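(* There is an algorithm that, given any full-rank $\mathbf{A} \in \mathbb{R}^{n \times d}$ with $n \ge d$, any $b \in \mathbb{R}^n$, any $p \ge 2$ and any $\varepsilon > 0$, with high probability returns an $\varepsilon$-accurate solution to $\ell_p$ regression, i.e. a vector $y \in \mathbb{R}^d$ with $\|\mathbf{A} y - b\|_p \le (1+\varepsilon)\min_{x \in \mathbb{R}^d}\|\mathbf{A} x - b\|_p$, in time $\widetilde{O}_p\big(d^{\frac{p-2}{3p-2}} \cdot \mathcal{T}_{\mathbf{A}}\big)$.
   Context: $\mathcal{T}_{\mathbf{A}}$ denotes the time to (exactly) solve a linear system in a matrix of the form $\mathbf{A}^\top \mathbf{D} \mathbf{A}$, where $\mathbf{D}$ is a positive diagonal matrix. The notation $\widetilde{O}_p(\cdot)$ hides factors polynomial in $\log n$ and $\log(1/\varepsilon)$ as well as constants depending only on $p$. "With high probability" means with probability at least $1 - n^{-C}$ for any constant $C$. *)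

theory Defs
  imports
    "Jordan_Normal_Form.DL_Rank"
    "HOL-Probability.Probability_Mass_Function"
begin

definition lp_norm :: "real \<Rightarrow> real Matrix.vec \<Rightarrow> real" where
  "lp_norm p x = (\<Sum>i<dim_vec x. \<bar>vec_index x i\<bar> powr p) powr (1 / p)"

text \<open>The minimum is written as an infimum; it is attained, since the range of \<open>A\<close> is a
  finite-dimensional subspace.\<close>

definition accurate_lp_solution ::
    "real \<Rightarrow> real \<Rightarrow> real mat \<Rightarrow> real Matrix.vec \<Rightarrow> real Matrix.vec \<Rightarrow> bool" where
  "accurate_lp_solution p \<epsilon> A b y \<longleftrightarrow>
     y \<in> carrier_vec (dim_col A) \<and>
     lp_norm p (A *\<^sub>v y - b)
       \<le> (1 + \<epsilon>) * (INF x \<in> carrier_vec (dim_col A). lp_norm p (A *\<^sub>v x - b))"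

definition support_list :: "real mat \<Rightarrow> (nat \<times> nat) list" where
  "support_list A =
     filter (\<lambda>ij. A $$ ij \<noteq> 0) (List.product [0..<dim_row A] [0..<dim_col A])"

definition nnz :: "real mat \<Rightarrow> nat" where
  "nnz A = length (support_list A)"


text \<open>
  Model of computation: a randomized real RAM with unit-cost exact real arithmetic, in the form of
  a while language. The memory consists of arrays of natural numbers and arrays of reals; array
  names are constants of the program text, array indices are computed. Finitely many arrays occur
  in a program, and its expressions have bounded size, so charging one unit per executed command
  counts elementary operations up to a constant factor.

  To keep the unit-cost measure honest, natural numbers have no multiplication, there is no
  conversion from reals to natural numbers, and the only constants are natural numbers (a real
  constant could carry an infinite amount of advice). Real powers are primitive because
  \<open>\<ell>\<^sub>p\<close> norms with real \<open>p\<close> could not be evaluated otherwise.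
\<close>

record store =
  nats :: "nat \<Rightarrow> nat \<Rightarrow> nat"
  reals :: "nat \<Rightarrow> nat \<Rightarrow> real"

datatype nexp =
    NConst nat
  | NRead nat nexp
  | NAdd nexp nexp
  | NSub nexp nexp

datatype rexp =
    ROfNat nexp
  | RRead nat nexp
  | RAdd rexp rexp
  | RSub rexp rexp
  | RMul rexp rexp
  | RDiv rexp rexp
  | RPowr rexp rexp

datatype bexp =
    NLess nexp nexp
  | RLess rexp rexp
  | BNot bexp
  | BAnd bexp bexp

fun nval :: "nexp \<Rightarrow> store \<Rightarrow> nat" where
  "nval (NConst k) s = k"
| "nval (NRead a e) s = nats s a (nval e s)"
| "nval (NAdd e f) s = nval e s + nval f s"
| "nval (NSub e f) s = nval e s - nval f s"

fun rval :: "rexp \<Rightarrow> store \<Rightarrow> real" where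
  "rval (ROfNat e) s = real (nval e s)"
| "rval (RRead a e) s = reals s a (nval e s)"
| "rval (RAdd e f) s = rval e s + rval f s"
| "rval (RSub e f) s = rval e s - rval f s"
| "rval (RMul e f) s = rval e s * rval f s"
| "rval (RDiv e f) s = rval e s / rval f s"
| "rval (RPowr e f) s = (if rval e s > 0 then rval e s powr rval f s else 0)"

fun bval :: "bexp \<Rightarrow> store \<Rightarrow> bool" where
  "bval (NLess e f) s \<longleftrightarrow> nval e s < nval f s"
| "bval (RLess e f) s \<longleftrightarrow> rval e s < rval f s"
| "bval (BNot b) s \<longleftrightarrow> \<not> bval b s"
| "bval (BAnd b c) s \<longleftrightarrow> bval b s \<and> bval c s"

definition write_nat :: "nat \<Rightarrow> nat \<Rightarrow> nat \<Rightarrow> store \<Rightarrow> store" where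
  "write_nat a i k s = s\<lparr>nats := (nats s)(a := (nats s a)(i := k))\<rparr>"

definition write_real :: "nat \<Rightarrow> nat \<Rightarrow> real \<Rightarrow> store \<Rightarrow> store" where
  "write_real a i x s = s\<lparr>reals := (reals s)(a := (reals s a)(i := x))\<rparr>"

definition read_vec :: "nat \<Rightarrow> nat \<Rightarrow> store \<Rightarrow> real Matrix.vec" where
  "read_vec m a s = Matrix.vec m (reals s a)"

definition write_vec :: "nat \<Rightarrow> real Matrix.vec \<Rightarrow> store \<Rightarrow> store" where
  "write_vec a x s = s\<lparr>reals := (reals s)(a :=
     (\<lambda>i. if i < dim_vec x then vec_index x i else reals s a i))\<rparr>"

text \<open>\<open>Solve w v x\<close> solves the system with matrix \<open>A\<^sup>T D A\<close>, where the diagonal of \<open>D\<close> and the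
  right-hand side are stored in the arrays \<open>w\<close> and \<open>v\<close>, and puts the solution into the array
  \<open>x\<close>. \<open>Flip a i\<close> stores a fair random bit.\<close>

datatype com =
    SKIP
  | NAssign nat nexp nexp
  | RAssign nat nexp rexp
  | Flip nat nexp
  | Solve nat nat nat
  | Seq com com
  | Cond bexp com com
  | While bexp com

definition weighted_gram :: "real mat \<Rightarrow> (nat \<Rightarrow> real) \<Rightarrow> real mat" where
  "weighted_gram A w = transpose_mat A * mat_diag (dim_row A) w * A"

text \<open>The solver only accepts positive diagonal matrices; the system then has exactly one solution
  whenever \<open>A\<close> has full column rank.\<close>

definition solve_effect :: "real mat \<Rightarrow> nat \<Rightarrow> nat \<Rightarrow> nat \<Rightarrow> store \<Rightarrow> store" where
  "solve_effect A w v x s =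
     (if \<forall>i<dim_row A. reals s w i > 0
      then write_vec x
        (THE z. z \<in> carrier_vec (dim_col A) \<and>
           weighted_gram A (reals s w) *\<^sub>v z = read_vec (dim_col A) v s) s
      else s)"

text \<open>The time \<open>\<T>\<^sub>A\<close> of one system solve. A solver has to read its input, i.e. the nonzero
  entries of \<open>A\<close>, the diagonal of \<open>D\<close> and the right-hand side; \<open>\<tau>\<close> is the time it spends beyond
  that, and is otherwise arbitrary.\<close>

definition solve_time :: "real mat \<Rightarrow> nat \<Rightarrow> nat" where
  "solve_time A \<tau> = nnz A + dim_row A + dim_col A + \<tau>"

text \<open>A configuration consists of the commands still to be executed, the memory, and the time
  used so far.\<close>

type_synonym config = "com list \<times> store \<times> nat"

fun step :: "real mat \<Rightarrow> nat \<Rightarrow> config \<Rightarrow> config pmf" where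
  "step A \<tau> ([], s, t) = return_pmf ([], s, t)"
| "step A \<tau> (SKIP # cs, s, t) = return_pmf (cs, s, t + 1)"
| "step A \<tau> (NAssign a i e # cs, s, t) =
     return_pmf (cs, write_nat a (nval i s) (nval e s) s, t + 1)"
| "step A \<tau> (RAssign a i e # cs, s, t) =
     return_pmf (cs, write_real a (nval i s) (rval e s) s, t + 1)"
| "step A \<tau> (Flip a i # cs, s, t) =
     map_pmf (\<lambda>c. (cs, write_nat a (nval i s) (of_bool c) s, t + 1)) (bernoulli_pmf (1 / 2))"
| "step A \<tau> (Solve w v x # cs, s, t) =
     return_pmf (cs, solve_effect A w v x s, t + solve_time A \<tau>)"
| "step A \<tau> (Seq c1 c2 # cs, s, t) = return_pmf (c1 # c2 # cs, s, t + 1)"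
| "step A \<tau> (Cond b c1 c2 # cs, s, t) =
     return_pmf ((if bval b s then c1 else c2) # cs, s, t + 1)"
| "step A \<tau> (While b c # cs, s, t) =
     return_pmf ((if bval b s then c # While b c # cs else cs), s, t + 1)"

fun run :: "real mat \<Rightarrow> nat \<Rightarrow> nat \<Rightarrow> config \<Rightarrow> config pmf" where
  "run A \<tau> 0 cfg = return_pmf cfg"
| "run A \<tau> (Suc m) cfg = bind_pmf (step A \<tau> cfg) (run A \<tau> m)"

text \<open>The input: \<open>n\<close>, \<open>d\<close> and the number of nonzero entries of \<open>A\<close>; the row and column indices and
  the values of these entries; \<open>p\<close> and \<open>\<epsilon>\<close>; the vector \<open>b\<close>. The dense array of all \<open>n d\<close> entries
  would be too large to be read in the time \<open>\<T>\<^sub>A\<close>. All other memory cells are \<open>0\<close>.\<close>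

definition input_store ::
    "real mat \<Rightarrow> real Matrix.vec \<Rightarrow> real \<Rightarrow> real \<Rightarrow> store" where
  "input_store A b p \<epsilon> =
     \<lparr>nats = (\<lambda>a i.
        if a = 0 \<and> i = 0 then dim_row A
        else if a = 0 \<and> i = 1 then dim_col A
        else if a = 0 \<and> i = 2 then nnz A
        else if a = 1 \<and> i < nnz A then fst (support_list A ! i)
        else if a = 2 \<and> i < nnz A then snd (support_list A ! i)
        else 0),
      reals = (\<lambda>a i.
        if a = 0 \<and> i = 0 then p
        else if a = 0 \<and> i = 1 then \<epsilon>
        else if a = 1 \<and> i < dim_vec b then vec_index b i
        else if a = 2 \<and> i < nnz A then A $$ (support_list A ! i)
        else 0)\<rparr>"

definition output_vec :: "nat \<Rightarrow> store \<Rightarrow> real Matrix.vec" where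
  "output_vec d s = read_vec d 3 s"

text \<open>Halted configurations are absorbing and (for nonempty \<open>A\<close>) every other step takes time, so
  for any \<open>B\<close> the probability of having halted within time \<open>B\<close> with a result in \<open>Q\<close> is nondecreasing
  in the number \<open>m\<close> of steps and constant from \<open>m = \<lfloor>B\<rfloor>\<close> on.\<close>

definition prob_returns_within ::
    "real mat \<Rightarrow> nat \<Rightarrow> com \<Rightarrow> store \<Rightarrow> real \<Rightarrow> (real Matrix.vec \<Rightarrow> bool) \<Rightarrow> real" where
  "prob_returns_within A \<tau> P s B Q =
     (SUP m. measure_pmf.prob (run A \<tau> m ([P], s, 0))
        {(cs, s', t). cs = [] \<and> real t \<le> B \<and> Q (output_vec (dim_col A) s')})"

text \<open>A polynomial in \<open>log n\<close> and \<open>log (1/\<epsilon>)\<close> is at most a constant times a power of this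
  quantity. The summand \<open>1\<close> and the maximum only matter for \<open>n = 1\<close> and \<open>\<epsilon> \<ge> 1\<close>, where the logarithms
  are not positive.\<close>

definition log_factor :: "nat \<Rightarrow> real \<Rightarrow> real" where
  "log_factor n \<epsilon> = 1 + ln (real n) + max 0 (ln (1 / \<epsilon>))"

end

theory Submission
  imports Defs
begin

text \<open>
  The algorithm computes a one-sided approximation of the \<open>\<ell>\<^sub>p\<close> Lewis weights of \<open>A\<close> and then minimizes
  \<open>f(x) = \<parallel>Ax - b\<parallel>\<^sub>p\<^sup>p\<close> by iterative refinement, starting from the least squares solution.

  Lewis weights: from \<open>w = d/n\<close> iterate \<open>v = w\<^bsup>1 - 2/p\<^esup>\<close>, \<open>w \<leftarrow>\<close> leverage scores of \<open>V\<^bsup>1/2\<^esup>A\<close>, and average the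
  \<open>v\<close>. With \<open>h\<^sub>i(v) = a\<^sub>i\<^sup>T(A\<^sup>TVA)\<^sup>-\<^sup>1a\<^sub>i\<close>, the function \<open>1/h\<^sub>i\<close> is concave in \<open>v\<close>, so \<open>log n\<close> rounds give
  \<open>h\<^sub>i(v) = O(v\<^sub>i\<^bsup>2/(p-2)\<^esup>)\<close> for the average, i.e. \<open>\<parallel>Ax\<parallel>\<^sub>p = O(\<parallel>V\<^bsup>1/2\<^esup>Ax\<parallel>\<^sub>2)\<close>, while Hoelder's inequality
  bounds \<open>\<parallel>V\<^bsup>1/2\<^esup>Ax\<parallel>\<^sub>2\<close> by \<open>O(d\<^bsup>1/2 - 1/p\<^esup>)\<parallel>Ax\<parallel>\<^sub>p\<close> up to logarithms. Leverage scores are only needed up to a constant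
  factor from below and in sum from above, so the maximum of \<open>O(log n)\<close> squared random sign sums
  suffices (second and fourth moments).

  Refinement: \<open>f(x) - f(x - \<Delta>)\<close> agrees up to constants in \<open>p\<close> with
  \<open>g\<cdot>\<Delta> - (\<parallel>A\<Delta>\<parallel>\<^sup>2\<^sub>D + \<parallel>A\<Delta>\<parallel>\<^sub>p\<^sup>p)\<close>, \<open>D = |Ax - b|\<^bsup>p-2\<^esup>\<close>. If the gap to the optimum is about \<open>\<nu>\<close>, some \<open>\<Delta>\<close> with
  \<open>g\<cdot>\<Delta> = \<nu>/2\<close> makes both penalties \<open>O(\<nu>)\<close>. Such a \<open>\<Delta>\<close> is found as an average of minimizers of
  weighted quadratic forms with weights \<open>D + r\<close>. If the minimizer \<open>\<Delta>\<close> has small \<open>\<ell>\<^sub>p\<close> norm it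
  is added to the average and \<open>r\<close> grows with the sum of the \<open>|A\<Delta>|\<close>; otherwise \<open>r\<close> is increased by a
  multiple of \<open>|A\<Delta>|\<^bsup>p-2\<^esup>\<close>, which by the Lewis weight property is dominated by the present quadratic form and
  hence raises the minimal energy substantially. The energy stays bounded, so
  \<open>O(d\<^bsup>(p-2)/(3p-2)\<^esup>)\<close> steps of both kinds together suffice.
\<close>

section \<open>Power inequalities\<close>

text \<open>The exponent (p-2)/(3p-2) comes from balancing the two kinds of steps. Let t be a times
  the p-th power of the norm of A\<Delta>. With about \<iota> primal steps of length \<alpha> ~
  1/\<iota>, the potential, the sum of the u_i^p, may grow by O(\<alpha>) per step; its term
  \<alpha>^p t stays below \<alpha> exactly up to the threshold \<tau> = \<alpha>^(1-p) ~
  \<iota>^(p-1). A larger t triggers a width step, which raises an energy bounded by 4 by at least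
  \<tau>^(2/p) / (2\<Lambda>), where \<Lambda> is the distortion between the p-norm and the Lewis
  quadratic form. So there are O(\<Lambda> / \<iota>^(2(p-1)/p)) width steps, and at most \<iota>/2
  once \<Lambda> \<le> \<iota>^((3p-2)/p). Lewis weights give \<Lambda> = d^((p-2)/p) up to
  logarithms, hence \<iota> = d^((p-2)/(3p-2)) up to logarithms. Randomness enters only through the
  leverage estimates. Their sum is bounded by construction, so underestimating some row is the only
  bad event, and the probability bound is a union bound over rounds and rows. The gap bound \<nu>
  may be far too large, but needs no test: a gap below \<nu>/2 is already within the next
  bound.\<close>

lemma powr_tangent:
  fixes x a h :: real
  assumes "0 \<le> x" "0 \<le> a" "1 \<le> h"
  shows "a powr h + h * a powr (h - 1) * (x - a) \<le> x powr h"
proof (cases "a = 0 \<or> x = 0")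
  case True
  then show ?thesis
  proof
    assume "a = 0"
    \<comment> \<open>\<open>0 powr 0\<close> is \<open>0\<close>, so the left-hand side vanishes
      also for \<open>h = 1\<close>.\<close>
    then show ?thesis by simp
  next
    assume x: "x = 0"
    show ?thesis
    proof (cases "a = 0")
      case False
      then have "a powr (h - 1) * a = a powr h"
        using assms by (simp add: powr_mult_base mult.commute)
      then have "a powr h + h * a powr (h - 1) * (x - a) = (1 - h) * a powr h"
        using x by (simp add: algebra_simps)
      also have "\<dots> \<le> 0"
        using assms by (simp add: mult_nonpos_nonneg)
      finally show ?thesis using x by simp
    qed simp
  qed
next
  case False
  then have pos: "0 < x" "0 < a" using assms by auto
  \<comment> \<open>Young's inequality with weights \<open>1 / h\<close> and
    \<open>1 - 1 / h\<close> is the tangent inequality of the convex power, read as a bound on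
    \<open>x * a powr (h - 1)\<close>.\<close>
  have "(x powr h) powr (1 / h) * (a powr h) powr (1 - 1 / h)
        \<le> (1 / h) * x powr h + (1 - 1 / h) * a powr h"
    by (rule Youngs_inequality_0) (use assms pos in auto)
  moreover have "(x powr h) powr (1 / h) = x" "(a powr h) powr (1 - 1 / h) = a powr (h - 1)"
    using assms pos by (simp_all add: powr_powr right_diff_distrib)
  ultimately have "h * (x * a powr (h - 1)) \<le> h * ((1 / h) * x powr h + (1 - 1 / h) * a powr h)"
    using assms by (intro mult_left_mono) auto
  also have "\<dots> = x powr h + (h - 1) * a powr h"
    using assms by (simp add: field_simps)
  finally have "h * (x * a powr (h - 1)) \<le> x powr h + (h - 1) * a powr h" .
  moreover have "a powr (h - 1) * a = a powr h"
    using pos by (simp add: powr_mult_base mult.commute)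
  ultimately show ?thesis by (simp add: algebra_simps)
qed

text \<open>Both summands have the form \<open>u * u powr (h - 1)\<close>, and the second factor
  only grows when its base \<open>u\<close> is replaced by \<open>x + y\<close>.\<close>

lemma powr_superadditive:
  fixes x y h :: real
  assumes "0 \<le> x" "0 \<le> y" "1 \<le> h"
  shows "x powr h + y powr h \<le> (x + y) powr h"
proof -
  have *: "u powr h \<le> u * (x + y) powr (h - 1)" if "0 \<le> u" "u \<le> x + y" for u
  proof (cases "u = 0")
    case False
    then have "u powr h = u * u powr (h - 1)"
      using that by (simp add: powr_mult_base)
    also have "\<dots> \<le> u * (x + y) powr (h - 1)"
      using that assms by (intro mult_left_mono powr_mono2) auto
    finally show ?thesis .
  qed simp
  have "x powr h + y powr h \<le> x * (x + y) powr (h - 1) + y * (x + y) powr (h - 1)"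
    using *[of x] *[of y] assms by simp
  also have "\<dots> = (x + y) powr h"
    using assms by (cases "x + y = 0") (simp_all add: powr_mult_base flip: distrib_right)
  finally show ?thesis .
qed

lemma powr_midpoint:
  fixes x y h :: real
  assumes "0 \<le> x" "0 \<le> y" "1 \<le> h"
  shows "((x + y) / 2) powr h \<le> (x powr h + y powr h) / 2"
  using powr_tangent[of x "(x + y) / 2" h] powr_tangent[of y "(x + y) / 2" h] assms
  by (simp add: field_simps)

lemma square_powr: "(x * x) powr q = \<bar>x::real\<bar> powr (2 * q)"
proof -
  have "x * x = \<bar>x\<bar> powr 2"
    by (cases "x = 0") (simp_all add: powr_numeral power2_eq_square)
  then show ?thesis by (simp only: powr_powr)
qed

lemma abs_powr_diff_two: "\<bar>x\<bar> powr (p - 2) * x\<^sup>2 = \<bar>x::real\<bar> powr p"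
proof (cases "x = 0")
  case False
  then have sq: "x\<^sup>2 = \<bar>x\<bar> powr 2" by (simp add: powr_numeral)
  show ?thesis unfolding sq by (simp only: powr_add[symmetric]) simp
qed simp

lemma powr_sum_le:
  fixes x y q :: real
  assumes "0 \<le> x" "0 \<le> y" "0 \<le> q"
  shows "(x + y) powr q \<le> 2 powr q * (x powr q + y powr q)"
proof -
  have "(x + y) powr q \<le> (2 * max x y) powr q"
    using assms by (intro powr_mono2) auto
  also have "\<dots> = 2 powr q * max x y powr q"
    using assms by (simp add: powr_mult)
  also have "\<dots> \<le> 2 powr q * (x powr q + y powr q)"
    by (intro mult_left_mono) (auto simp: max_def)
  finally show ?thesis .
qed

text \<open>The tangent inequality is applied to the power \<open>p / 2\<close> at the point
  \<open>a\<^sup>2\<close>; the increment \<open>(a + t)\<^sup>2 - a\<^sup>2\<close> produces the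
  linear and the quadratic term at once.\<close>

lemma abs_powr_quadratic_lower:
  fixes a t p :: real
  assumes "2 \<le> p"
  shows "\<bar>a\<bar> powr p + p * \<bar>a\<bar> powr (p - 2) * a * t + (p / 2) * \<bar>a\<bar> powr (p - 2) * t\<^sup>2
    \<le> \<bar>a + t\<bar> powr p"
proof -
  have "(a * a) powr (p / 2) + (p / 2) * (a * a) powr (p / 2 - 1) * ((a + t) * (a + t) - a * a)
      \<le> ((a + t) * (a + t)) powr (p / 2)"
    using assms by (intro powr_tangent) auto
  moreover have "(a * a) powr (p / 2 - 1) = \<bar>a\<bar> powr (p - 2)"
    "(a * a) powr (p / 2) = \<bar>a\<bar> powr p" "((a + t) * (a + t)) powr (p / 2) = \<bar>a + t\<bar> powr p"
    by (simp_all only: square_powr right_diff_distrib) simp_all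
  moreover have "(p / 2) * \<bar>a\<bar> powr (p - 2) * ((a + t) * (a + t) - a * a)
      = p * \<bar>a\<bar> powr (p - 2) * a * t + (p / 2) * \<bar>a\<bar> powr (p - 2) * t\<^sup>2"
    by (simp add: field_simps power2_eq_square)
  ultimately show ?thesis by (simp only: add.assoc)
qed

lemma abs_powr_tangent:
  fixes a t p :: real
  assumes "2 \<le> p"
  shows "\<bar>a\<bar> powr p + p * \<bar>a\<bar> powr (p - 2) * a * t \<le> \<bar>a + t\<bar> powr p"
proof -
  have "0 \<le> (p / 2) * \<bar>a\<bar> powr (p - 2) * t\<^sup>2" using assms by simp
  then show ?thesis using abs_powr_quadratic_lower[OF assms, of a t] by linarith
qed

text \<open>Superadditivity of the power \<open>p / 2\<close>, the parallelogram identity, and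
  convexity of the same power.\<close>

lemma clarkson_scalar:
  fixes x y p :: real
  assumes "2 \<le> p"
  shows "\<bar>(x + y) / 2\<bar> powr p + \<bar>(x - y) / 2\<bar> powr p \<le> (\<bar>x\<bar> powr p + \<bar>y\<bar> powr p) / 2"
proof -
  let ?A = "(x + y) / 2" and ?B = "(x - y) / 2"
  have "(?A * ?A) powr (p / 2) + (?B * ?B) powr (p / 2) \<le> (?A * ?A + ?B * ?B) powr (p / 2)"
    using assms by (intro powr_superadditive) auto
  also have "?A * ?A + ?B * ?B = (x * x + y * y) / 2"
    by (simp add: field_simps)
  also have "\<dots> powr (p / 2) \<le> ((x * x) powr (p / 2) + (y * y) powr (p / 2)) / 2"
    using assms by (intro powr_midpoint) auto
  finally show ?thesis by (simp only: square_powr) simp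
qed

text \<open>The quadratic term comes from \<open>abs_powr_quadratic_lower\<close>, the
  \<open>p\<close>-th power of \<open>t\<close> from \<open>clarkson_scalar\<close> for
  \<open>a + t\<close> and \<open>a\<close> together with the tangent at \<open>a\<close>. The claim
  follows by averaging the two bounds.\<close>

lemma abs_powr_expand_lower:
  fixes a t p :: real
  assumes "2 \<le> p"
  shows "\<bar>a\<bar> powr p + p * \<bar>a\<bar> powr (p - 2) * a * t
      + 2 powr (- p) * (\<bar>a\<bar> powr (p - 2) * t\<^sup>2 + \<bar>t\<bar> powr p) \<le> \<bar>a + t\<bar> powr p"
proof -
  have q: "\<bar>a\<bar> powr p + p * \<bar>a\<bar> powr (p - 2) * a * t + (p / 2) * \<bar>a\<bar> powr (p - 2) * t\<^sup>2
    \<le> \<bar>a + t\<bar> powr p" by (rule abs_powr_quadratic_lower[OF assms])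
  have "\<bar>a\<bar> powr p + p * \<bar>a\<bar> powr (p - 2) * a * (t / 2) \<le> \<bar>a + t / 2\<bar> powr p"
    by (rule abs_powr_tangent[OF assms])
  moreover have "\<bar>a + t / 2\<bar> powr p + \<bar>t / 2\<bar> powr p \<le> (\<bar>a + t\<bar> powr p + \<bar>a\<bar> powr p) / 2"
    using clarkson_scalar[OF assms, of "a + t" a] by (simp add: field_simps)
  moreover have "\<bar>t / 2\<bar> powr p = 2 powr (- p) * \<bar>t\<bar> powr p"
    by (simp add: powr_divide powr_minus divide_simps)
  ultimately have c: "\<bar>a\<bar> powr p + p * \<bar>a\<bar> powr (p - 2) * a * t + 2 * (2 powr (- p) * \<bar>t\<bar> powr p)
      \<le> \<bar>a + t\<bar> powr p" by (simp add: field_simps)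
  have "2 powr (- p) \<le> (2::real) powr (-2)" using assms by (intro powr_mono) auto
  also have "\<dots> = 1 / 4" by (simp add: powr_minus powr_numeral)
  also have "\<dots> \<le> p / 4" using assms by simp
  finally have "2 powr (- p) * (\<bar>a\<bar> powr (p - 2) * t\<^sup>2) \<le> (p / 4) * (\<bar>a\<bar> powr (p - 2) * t\<^sup>2)"
    by (intro mult_right_mono) auto
  then show ?thesis using q c by (simp add: distrib_left)
qed

text \<open>The tangent at \<open>a + t\<close> bounds the excess over the linear term by
  \<open>p * (\<psi> (a + t) - \<psi> a) * t\<close>, where \<open>\<psi>\<close> is the derivative
  of \<open>\<bar>y\<bar> powr p / p\<close>; what remains is the growth of
  \<open>\<psi>\<close>.\<close>

lemma abs_powr_expand_upper:
  fixes a t p :: real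
  assumes "2 \<le> p"
  shows "\<bar>a + t\<bar> powr p \<le> \<bar>a\<bar> powr p + p * \<bar>a\<bar> powr (p - 2) * a * t
      + p\<^sup>2 * 2 powr p * (\<bar>a\<bar> powr (p - 2) * t\<^sup>2 + \<bar>t\<bar> powr p)"
proof -
  define \<psi> where "\<psi> y = \<bar>y\<bar> powr (p - 2) * y" for y :: real
  have \<psi>pos: "\<psi> y = y powr (p - 1)" if "0 \<le> y" for y
  proof -
    have "y powr (1 + (p - 2)) = y * y powr (p - 2)" using that by (simp only: powr_mult_base)
    moreover have "1 + (p - 2) = p - 1" by simp
    ultimately show ?thesis using that unfolding \<psi>_def by (metis abs_of_nonneg mult.commute)
  qed
  have \<psi>neg: "\<psi> (- y) = - \<psi> y" for y unfolding \<psi>_def by simp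
  have mono: "(\<psi> y - \<psi> x) * (y - x) \<le> (p - 1) * (max y x powr (p - 2) * (y - x)\<^sup>2)"
    if "0 \<le> x" "0 \<le> y" for x y
  proof -
    have *: "(v powr (p - 1) - u powr (p - 1)) * (v - u) \<le> (p - 1) * (v powr (p - 2) * (v - u)\<^sup>2)"
      if "0 \<le> u" "u \<le> v" for u v
    proof -
      have "v powr (p - 1) - u powr (p - 1) \<le> (p - 1) * v powr (p - 2) * (v - u)"
        using powr_tangent[of u v "p - 1"] that assms by (simp add: algebra_simps)
      then have "(v powr (p - 1) - u powr (p - 1)) * (v - u) \<le> (p - 1) * v powr (p - 2) * (v - u) * (v - u)"
        using that by (intro mult_right_mono) auto
      then show ?thesis by (simp add: power2_eq_square mult.assoc)
    qed
    show ?thesis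
    proof (cases "x \<le> y")
      case True
      then show ?thesis using *[of x y] that by (simp add: \<psi>pos max_def)
    next
      case False
      then show ?thesis using *[of y x] that by (simp add: \<psi>pos max_def algebra_simps power2_eq_square)
    qed
  qed
  have same: "(\<psi> (a + t) - \<psi> a) * t \<le> p * 2 powr p * (\<bar>a\<bar> powr (p - 2) * t\<^sup>2 + \<bar>t\<bar> powr p)" if "0 \<le> a" "0 \<le> a + t" for a t
  proof -
    have "(\<psi> (a + t) - \<psi> a) * t \<le> (p - 1) * (max (a + t) a powr (p - 2) * t\<^sup>2)"
      using mono[of a "a + t"] that by simp
    also have "\<dots> \<le> p * ((\<bar>a\<bar> + \<bar>t\<bar>) powr (p - 2) * t\<^sup>2)"
      using assms that by (intro mult_mono powr_mono2) auto
    also have "\<dots> \<le> p * ((2 powr (p - 2) * (\<bar>a\<bar> powr (p - 2) + \<bar>t\<bar> powr (p - 2))) * t\<^sup>2)"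
      using assms by (intro mult_left_mono mult_right_mono powr_sum_le) auto
    also have "\<dots> = p * 2 powr (p - 2) * (\<bar>a\<bar> powr (p - 2) * t\<^sup>2 + \<bar>t\<bar> powr p)"
      by (simp add: algebra_simps abs_powr_diff_two[of t p, symmetric])
    also have "\<dots> \<le> p * 2 powr p * (\<bar>a\<bar> powr (p - 2) * t\<^sup>2 + \<bar>t\<bar> powr p)"
      using assms by (intro mult_right_mono mult_left_mono powr_mono) auto
    finally show ?thesis .
  qed
  \<comment> \<open>If the sign changes between \<open>a\<close> and \<open>a + t\<close>, both are
    at most \<open>\<bar>t\<bar>\<close> in absolute value, and bounding the two values of
    \<open>\<psi>\<close> separately is enough.\<close>
  have opp: "(\<psi> (a + t) - \<psi> a) * t \<le> p * 2 powr p * (\<bar>a\<bar> powr (p - 2) * t\<^sup>2 + \<bar>t\<bar> powr p)" if "0 \<le> a" "a + t < 0" for a t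
  proof -
    have b: "\<bar>\<psi> y\<bar> \<le> \<bar>t\<bar> powr (p - 1)" if "\<bar>y\<bar> \<le> \<bar>t\<bar>" for y
    proof -
      have "\<bar>\<psi> y\<bar> = \<psi> \<bar>y\<bar>" unfolding \<psi>_def by (simp add: abs_mult)
      also have "\<dots> = \<bar>y\<bar> powr (p - 1)" by (simp add: \<psi>pos)
      also have "\<dots> \<le> \<bar>t\<bar> powr (p - 1)" using that assms by (intro powr_mono2) auto
      finally show ?thesis .
    qed
    have "(\<psi> (a + t) - \<psi> a) * t \<le> \<bar>\<psi> (a + t) - \<psi> a\<bar> * \<bar>t\<bar>"
      by (metis abs_ge_self abs_mult)
    also have "\<dots> \<le> (2 * \<bar>t\<bar> powr (p - 1)) * \<bar>t\<bar>"
      using b[of "a + t"] b[of a] that by (intro mult_right_mono) auto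
    also have "\<dots> = 2 * \<bar>t\<bar> powr p"
      by (cases "t = 0") (simp_all add: powr_mult_base mult.commute)
    also have "\<dots> \<le> p * 2 powr p * \<bar>t\<bar> powr p"
    proof (intro mult_right_mono)
      have "(1::real) = 2 powr 0" by simp
      also have "\<dots> \<le> 2 powr p" using assms by (intro powr_mono) auto
      finally have "2 * 1 \<le> p * 2 powr p" using assms by (intro mult_mono) auto
      then show "2 \<le> p * 2 powr p" by simp
    qed simp
    also have "\<dots> \<le> p * 2 powr p * (\<bar>a\<bar> powr (p - 2) * t\<^sup>2 + \<bar>t\<bar> powr p)"
      using assms by (intro mult_left_mono) auto
    finally show ?thesis .
  qed
  have pos: "(\<psi> (a + t) - \<psi> a) * t \<le> p * 2 powr p * (\<bar>a\<bar> powr (p - 2) * t\<^sup>2 + \<bar>t\<bar> powr p)" if "0 \<le> a" for a t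
    using same[of a t] opp[of a t] that by fastforce
  have "(\<psi> (a + t) - \<psi> a) * t \<le> p * 2 powr p * (\<bar>a\<bar> powr (p - 2) * t\<^sup>2 + \<bar>t\<bar> powr p)"
  proof (cases "0 \<le> a")
    case False
    then have "(\<psi> (- a + - t) - \<psi> (- a)) * (- t) \<le> p * 2 powr p * (\<bar>a\<bar> powr (p - 2) * t\<^sup>2 + \<bar>t\<bar> powr p)"
      using pos[of "- a" "- t"] by simp
    moreover have "\<psi> (- a + - t) = - \<psi> (a + t)" using \<psi>neg[of "a + t"] by simp
    ultimately show ?thesis using \<psi>neg[of a] by (simp add: algebra_simps)
  qed (rule pos)
  then have "p * ((\<psi> (a + t) - \<psi> a) * t) \<le> p * (p * 2 powr p * (\<bar>a\<bar> powr (p - 2) * t\<^sup>2 + \<bar>t\<bar> powr p))"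
    using assms by (intro mult_left_mono) auto
  moreover have "\<bar>a + t\<bar> powr p + p * \<psi> (a + t) * (- t) \<le> \<bar>a\<bar> powr p"
    using abs_powr_tangent[OF assms, of "a + t" "- t"] unfolding \<psi>_def by (simp add: mult.assoc)
  ultimately show ?thesis unfolding \<psi>_def by (simp add: algebra_simps power2_eq_square)
qed

text \<open>Controls the growth of the potential in a primal step, where \<open>b\<close> is the
  small increment. The tangent is taken at \<open>a + b\<close>, and \<open>powr_sum_le\<close>
  splits its slope.\<close>

lemma powr_add_le:
  fixes a b p :: real
  assumes "0 \<le> a" "0 \<le> b" "2 \<le> p"
  shows "(a + b) powr p \<le> a powr p + p * 2 powr p * (a powr (p - 1) * b + b powr p)"
proof -
  have b: "b powr (p - 1) * b = b powr p"
    using assms by (cases "b = 0") (simp_all add: powr_mult_base mult.commute)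
  have "(a + b) powr p \<le> a powr p + p * (a + b) powr (p - 1) * b"
    using powr_tangent[of a "a + b" p] assms by simp
  also have "p * (a + b) powr (p - 1) * b
      \<le> p * (2 powr (p - 1) * (a powr (p - 1) + b powr (p - 1))) * b"
    using assms by (intro mult_right_mono mult_left_mono powr_sum_le) auto
  also have "\<dots> = p * 2 powr (p - 1) * (a powr (p - 1) * b + b powr p)"
    by (simp add: algebra_simps b[symmetric])
  also have "\<dots> \<le> p * 2 powr p * (a powr (p - 1) * b + b powr p)"
    using assms by (intro mult_right_mono mult_left_mono powr_mono) auto
  finally show ?thesis by simp
qed

text \<open>Hoelder's inequality for the exponents \<open>p / (p - 2)\<close> and
  \<open>p / 2\<close>: Young's inequality is summed after both families have been normalized to sum
  \<open>1\<close>.\<close>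

lemma holder_powr:
  fixes x y :: "'i \<Rightarrow> real" and p :: real
  assumes "finite I" "2 < p"
  shows "(\<Sum>i\<in>I. \<bar>y i\<bar> powr (p - 2) * (x i)\<^sup>2)
    \<le> (\<Sum>i\<in>I. \<bar>y i\<bar> powr p) powr ((p - 2) / p) * (\<Sum>i\<in>I. \<bar>x i\<bar> powr p) powr (2 / p)"
proof -
  let ?Y = "\<Sum>i\<in>I. \<bar>y i\<bar> powr p" and ?X = "\<Sum>i\<in>I. \<bar>x i\<bar> powr p"
  have nn: "0 \<le> ?X" "0 \<le> ?Y" by (auto intro: sum_nonneg)
  show ?thesis
  proof (cases "?X = 0 \<or> ?Y = 0")
    case True
    then have "(\<forall>i\<in>I. x i = 0) \<or> (\<forall>i\<in>I. y i = 0)"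
      using assms by (auto simp: sum_nonneg_eq_0_iff)
    then show ?thesis by (auto intro: sum.neutral)
  next
    case False
    then have pos: "0 < ?X" "0 < ?Y" using nn by auto
    have "\<bar>y i\<bar> powr (p - 2) * (x i)\<^sup>2
        \<le> ?Y powr ((p - 2) / p) * ?X powr (2 / p)
            * ((p - 2) / p * (\<bar>y i\<bar> powr p / ?Y) + 2 / p * (\<bar>x i\<bar> powr p / ?X))" for i
    proof (cases "x i = 0 \<or> y i = 0")
      case True
      then show ?thesis using assms nn by (auto intro!: mult_nonneg_nonneg add_nonneg_nonneg)
    next
      case False
      then have "(\<bar>y i\<bar> powr p / ?Y) powr ((p - 2) / p) * (\<bar>x i\<bar> powr p / ?X) powr (2 / p)
          \<le> (p - 2) / p * (\<bar>y i\<bar> powr p / ?Y) + 2 / p * (\<bar>x i\<bar> powr p / ?X)"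
        using assms pos by (intro Youngs_inequality_0) (auto simp: field_simps)
      moreover have "(\<bar>y i\<bar> powr p / ?Y) powr ((p - 2) / p) = \<bar>y i\<bar> powr (p - 2) / ?Y powr ((p - 2) / p)"
        using assms pos by (simp add: powr_divide powr_powr)
      moreover have "(\<bar>x i\<bar> powr p / ?X) powr (2 / p) = (x i)\<^sup>2 / ?X powr (2 / p)"
        using assms pos False by (simp add: powr_divide powr_powr powr_numeral)
      ultimately show ?thesis using pos by (simp add: field_simps)
    qed
    then have "(\<Sum>i\<in>I. \<bar>y i\<bar> powr (p - 2) * (x i)\<^sup>2)
      \<le> (\<Sum>i\<in>I. ?Y powr ((p - 2) / p) * ?X powr (2 / p)
            * ((p - 2) / p * (\<bar>y i\<bar> powr p / ?Y) + 2 / p * (\<bar>x i\<bar> powr p / ?X)))"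
      by (intro sum_mono)
    also have "\<dots> = ?Y powr ((p - 2) / p) * ?X powr (2 / p) * ((p - 2) / p * (?Y / ?Y) + 2 / p * (?X / ?X))"
      by (simp only: sum_distrib_left[symmetric] sum.distrib sum_divide_distrib[symmetric])
    also have "\<dots> = ?Y powr ((p - 2) / p) * ?X powr (2 / p)"
    proof -
      have "(p - 2) / p + 2 / p = 1" using assms by (simp add: field_simps)
      then show ?thesis using pos by simp
    qed
    finally show ?thesis .
  qed
qed

section \<open>Iterative refinement and width-reduced multiplicative weights\<close>

locale design =
  fixes n d :: nat and M :: "nat \<Rightarrow> nat \<Rightarrow> real"
begin

definition mv :: "(nat \<Rightarrow> real) \<Rightarrow> nat \<Rightarrow> real" where
  "mv x i = (\<Sum>j<d. M i j * x j)"

definition mt :: "(nat \<Rightarrow> real) \<Rightarrow> nat \<Rightarrow> real" where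
  "mt y j = (\<Sum>i<n. M i j * y i)"

definition dot :: "(nat \<Rightarrow> real) \<Rightarrow> (nat \<Rightarrow> real) \<Rightarrow> real" where
  "dot g x = (\<Sum>j<d. g j * x j)"

text \<open>The normal equations \<open>M\<^sup>T W M z = g\<close>, kept as a relation because
  existence and uniqueness of \<open>z\<close> come from the rank of \<open>M\<close>, which
  \<open>full_design\<close> supplies later.\<close>

definition nsol :: "(nat \<Rightarrow> real) \<Rightarrow> (nat \<Rightarrow> real) \<Rightarrow> (nat \<Rightarrow> real) \<Rightarrow> bool" where
  "nsol W g z \<longleftrightarrow> (\<forall>j<d. mt (\<lambda>i. W i * mv z i) j = g j)"

definition wsq :: "(nat \<Rightarrow> real) \<Rightarrow> (nat \<Rightarrow> real) \<Rightarrow> real" where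
  "wsq W y = (\<Sum>i<n. W i * (y i)\<^sup>2)"

definition pw :: "real \<Rightarrow> (nat \<Rightarrow> real) \<Rightarrow> real" where
  "pw p y = (\<Sum>i<n. \<bar>y i\<bar> powr p)"

text \<open>For \<open>p > 2\<close> and \<open>r \<ge> 0\<close> the least such \<open>c\<close> is the norm of \<open>r\<close> in \<open>\<ell>\<^sub>q\<close>, where
  \<open>q = p / (p - 2)\<close>.\<close>

definition hb :: "real \<Rightarrow> (nat \<Rightarrow> real) \<Rightarrow> real \<Rightarrow> bool" where
  "hb p r c \<longleftrightarrow> (\<forall>x. wsq r x \<le> c * pw p x powr (2 / p))"

lemma mv_cong: "(\<And>j. j < d \<Longrightarrow> x j = y j) \<Longrightarrow> mv x i = mv y i"
  unfolding mv_def by (intro sum.cong) auto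

lemma dot_cong: "(\<And>j. j < d \<Longrightarrow> g j = h j) \<Longrightarrow> (\<And>j. j < d \<Longrightarrow> x j = y j) \<Longrightarrow> dot g x = dot h y"
  unfolding dot_def by (intro sum.cong) auto

lemma wsq_cong: "(\<And>i. i < n \<Longrightarrow> V i = W i) \<Longrightarrow> (\<And>i. i < n \<Longrightarrow> x i = y i) \<Longrightarrow> wsq V x = wsq W y"
  unfolding wsq_def by (intro sum.cong) auto

lemma pw_cong: "(\<And>i. i < n \<Longrightarrow> x i = y i) \<Longrightarrow> pw p x = pw p y"
  unfolding pw_def by (intro sum.cong) auto

lemma hb_cong: "(\<And>i. i < n \<Longrightarrow> V i = W i) \<Longrightarrow> hb p V c \<longleftrightarrow> hb p W c"
  unfolding hb_def using wsq_cong[of V W] by auto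

lemma mv_scale: "mv (\<lambda>j. c * x j) i = c * mv x i"
  unfolding mv_def by (simp add: sum_distrib_left algebra_simps)

lemma mv_add: "mv (\<lambda>j. x j + y j) i = mv x i + mv y i"
  unfolding mv_def by (simp add: sum.distrib algebra_simps)

lemma mv_diff: "mv (\<lambda>j. x j - y j) i = mv x i - mv y i"
  unfolding mv_def by (simp add: sum_subtractf algebra_simps)

lemma dot_scale: "dot g (\<lambda>j. c * x j) = c * dot g x"
  unfolding dot_def by (simp add: sum_distrib_left algebra_simps)

lemma dot_add: "dot g (\<lambda>j. x j + y j) = dot g x + dot g y"
  unfolding dot_def by (simp add: sum.distrib algebra_simps)

lemma wsq_nonneg: "(\<And>i. i < n \<Longrightarrow> 0 \<le> W i) \<Longrightarrow> 0 \<le> wsq W y"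
  unfolding wsq_def by (intro sum_nonneg) auto

lemma pw_nonneg: "0 \<le> pw p y"
  unfolding pw_def by (intro sum_nonneg) auto

lemma wsq_add_left: "wsq (\<lambda>i. V i + W i) y = wsq V y + wsq W y"
  unfolding wsq_def by (simp add: sum.distrib algebra_simps)

lemma wsq_scale_left: "wsq (\<lambda>i. c * W i) y = c * wsq W y"
  unfolding wsq_def by (simp add: sum_distrib_left algebra_simps)

lemma wsq_scale: "wsq W (\<lambda>i. c * y i) = c\<^sup>2 * wsq W y"
  unfolding wsq_def by (simp add: sum_distrib_left power_mult_distrib algebra_simps)

lemma pw_scale: "pw p (\<lambda>i. c * y i) = \<bar>c\<bar> powr p * pw p y"
  unfolding pw_def by (simp add: sum_distrib_left abs_mult powr_mult)

lemma dot_mt: "dot (mt y) x = (\<Sum>i<n. y i * mv x i)"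
proof -
  have "dot (mt y) x = (\<Sum>j<d. \<Sum>i<n. M i j * y i * x j)"
    unfolding dot_def mt_def by (simp add: sum_distrib_right)
  also have "\<dots> = (\<Sum>i<n. \<Sum>j<d. M i j * y i * x j)" by (rule sum.swap)
  also have "\<dots> = (\<Sum>i<n. y i * mv x i)"
    unfolding mv_def by (simp add: sum_distrib_left algebra_simps)
  finally show ?thesis .
qed

lemma nsol_dot:
  assumes "nsol W g z"
  shows "dot g x = (\<Sum>i<n. W i * mv z i * mv x i)"
proof -
  have "dot g x = dot (mt (\<lambda>i. W i * mv z i)) x"
    using assms unfolding nsol_def by (intro dot_cong) auto
  then show ?thesis by (simp add: dot_mt)
qed

text \<open>\<open>dot g z\<close> is the energy \<open>wsq W (mv z)\<close>; if it vanished, so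
  would every \<open>W i * mv z i\<close>, and \<open>g\<close> would be the zero functional.
  Positivity allows \<open>z\<close> to be rescaled to a prescribed value of
  \<open>dot g\<close>.\<close>

lemma nsol_pos:
  assumes "nsol W g z" "\<And>i. i < n \<Longrightarrow> 0 \<le> W i" "dot g x \<noteq> 0"
  shows "0 < dot g z"
proof -
  have eq: "dot g z = (\<Sum>i<n. W i * (mv z i)\<^sup>2)"
    using nsol_dot[OF assms(1), of z] by (simp add: power2_eq_square mult.assoc)
  have "dot g z \<noteq> 0"
  proof
    assume "dot g z = 0"
    then have "\<forall>i\<in>{..<n}. W i * (mv z i)\<^sup>2 = 0"
      unfolding eq using assms(2) by (subst (asm) sum_nonneg_eq_0_iff) auto
    then have "dot g x = 0"
      unfolding nsol_dot[OF assms(1), of x] by (intro sum.neutral) auto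
    then show False using assms(3) by simp
  qed
  moreover have "0 \<le> dot g z" unfolding eq using assms(2) by (intro sum_nonneg) auto
  ultimately show ?thesis by simp
qed

text \<open>The \<open>W\<close>-inner product of \<open>mv z\<close> with \<open>mv x\<close>
  depends on \<open>dot g x\<close> only, so the rescaled solution is the point of least energy on
  the hyperplane \<open>dot g x = c\<close>. The exact remainder is what
  \<open>energy_increase\<close> needs beyond minimality.\<close>

lemma nsol_pythagoras:
  assumes "nsol W g z" "dot g z \<noteq> 0" "dot g x = c" and y: "\<And>i. i < n \<Longrightarrow> y i = c / dot g z * mv z i"
  shows "wsq W (mv x) = wsq W y + wsq W (\<lambda>i. mv x i - y i)"
proof -
  let ?k = "c / dot g z"
  have 1: "(\<Sum>i<n. W i * mv z i * mv x i) = c" using nsol_dot[OF assms(1)] assms(3) by simp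
  have 2: "(\<Sum>i<n. W i * mv z i * mv z i) = dot g z" using nsol_dot[OF assms(1)] by simp
  have "wsq W y + wsq W (\<lambda>i. mv x i - y i)
     = (\<Sum>i<n. W i * (mv x i)\<^sup>2 - 2 * ?k * (W i * mv z i * mv x i) + 2 * ?k\<^sup>2 * (W i * mv z i * mv z i))"
    unfolding wsq_def sum.distrib[symmetric]
    by (intro sum.cong) (auto simp: y algebra_simps power2_eq_square)
  also have "\<dots> = wsq W (mv x) - 2 * ?k * c + 2 * ?k\<^sup>2 * dot g z"
    unfolding sum.distrib sum_subtractf sum_distrib_left[symmetric] 1 2 wsq_def ..
  also have "\<dots> = wsq W (mv x)" using assms(2) by (simp add: field_simps power2_eq_square)
  finally show ?thesis by simp
qed

text \<open>Adding \<open>S \<le> W\<close> to the weights raises the minimal energy by at least half of what it raises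
  the energy of the old minimizer \<open>y\<close>.\<close>

lemma energy_increase:
  assumes "nsol W g z" "dot g z \<noteq> 0" "dot g x = c"
    and "\<And>i. i < n \<Longrightarrow> mv \<Delta> i = c / dot g z * mv z i"
    and "\<And>i. i < n \<Longrightarrow> 0 \<le> S i" and "\<And>y. wsq S (mv y) \<le> wsq W (mv y)"
  shows "wsq W (mv \<Delta>) + wsq S (mv \<Delta>) / 2 \<le> wsq (\<lambda>i. W i + S i) (mv x)"
proof -
  \<comment> \<open>Whatever part of the \<open>S\<close>-energy of the old minimizer the competitor
    \<open>x\<close> does not inherit shows up in the distance between the two, and that distance is
    paid for by \<open>W\<close> through Pythagoras.\<close>
  have "wsq S (mv \<Delta>) / 2 \<le> wsq S (\<lambda>i. mv x i - mv \<Delta> i) + wsq S (mv x)"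
  proof -
    have "S i * (mv \<Delta> i)\<^sup>2 / 2 \<le> S i * (mv x i - mv \<Delta> i)\<^sup>2 + S i * (mv x i)\<^sup>2" if "i < n" for i
    proof -
      have "0 \<le> (2 * mv x i - mv \<Delta> i)\<^sup>2" by simp
      then have "(mv \<Delta> i)\<^sup>2 / 2 \<le> (mv x i - mv \<Delta> i)\<^sup>2 + (mv x i)\<^sup>2"
        by (simp add: power2_eq_square algebra_simps)
      then have "S i * ((mv \<Delta> i)\<^sup>2 / 2) \<le> S i * ((mv x i - mv \<Delta> i)\<^sup>2 + (mv x i)\<^sup>2)"
        using assms(5)[OF that] by (rule mult_left_mono)
      then show ?thesis by (simp add: algebra_simps)
    qed
    then show ?thesis
      unfolding wsq_def sum_divide_distrib sum.distrib[symmetric] by (intro sum_mono) auto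
  qed
  also have "wsq S (\<lambda>i. mv x i - mv \<Delta> i) \<le> wsq W (\<lambda>i. mv x i - mv \<Delta> i)"
  proof -
    have "mv (\<lambda>j. x j - \<Delta> j) = (\<lambda>i. mv x i - mv \<Delta> i)" by (simp add: fun_eq_iff mv_diff)
    then show ?thesis using assms(6)[of "\<lambda>j. x j - \<Delta> j"] by simp
  qed
  finally show ?thesis
    using nsol_pythagoras[OF assms(1-4)] by (simp add: wsq_add_left)
qed

lemma hb_add: "hb p r c \<Longrightarrow> hb p s e \<Longrightarrow> hb p (\<lambda>i. r i + s i) (c + e)"
  unfolding hb_def by (simp add: wsq_add_left distrib_right add_mono)

lemma hb_powr:
  assumes "2 < p" shows "hb p (\<lambda>i. \<bar>y i\<bar> powr (p - 2)) (pw p y powr ((p - 2) / p))"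
  unfolding hb_def wsq_def pw_def using holder_powr[OF _ assms] by auto

lemma hb_scale: "hb p r c \<Longrightarrow> 0 \<le> k \<Longrightarrow> hb p (\<lambda>i. k * r i) (k * c)"
  unfolding hb_def by (simp add: wsq_scale_left mult.assoc mult_left_mono)

section \<open>One refinement step for the sum of p-th powers\<close>

context
  fixes p \<nu> a :: real and b x g e D :: "nat \<Rightarrow> real"
  assumes p: "2 < p" and \<nu>: "0 < \<nu>" and a: "a = 2 * 2 powr (- p) / \<nu>"
    and e: "\<And>i. i < n \<Longrightarrow> e i = mv x i - b i" and D: "\<And>i. i < n \<Longrightarrow> D i = \<bar>e i\<bar> powr (p - 2)"
    and g: "\<And>j. j < d \<Longrightarrow> g j = mt (\<lambda>i. p * (D i * e i)) j"
begin

lemma a_pos: "0 < a" using a \<nu> by simp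

lemma dot_gradient: "dot g h = (\<Sum>i<n. p * \<bar>e i\<bar> powr (p - 2) * e i * mv h i)"
proof -
  have "dot g h = dot (mt (\<lambda>i. p * (D i * e i))) h" by (intro dot_cong) (simp_all add: g)
  then show ?thesis unfolding dot_mt by (simp add: D mult.assoc)
qed

text \<open>The witness is a multiple of \<open>x - x'\<close>. The lower expansion gives
  \<open>dot g h > \<nu> / 2 + c1 * Q\<close> for the total penalty \<open>Q\<close>; shrinking
  \<open>h\<close> until \<open>dot g h = \<nu> / 2\<close> shrinks both penalties at least by the
  same factor, and \<open>a\<close> is the normalization that turns the resulting bound into
  \<open>1\<close>.\<close>

lemma refinement_feasible:
  assumes gap: "\<nu> / 2 < pw p (\<lambda>i. mv x i - b i) - pw p (\<lambda>i. mv x' i - b i)"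
  shows "\<exists>h. dot g h = \<nu> / 2 \<and> a * wsq D (mv h) \<le> 1 \<and> a * pw p (mv h) \<le> 1"
proof -
  define h where "h j = x j - x' j" for j
  define c1 where "c1 = (2::real) powr (- p)"
  have c1: "0 < c1" unfolding c1_def by simp
  let ?Q = "wsq D (mv h) + pw p (mv h)"
  have wD: "0 \<le> wsq D (mv h)" using D by (intro wsq_nonneg) simp
  have "\<bar>e i\<bar> powr p + p * \<bar>e i\<bar> powr (p - 2) * e i * (- mv h i)
      + c1 * (\<bar>e i\<bar> powr (p - 2) * (- mv h i)\<^sup>2 + \<bar>- mv h i\<bar> powr p) \<le> \<bar>mv x' i - b i\<bar> powr p"
    if "i < n" for i
  proof -
    have "mv h i = mv x i - mv x' i" unfolding h_def by (rule mv_diff)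
    then have "mv x' i - b i = e i + - mv h i" using e[OF that] by simp
    then show ?thesis unfolding c1_def using abs_powr_expand_lower[of p "e i" "- mv h i"] p by simp
  qed
  then have "(\<Sum>i<n. \<bar>e i\<bar> powr p + p * \<bar>e i\<bar> powr (p - 2) * e i * (- mv h i)
      + c1 * (\<bar>e i\<bar> powr (p - 2) * (- mv h i)\<^sup>2 + \<bar>- mv h i\<bar> powr p)) \<le> pw p (\<lambda>i. mv x' i - b i)"
    unfolding pw_def by (intro sum_mono) auto
  also have "(\<Sum>i<n. \<bar>e i\<bar> powr p + p * \<bar>e i\<bar> powr (p - 2) * e i * (- mv h i)
      + c1 * (\<bar>e i\<bar> powr (p - 2) * (- mv h i)\<^sup>2 + \<bar>- mv h i\<bar> powr p)) = pw p e - dot g h + c1 * ?Q"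
    unfolding dot_gradient wsq_def pw_def by (simp add: sum.distrib sum_subtractf sum_distrib_left distrib_left D)
  also have "pw p e = pw p (\<lambda>i. mv x i - b i)" by (intro pw_cong) (rule e)
  finally have y: "\<nu> / 2 + c1 * ?Q < dot g h" using gap by simp
  have cQ: "0 \<le> c1 * ?Q" using wD pw_nonneg c1 by (intro mult_nonneg_nonneg add_nonneg_nonneg) auto
  have y0: "\<nu> / 2 < dot g h" and yQ: "c1 * ?Q \<le> dot g h" using y cQ \<nu> by linarith+
  define t where "t = \<nu> / 2 / dot g h"
  have t: "0 < t" "t < 1" unfolding t_def using y0 \<nu> by (auto simp: field_simps)
  have atQ: "a * (t * ?Q) \<le> 1"
  proof -
    have "a * (t * ?Q) = c1 * ?Q / dot g h"
      unfolding a t_def c1_def using \<nu> y0 by (simp add: field_simps)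
    also have "\<dots> \<le> 1" using yQ y0 \<nu> by (simp add: field_simps)
    finally show ?thesis .
  qed
  have mvt: "mv (\<lambda>j. t * h j) = (\<lambda>i. t * mv h i)" using mv_scale by blast
  have "dot g (\<lambda>j. t * h j) = \<nu> / 2" unfolding dot_scale t_def using y0 \<nu> by simp
  moreover have "a * wsq D (mv (\<lambda>j. t * h j)) \<le> 1"
  proof -
    have "t\<^sup>2 * wsq D (mv h) \<le> t * ?Q"
      using t wD pw_nonneg by (intro mult_mono) (auto simp: power2_eq_square mult_left_le)
    then have "a * (t\<^sup>2 * wsq D (mv h)) \<le> a * (t * ?Q)" using a_pos by (intro mult_left_mono) auto
    then show ?thesis unfolding mvt wsq_scale using atQ by linarith
  qed
  moreover have "a * pw p (mv (\<lambda>j. t * h j)) \<le> 1"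
  proof -
    have "t powr p \<le> t powr 1" using t p by (intro powr_mono') auto
    then have "\<bar>t\<bar> powr p * pw p (mv h) \<le> t * ?Q"
      using t wD pw_nonneg by (intro mult_mono) auto
    then have "a * (\<bar>t\<bar> powr p * pw p (mv h)) \<le> a * (t * ?Q)" using a_pos by (intro mult_left_mono) auto
    then show ?thesis unfolding mvt pw_scale using atQ by linarith
  qed
  ultimately show ?thesis by blast
qed

text \<open>The step size \<open>s\<close> is such that the error of the upper expansion costs at
  most half of the linear gain \<open>s * \<nu> / 2\<close>.\<close>

lemma refinement_progress:
  assumes dot: "dot g \<Delta> = \<nu> / 2" and wD: "a * wsq D (mv \<Delta>) \<le> 4" and pw: "a * pw p (mv \<Delta>) \<le> \<kappa>"
    and s: "s = 2 powr (- p) / (2 * (p\<^sup>2 * 2 powr p) * (4 + \<kappa>))"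
    and x': "\<And>j. j < d \<Longrightarrow> x' j = x j - s * \<Delta> j"
  shows "pw p (\<lambda>i. mv x' i - b i) \<le> pw p (\<lambda>i. mv x i - b i) - s / 4 * \<nu>"
proof -
  define c1 where "c1 = (2::real) powr (- p)"
  define c2 where "c2 = p\<^sup>2 * (2::real) powr p"
  have c1: "0 < c1" "c1 \<le> 1" unfolding c1_def using p powr_mono[of "-p" 0 "2::real"] by auto
  have c2: "1 \<le> c2"
  proof -
    have "1 \<le> p\<^sup>2" using p by (intro one_le_power) auto
    moreover have "1 \<le> 2 powr p" using p by (intro ge_one_powr_ge_zero) auto
    ultimately have "1 * 1 \<le> c2" unfolding c2_def by (intro mult_mono) auto
    then show ?thesis by simp
  qed
  have "0 \<le> a * pw p (mv \<Delta>)" using a_pos pw_nonneg by auto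
  then have \<kappa>: "0 \<le> \<kappa>" using pw by linarith
  have s_eq: "s = c1 / (2 * c2 * (4 + \<kappa>))" using s unfolding c1_def c2_def .
  have "1 * 1 \<le> (2 * c2) * (4 + \<kappa>)" using c2 \<kappa> by (intro mult_mono) auto
  then have s01: "0 < s" "s \<le> 1" unfolding s_eq using c1 c2 \<kappa> by (auto simp: field_simps)
  have mvx': "mv x' i = mv x i - s * mv \<Delta> i" for i
  proof -
    have "mv x' i = mv (\<lambda>j. x j - s * \<Delta> j) i" by (intro mv_cong) (rule x')
    then show ?thesis by (simp add: mv_diff mv_scale)
  qed
  have "\<bar>mv x' i - b i\<bar> powr p \<le> \<bar>e i\<bar> powr p + p * \<bar>e i\<bar> powr (p - 2) * e i * (- (s * mv \<Delta> i))
      + c2 * (D i * (s * mv \<Delta> i)\<^sup>2 + \<bar>s * mv \<Delta> i\<bar> powr p)" if "i < n" for i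
  proof -
    have "mv x' i - b i = e i + - (s * mv \<Delta> i)" using e[OF that] mvx' by simp
    then show ?thesis
      unfolding c2_def D[OF that] using abs_powr_expand_upper[of p "e i" "- (s * mv \<Delta> i)"] p by simp
  qed
  then have "pw p (\<lambda>i. mv x' i - b i) \<le> (\<Sum>i<n. \<bar>e i\<bar> powr p + p * \<bar>e i\<bar> powr (p - 2) * e i * (- (s * mv \<Delta> i))
      + c2 * (D i * (s * mv \<Delta> i)\<^sup>2 + \<bar>s * mv \<Delta> i\<bar> powr p))"
    unfolding pw_def by (intro sum_mono) auto
  also have "\<dots> = pw p e - s * dot g \<Delta> + c2 * (wsq D (\<lambda>i. s * mv \<Delta> i) + pw p (\<lambda>i. s * mv \<Delta> i))"
    unfolding dot_gradient wsq_def pw_def sum_distrib_left distrib_left sum.distrib[symmetric] sum_subtractf[symmetric]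
    by (intro sum.cong) (auto simp: algebra_simps)
  also have "wsq D (\<lambda>i. s * mv \<Delta> i) + pw p (\<lambda>i. s * mv \<Delta> i) \<le> s\<^sup>2 * (4 + \<kappa>) / a"
  proof -
    have "s powr p \<le> s powr 2" using s01 p by (intro powr_mono') auto
    then have "\<bar>s\<bar> powr p * pw p (mv \<Delta>) \<le> s\<^sup>2 * pw p (mv \<Delta>)"
      using s01 pw_nonneg by (intro mult_right_mono) (auto simp: powr_numeral)
    moreover have "s\<^sup>2 * (wsq D (mv \<Delta>) + pw p (mv \<Delta>)) \<le> s\<^sup>2 * ((4 + \<kappa>) / a)"
      using wD pw a_pos by (intro mult_left_mono) (auto simp: field_simps)
    ultimately show ?thesis unfolding wsq_scale pw_scale by (simp add: distrib_left)
  qed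
  also have "c2 * (s\<^sup>2 * (4 + \<kappa>) / a) = s * \<nu> / 4"
  proof -
    have "c2 * (s\<^sup>2 * (4 + \<kappa>) / a) = s * (s * (c2 * (4 + \<kappa>))) * \<nu> / (2 * c1)"
      unfolding a c1_def[symmetric] using c1 \<nu> by (simp add: field_simps power2_eq_square)
    also have "s * (c2 * (4 + \<kappa>)) = c1 / 2" 
    proof -
      have "c2 * (4 + \<kappa>) \<noteq> 0" using c2 \<kappa> by auto
      then show ?thesis unfolding s_eq by (simp add: mult.assoc)
    qed
    finally show ?thesis using c1 by simp
  qed
  also have "pw p e = pw p (\<lambda>i. mv x i - b i)" by (intro pw_cong) (rule e)
  finally show ?thesis using c2 by (simp add: dot algebra_simps)
qed

end

end

section \<open>Width-reduced multiplicative weights\<close>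

locale mwu = design +
  fixes p a \<Lambda> \<iota> c :: real and D r0 g :: "nat \<Rightarrow> real"
  assumes p: "2 < p" and a: "0 < a" and \<Lambda>: "0 < \<Lambda>" and c: "0 < c"
    and \<iota>: "1 \<le> \<iota>" "\<Lambda> \<le> \<iota> powr ((3 * p - 2) / p)"
    and D: "\<And>i. i < n \<Longrightarrow> 0 \<le> D i" and r0: "\<And>i. i < n \<Longrightarrow> 0 < r0 i" and hb0: "hb p r0 1"
    and lewis: "\<And>x. pw p (mv x) powr (2 / p) \<le> \<Lambda> * wsq r0 (mv x)"
    and feasible: "\<exists>x. dot g x = c \<and> a * wsq D (mv x) \<le> 1 \<and> a * pw p (mv x) \<le> 1"
begin

definition "Cp = p * 2 powr p"
text \<open>A primal step adds at most \<open>8 * Cp * \<alpha>\<close> to the potential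
  \<open>pw p u\<close>, so \<open>2 * \<iota>\<close> of them keep it at most \<open>1\<close>. The
  threshold \<open>\<tau>\<close> below is the value of \<open>t\<close> at which
  \<open>\<alpha> powr p * t\<close> reaches \<open>\<alpha>\<close>.\<close>

definition "\<alpha> = 1 / (16 * Cp * \<iota>)"
definition "\<tau> = (16 * Cp * \<iota>) powr (p - 1)"

text \<open>The factor \<open>a powr (2 / p)\<close> turns \<open>hb\<close> bounds into energy
  bounds: \<open>a * pw p y \<le> 1\<close> gives
  \<open>a powr (2 / p) * pw p y powr (2 / p) \<le> 1\<close>.\<close>

definition mW :: "(nat \<Rightarrow> real) \<Rightarrow> (nat \<Rightarrow> real) \<Rightarrow> nat \<Rightarrow> real" where
  "mW racc u i = a * D i + a powr (2 / p) * (r0 i + racc i + u i powr (p - 2))"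

text \<open>\<open>kw\<close> and \<open>cnt\<close> count the width and the primal steps so far, \<open>racc\<close> and \<open>u\<close> carry the increments of the
  weights due to them, and \<open>S\<close> is the sum of the primal steps. The fourth conjunct says that every
  width step has raised the minimal energy by a fixed amount.\<close>

definition minv :: "(nat \<Rightarrow> real) \<Rightarrow> (nat \<Rightarrow> real) \<Rightarrow> (nat \<Rightarrow> real) \<Rightarrow> nat \<Rightarrow> nat \<Rightarrow> bool" where
  "minv racc u S kw cnt \<longleftrightarrow>
     (\<forall>i<n. 0 \<le> racc i \<and> 0 \<le> u i) \<and> hb p racc (kw / \<Lambda>) \<and> pw p u \<le> 8 * Cp * \<alpha> * cnt \<and>
     (\<forall>x. dot g x = c \<longrightarrow> kw * (\<tau> powr (2 / p) / (2 * \<Lambda>)) \<le> wsq (mW racc u) (mv x)) \<and>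
     (\<forall>i<n. \<alpha> * (a powr (1 / p) * \<bar>mv S i\<bar>) \<le> u i) \<and> dot g S = cnt * c \<and>
     a * wsq D (mv S) \<le> 4 * (real cnt)\<^sup>2"

lemma Cp_ge: "8 \<le> Cp"
proof -
  have "(2::real) powr 2 \<le> 2 powr p" using p by (intro powr_mono) auto
  then have "2 * 4 \<le> Cp" unfolding Cp_def using p by (intro mult_mono) (auto simp: powr_numeral)
  then show ?thesis by simp
qed

lemma big: "16 * \<iota> \<le> 16 * Cp * \<iota>" "1 \<le> 16 * Cp * \<iota>" "0 < 16 * Cp * \<iota>"
proof -
  have "16 * \<iota> * 1 \<le> 16 * \<iota> * Cp" using Cp_ge \<iota> by (intro mult_left_mono) auto
  then show "16 * \<iota> \<le> 16 * Cp * \<iota>" by (simp add: ac_simps)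
  then have "16 \<le> 16 * Cp * \<iota>" using \<iota>(1) by linarith
  then show "1 \<le> 16 * Cp * \<iota>" "0 < 16 * Cp * \<iota>" by linarith+
qed

lemma \<alpha>_pos: "0 < \<alpha>" unfolding \<alpha>_def by (intro divide_pos_pos big) simp

lemma \<tau>_pos: "0 < \<tau>" unfolding \<tau>_def using big(3) by (simp only: powr_gt_zero)

lemma \<alpha>\<tau>: "\<alpha> powr p * \<tau> = \<alpha>"
proof -
  have "(1 / B) powr (- q) = B powr q" for B q :: real by (simp add: powr_divide powr_minus)
  then have "\<tau> = \<alpha> powr (- (p - 1))" unfolding \<tau>_def \<alpha>_def by metis
  then have "\<alpha> powr p * \<tau> = \<alpha> powr (p + - (p - 1))" by (simp only: powr_add)
  then show ?thesis using \<alpha>_pos by simp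
qed

lemma \<tau>_powr: "16 * \<iota> powr (2 * (p - 1) / p) \<le> \<tau> powr (2 / p)"
proof -
  have e: "1 \<le> 2 * (p - 1) / p" using p by simp
  have "16 * \<iota> powr (2 * (p - 1) / p) \<le> 16 powr (2 * (p - 1) / p) * \<iota> powr (2 * (p - 1) / p)"
    using powr_mono[OF e, of 16] by (intro mult_right_mono) auto
  also have "\<dots> = (16 * \<iota>) powr (2 * (p - 1) / p)" using \<iota> by (simp add: powr_mult)
  also have "\<dots> \<le> (16 * Cp * \<iota>) powr (2 * (p - 1) / p)"
    using big e \<iota> by (intro powr_mono2) auto
  also have "\<dots> = \<tau> powr (2 / p)"
    unfolding \<tau>_def by (simp add: powr_powr mult.commute)
  finally show ?thesis .
qed

lemma mW_nonneg:
  assumes "minv racc u S kw cnt" "i < n"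
  shows "0 \<le> mW racc u i"
  using assms a D[of i] r0[of i] unfolding minv_def mW_def
  by (auto intro!: add_nonneg_nonneg mult_nonneg_nonneg simp: less_imp_le)

lemma wsq_mW:
  "wsq (mW racc u) y = a * wsq D y + a powr (2 / p) * (wsq r0 y + wsq racc y + wsq (\<lambda>i. u i powr (p - 2)) y)"
  unfolding mW_def wsq_add_left wsq_scale_left ..

lemma pw_u_le:
  assumes "minv racc u S kw cnt" "cnt \<le> 2 * \<iota>"
  shows "pw p u \<le> 1"
proof -
  have "pw p u \<le> 8 * Cp * \<alpha> * cnt" using assms(1) unfolding minv_def by auto
  also have "\<dots> \<le> 8 * Cp * \<alpha> * (2 * \<iota>)"
    using assms(2) Cp_ge \<alpha>_pos by (intro mult_left_mono) auto
  also have "\<dots> = 1" unfolding \<alpha>_def using big Cp_ge \<iota> by (simp add: field_simps)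
  finally show ?thesis .
qed

lemma hb_u:
  assumes "minv racc u S kw cnt" "cnt \<le> 2 * \<iota>"
  shows "hb p (\<lambda>i. u i powr (p - 2)) 1"
proof -
  have "hb p (\<lambda>i. \<bar>u i\<bar> powr (p - 2)) (pw p u powr ((p - 2) / p))" by (rule hb_powr[OF p])
  moreover have "pw p u powr ((p - 2) / p) \<le> 1"
    using pw_u_le[OF assms] pw_nonneg p by (intro powr_le1) auto
  ultimately have "hb p (\<lambda>i. \<bar>u i\<bar> powr (p - 2)) 1"
    unfolding hb_def by (meson mult_right_mono order_trans powr_ge_zero)
  moreover have "u i = \<bar>u i\<bar>" if "i < n" for i using assms(1) that unfolding minv_def by auto
  ultimately show ?thesis using hb_cong[of "\<lambda>i. u i powr (p - 2)" "\<lambda>i. \<bar>u i\<bar> powr (p - 2)"] by simp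
qed

text \<open>Two bounds on the energy of the feasible point are played against each other: at most
  \<open>3 + kw / \<Lambda>\<close> by the norms of the weights, and at least
  \<open>8 * (kw / \<Lambda>) * \<iota> powr (2 * (p - 1) / p)\<close> by the invariant. Together
  they give \<open>kw \<le> \<Lambda>\<close>, hence energy at most \<open>4\<close>, and then
  \<open>kw \<le> \<iota> / 2\<close> by the choice of \<open>\<iota>\<close>.\<close>

lemma energy_bounds:
  assumes inv: "minv racc u S kw cnt" and "cnt \<le> 2 * \<iota>"
  shows "\<exists>x. dot g x = c \<and> wsq (mW racc u) (mv x) \<le> 4" "kw \<le> \<iota> / 2"
proof -
  obtain x where x: "dot g x = c" "a * wsq D (mv x) \<le> 1" "a * pw p (mv x) \<le> 1"
    using feasible by auto
  let ?N = "pw p (mv x) powr (2 / p)"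
  have N: "a powr (2 / p) * ?N \<le> 1"
  proof -
    have "a powr (2 / p) * ?N = (a * pw p (mv x)) powr (2 / p)"
      using a pw_nonneg by (simp add: powr_mult)
    also have "\<dots> \<le> 1" using x a pw_nonneg p by (intro powr_le1) auto
    finally show ?thesis .
  qed
  have "wsq r0 (mv x) + wsq racc (mv x) + wsq (\<lambda>i. u i powr (p - 2)) (mv x)
      \<le> 1 * ?N + kw / \<Lambda> * ?N + 1 * ?N"
    using hb0 inv hb_u[OF assms] unfolding minv_def hb_def by (intro add_mono) auto
  then have "a powr (2 / p) * (wsq r0 (mv x) + wsq racc (mv x) + wsq (\<lambda>i. u i powr (p - 2)) (mv x))
      \<le> a powr (2 / p) * ((2 + kw / \<Lambda>) * ?N)"
    by (intro mult_left_mono) (auto simp: algebra_simps)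
  also have "\<dots> = (2 + kw / \<Lambda>) * (a powr (2 / p) * ?N)" by simp
  also have "\<dots> \<le> (2 + kw / \<Lambda>) * 1" using N \<Lambda> by (intro mult_left_mono) auto
  finally have up: "wsq (mW racc u) (mv x) \<le> 3 + kw / \<Lambda>"
    unfolding wsq_mW using x(2) by simp
  have low: "kw * (\<tau> powr (2 / p) / (2 * \<Lambda>)) \<le> wsq (mW racc u) (mv x)"
    using inv x(1) unfolding minv_def by auto
  have \<iota>1: "1 \<le> \<iota> powr (2 * (p - 1) / p)" using \<iota> p by (intro ge_one_powr_ge_zero) auto
  have "kw / \<Lambda> * (8 * \<iota> powr (2 * (p - 1) / p)) \<le> kw / \<Lambda> * (\<tau> powr (2 / p) / 2)"
    using \<tau>_powr \<Lambda> by (intro mult_left_mono) auto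
  also have "\<dots> = kw * (\<tau> powr (2 / p) / (2 * \<Lambda>))" by simp
  also have "\<dots> \<le> 3 + kw / \<Lambda>" using low up by simp
  finally have main: "kw / \<Lambda> * (8 * \<iota> powr (2 * (p - 1) / p)) \<le> 3 + kw / \<Lambda>" .
  have "kw / \<Lambda> * 1 \<le> kw / \<Lambda> * \<iota> powr (2 * (p - 1) / p)"
    using \<iota>1 \<Lambda> by (intro mult_left_mono) auto
  then have ge: "kw / \<Lambda> \<le> kw / \<Lambda> * \<iota> powr (2 * (p - 1) / p)" by simp
  have main8: "8 * (kw / \<Lambda> * \<iota> powr (2 * (p - 1) / p)) \<le> 3 + kw / \<Lambda>"
    using main unfolding mult.left_commute[of _ 8] .
  have k1: "kw / \<Lambda> * \<iota> powr (2 * (p - 1) / p) \<le> 3 / 7" and k2: "kw / \<Lambda> \<le> 1"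
  proof -
    have "K \<le> L \<Longrightarrow> 8 * L \<le> 3 + K \<Longrightarrow> L \<le> 3 / 7 \<and> K \<le> 1" for K L :: real by auto
    from this[OF ge main8] show "kw / \<Lambda> * \<iota> powr (2 * (p - 1) / p) \<le> 3 / 7" "kw / \<Lambda> \<le> 1" by auto
  qed
  show "\<exists>x. dot g x = c \<and> wsq (mW racc u) (mv x) \<le> 4" using x(1) up k2 by auto
  have "kw * \<iota> powr (2 * (p - 1) / p) \<le> 3 / 7 * \<Lambda>" using k1 \<Lambda> by (simp add: field_simps)
  also have "\<dots> \<le> 1 / 2 * \<iota> powr ((3 * p - 2) / p)" using \<iota> \<Lambda> by (intro mult_mono) auto
  also have "(3 * p - 2) / p = 1 + 2 * (p - 1) / p" using p by (simp add: field_simps)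
  also have "\<iota> powr (1 + 2 * (p - 1) / p) = \<iota> * \<iota> powr (2 * (p - 1) / p)"
    using \<iota> by (simp add: powr_add)
  finally have "kw * \<iota> powr (2 * (p - 1) / p) \<le> \<iota> / 2 * \<iota> powr (2 * (p - 1) / p)" by simp
  moreover have "0 < \<iota> powr (2 * (p - 1) / p)" using \<iota>1 by linarith
  ultimately show "kw \<le> \<iota> / 2" using mult_le_cancel_right_pos by blast
qed

context
  fixes racc u S z \<Delta> y :: "nat \<Rightarrow> real" and kw cnt :: nat
  assumes inv: "minv racc u S kw cnt" and cnt: "cnt \<le> 2 * \<iota>"
    and z: "nsol (mW racc u) g z" and \<Delta>: "\<And>j. j < d \<Longrightarrow> \<Delta> j = z j * c / dot g z"
    and y: "\<And>i. i < n \<Longrightarrow> y i = mv \<Delta> i"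
begin

lemma dot_z_pos: "0 < dot g z"
proof -
  obtain x where "dot g x = c" using feasible by auto
  then show ?thesis using nsol_pos[OF z mW_nonneg[OF inv], of x] c by simp
qed

lemma mv_\<Delta>: "mv \<Delta> i = c / dot g z * mv z i"
  unfolding mv_scale[symmetric] by (intro mv_cong) (simp add: \<Delta>)

lemma dot_\<Delta>: "dot g \<Delta> = c"
proof -
  have "dot g \<Delta> = dot g (\<lambda>j. c / dot g z * z j)" by (intro dot_cong) (simp_all add: \<Delta>)
  then show ?thesis using dot_z_pos unfolding dot_scale by simp
qed

lemma wsq_y: "wsq W y = wsq W (mv \<Delta>)" by (intro wsq_cong) (simp_all add: y)

lemma energy_y: "wsq (mW racc u) y \<le> 4"
proof -
  obtain x where x: "dot g x = c" "wsq (mW racc u) (mv x) \<le> 4" using energy_bounds[OF inv cnt] by auto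
  have "wsq (mW racc u) (mv x) = wsq (mW racc u) (mv \<Delta>) + wsq (mW racc u) (\<lambda>i. mv x i - mv \<Delta> i)"
    by (rule nsol_pythagoras[OF z _ x(1)]) (use dot_z_pos mv_\<Delta> in auto)
  moreover have "0 \<le> wsq (mW racc u) (\<lambda>i. mv x i - mv \<Delta> i)"
    by (intro wsq_nonneg mW_nonneg[OF inv])
  ultimately show ?thesis using x(2) by (simp add: wsq_y)
qed

lemma a_powr: "(a powr (1 / p))\<^sup>2 = a powr (2 / p)" "(a powr (1 / p)) powr p = a"
  using a p by (simp_all add: powr_powr power2_eq_square flip: powr_add)

lemma pw_ahat: "pw p (\<lambda>i. a powr (1 / p) * y i) = a * pw p y"
  using a by (simp add: pw_scale a_powr)

text \<open>The factor \<open>\<theta>\<close> makes \<open>1 / \<Lambda>\<close> the bound on the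
  dual norm of the increment \<open>s\<close>. So \<open>racc\<close> grows by no more than that,
  the Lewis property puts the new form below that of \<open>r0\<close>, as
  \<open>energy_increase\<close> requires, and the present minimizer has energy exactly
  \<open>t powr (2 / p) / \<Lambda>\<close> under the increment.\<close>

lemma minv_width:
  assumes t: "t = a * pw p y" "\<tau> < t"
    and racc': "\<And>i. i < n \<Longrightarrow> racc' i = racc i
        + 1 / (\<Lambda> * t powr ((p - 2) / p)) * (a powr (1 / p) * \<bar>y i\<bar>) powr (p - 2)"
  shows "minv racc' u S (Suc kw) cnt"
proof -
  define \<theta> where "\<theta> = 1 / (\<Lambda> * t powr ((p - 2) / p))"
  define s where "s i = \<theta> * \<bar>a powr (1 / p) * y i\<bar> powr (p - 2)" for i
  have t0: "0 < t" using t \<tau>_pos by linarith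
  have \<theta>0: "0 < \<theta>" unfolding \<theta>_def using t0 \<Lambda> by simp
  have s0: "0 \<le> s i" for i unfolding s_def using \<theta>0 by simp
  have racc'_s: "racc' i = racc i + s i" if "i < n" for i
    using racc'[OF that] unfolding s_def \<theta>_def by (simp add: abs_mult)
  have hbs: "hb p s (1 / \<Lambda>)"
  proof -
    have "hb p s (\<theta> * (a * pw p y) powr ((p - 2) / p))"
      unfolding s_def using hb_scale[OF hb_powr[OF p, of "\<lambda>i. a powr (1 / p) * y i"], of \<theta>] \<theta>0
      by (simp add: pw_ahat)
    then have "hb p s (\<theta> * t powr ((p - 2) / p))" using t by simp
    moreover have "\<theta> * t powr ((p - 2) / p) = 1 / \<Lambda>" unfolding \<theta>_def using t0 \<Lambda> by simp
    ultimately show ?thesis by simp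
  qed
  have sy: "a powr (2 / p) * wsq s y = t powr (2 / p) / \<Lambda>"
  proof -
    have "a powr (2 / p) * wsq s y = \<theta> * (\<Sum>i<n. \<bar>a powr (1 / p) * y i\<bar> powr (p - 2) * (a powr (1 / p) * y i)\<^sup>2)"
      unfolding wsq_def s_def sum_distrib_left
      by (intro sum.cong) (simp_all add: power_mult_distrib a_powr)
    also have "\<dots> = \<theta> * t"
      using pw_ahat unfolding abs_powr_diff_two t(1) pw_def by simp
    also have "\<dots> = t powr (1 - (p - 2) / p) / \<Lambda>"
      unfolding \<theta>_def using t0 by (simp add: powr_diff)
    also have "1 - (p - 2) / p = 2 / p" using p by (simp add: field_simps)
    finally show ?thesis .
  qed
  have mW': "mW racc' u i = mW racc u i + a powr (2 / p) * s i" if "i < n" for i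
    unfolding mW_def using racc'_s[OF that] by (simp add: algebra_simps)
  have energy: "Suc kw * (\<tau> powr (2 / p) / (2 * \<Lambda>)) \<le> wsq (mW racc' u) (mv x)" if "dot g x = c" for x
  proof -
    have le: "wsq (\<lambda>i. a powr (2 / p) * s i) (mv v) \<le> wsq (mW racc u) (mv v)" for v
    proof -
      have "wsq s (mv v) \<le> 1 / \<Lambda> * pw p (mv v) powr (2 / p)" using hbs unfolding hb_def by auto
      also have "\<dots> \<le> 1 / \<Lambda> * (\<Lambda> * wsq r0 (mv v))"
        using lewis \<Lambda> by (intro mult_left_mono) auto
      also have "\<dots> = wsq r0 (mv v)" using \<Lambda> by simp
      finally have "a powr (2 / p) * wsq s (mv v) \<le> a powr (2 / p) * wsq r0 (mv v)"
        by (intro mult_left_mono) auto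
      moreover have "0 \<le> a * wsq D (mv v)" "0 \<le> wsq racc (mv v)" "0 \<le> wsq (\<lambda>i. u i powr (p - 2)) (mv v)"
        using inv a D unfolding minv_def by (auto intro!: wsq_nonneg mult_nonneg_nonneg)
      ultimately show ?thesis
        unfolding wsq_mW wsq_scale_left by (simp add: distrib_left add_increasing add_increasing2)
    qed
    have "wsq (mW racc u) (mv \<Delta>) + wsq (\<lambda>i. a powr (2 / p) * s i) (mv \<Delta>) / 2
        \<le> wsq (\<lambda>i. mW racc u i + a powr (2 / p) * s i) (mv x)"
      by (rule energy_increase[OF z _ that]) (use dot_z_pos mv_\<Delta> s0 le in auto)
    also have "\<dots> = wsq (mW racc' u) (mv x)" by (intro wsq_cong) (simp_all add: mW')
    finally have "wsq (mW racc u) (mv \<Delta>) + t powr (2 / p) / \<Lambda> / 2 \<le> wsq (mW racc' u) (mv x)"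
      using sy unfolding wsq_y wsq_scale_left by simp
    moreover have "kw * (\<tau> powr (2 / p) / (2 * \<Lambda>)) \<le> wsq (mW racc u) (mv \<Delta>)"
      using inv dot_\<Delta> unfolding minv_def by auto
    moreover have "\<tau> powr (2 / p) / \<Lambda> / 2 \<le> t powr (2 / p) / \<Lambda> / 2"
      using t \<tau>_pos \<Lambda> p by (intro divide_right_mono powr_mono2) auto
    ultimately show ?thesis by (simp add: distrib_right add_divide_distrib mult.commute)
  qed
  have "hb p racc' (real (Suc kw) / \<Lambda>)"
  proof -
    have "hb p (\<lambda>i. racc i + s i) (kw / \<Lambda> + 1 / \<Lambda>)"
      using inv hbs unfolding minv_def by (intro hb_add) auto
    moreover have "kw / \<Lambda> + 1 / \<Lambda> = real (Suc kw) / \<Lambda>" by (simp add: add_divide_distrib)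
    ultimately show ?thesis using hb_cong[of racc' "\<lambda>i. racc i + s i"] racc'_s by auto
  qed
  moreover have "\<forall>i<n. 0 \<le> racc' i" using racc'_s s0 inv unfolding minv_def by (simp add: add_nonneg_nonneg)
  ultimately show ?thesis using inv energy unfolding minv_def by auto
qed

text \<open>The potential grows by the cross term \<open>u powr (p - 1) * h\<close>, which splits by
  the inequality of the means into the potential itself and the energy of \<open>h\<close> under
  \<open>u powr (p - 2)\<close>, and by \<open>\<alpha> powr p * t\<close>, which
  \<open>t \<le> \<tau>\<close> keeps below \<open>\<alpha>\<close>.\<close>

lemma minv_primal:
  assumes t: "t = a * pw p y" "t \<le> \<tau>"
    and u': "\<And>i. i < n \<Longrightarrow> u' i = u i + \<alpha> * (a powr (1 / p) * \<bar>y i\<bar>)"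
    and S': "\<And>j. j < d \<Longrightarrow> S' j = S j + \<Delta> j"
  shows "minv racc u' S' kw (Suc cnt)"
proof -
  define h where "h i = a powr (1 / p) * \<bar>y i\<bar>" for i
  have h0: "0 \<le> h i" for i unfolding h_def by simp
  have u0: "0 \<le> u i" and racc0: "0 \<le> racc i" if "i < n" for i using inv that unfolding minv_def by auto
  have mvS': "mv S' i = mv S i + mv \<Delta> i" for i
    unfolding mv_add[symmetric] by (intro mv_cong) (simp add: S')
  have u'_ge: "u i \<le> u' i" if "i < n" for i using u'[OF that] h0[of i] \<alpha>_pos unfolding h_def by simp
  have E: "a * wsq D y \<le> 4" "wsq (\<lambda>i. u i powr (p - 2)) h \<le> 4"
  proof -
    have nn: "0 \<le> a * wsq D y" "0 \<le> wsq r0 y" "0 \<le> wsq racc y" "0 \<le> wsq (\<lambda>i. u i powr (p - 2)) y"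
      using a D r0 racc0 by (auto intro!: mult_nonneg_nonneg wsq_nonneg simp: less_imp_le)
    have sum: "a * wsq D y + a powr (2 / p) * (wsq r0 y + wsq racc y + wsq (\<lambda>i. u i powr (p - 2)) y) \<le> 4"
      using energy_y unfolding wsq_mW .
    have nn2: "0 \<le> a powr (2 / p) * wsq r0 y" "0 \<le> a powr (2 / p) * wsq racc y"
       "0 \<le> a powr (2 / p) * wsq (\<lambda>i. u i powr (p - 2)) y" using nn by auto
    show "a * wsq D y \<le> 4" using sum nn nn2 unfolding distrib_left by linarith
    have "wsq (\<lambda>i. u i powr (p - 2)) h = a powr (2 / p) * wsq (\<lambda>i. u i powr (p - 2)) y"
      unfolding h_def wsq_scale a_powr by (simp add: wsq_def)
    also have "\<dots> \<le> 4" using sum nn nn2 unfolding distrib_left by linarith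
    finally show "wsq (\<lambda>i. u i powr (p - 2)) h \<le> 4" .
  qed
  have pwh: "pw p h = t"
    unfolding t(1) pw_ahat[symmetric] unfolding h_def pw_def by (simp add: abs_mult)
  have "pw p u' \<le> pw p u + 8 * Cp * \<alpha>"
  proof -
    have "\<bar>u' i\<bar> powr p \<le> \<bar>u i\<bar> powr p + Cp * (\<alpha> * ((\<bar>u i\<bar> powr p + u i powr (p - 2) * (h i)\<^sup>2) / 2)
        + \<alpha> powr p * \<bar>h i\<bar> powr p)" if i: "i < n" for i
    proof -
      have "u i powr (p - 1) * h i \<le> (\<bar>u i\<bar> powr p + u i powr (p - 2) * (h i)\<^sup>2) / 2"
      proof (cases "u i = 0")
        case False
        then have ui: "0 < u i" using u0[OF i] by simp
        have e1: "u i powr (p - 1) = u i powr (p - 2) * u i"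
        proof -
          have "u i powr (1 + (p - 2)) = u i * u i powr (p - 2)" using ui by (simp only: powr_mult_base)
          moreover have "1 + (p - 2) = p - 1" by simp
          ultimately show ?thesis by (simp only: mult.commute)
        qed
        have e2: "\<bar>u i\<bar> powr p = u i powr (p - 2) * (u i)\<^sup>2"
          using abs_powr_diff_two[of "u i" p] ui by simp
        have "u i * h i \<le> ((u i)\<^sup>2 + (h i)\<^sup>2) / 2"
          using sum_squares_bound[of "u i" "h i"] by simp
        then have "u i powr (p - 2) * (u i * h i) \<le> u i powr (p - 2) * (((u i)\<^sup>2 + (h i)\<^sup>2) / 2)"
          by (intro mult_left_mono) auto
        then show ?thesis unfolding e1 e2 by (simp add: algebra_simps)
      qed simp
      then have l: "\<alpha> * (u i powr (p - 1) * h i) \<le> \<alpha> * ((\<bar>u i\<bar> powr p + u i powr (p - 2) * (h i)\<^sup>2) / 2)"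
        using \<alpha>_pos by (intro mult_left_mono) auto
      have "(u i + \<alpha> * h i) powr p \<le> u i powr p + p * 2 powr p * (u i powr (p - 1) * (\<alpha> * h i) + (\<alpha> * h i) powr p)"
        using u0[OF i] h0 \<alpha>_pos p by (intro powr_add_le) auto
      also have "(\<alpha> * h i) powr p = \<alpha> powr p * \<bar>h i\<bar> powr p"
        using \<alpha>_pos h0 by (simp add: powr_mult)
      also have "p * 2 powr p * (u i powr (p - 1) * (\<alpha> * h i) + \<alpha> powr p * \<bar>h i\<bar> powr p)
        \<le> Cp * (\<alpha> * ((\<bar>u i\<bar> powr p + u i powr (p - 2) * (h i)\<^sup>2) / 2) + \<alpha> powr p * \<bar>h i\<bar> powr p)"
        unfolding Cp_def using l p by (intro mult_left_mono) (auto simp: algebra_simps)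
      finally have "(u i + \<alpha> * h i) powr p \<le> u i powr p
          + Cp * (\<alpha> * ((\<bar>u i\<bar> powr p + u i powr (p - 2) * (h i)\<^sup>2) / 2) + \<alpha> powr p * \<bar>h i\<bar> powr p)" by simp
      moreover have "\<bar>u' i\<bar> = u i + \<alpha> * h i" using u'[OF i] u0[OF i] h0[of i] \<alpha>_pos unfolding h_def by simp
      ultimately show ?thesis using u0[OF i] by simp
    qed
    then have "pw p u' \<le> (\<Sum>i<n. \<bar>u i\<bar> powr p + Cp * (\<alpha> * ((\<bar>u i\<bar> powr p + u i powr (p - 2) * (h i)\<^sup>2) / 2)
        + \<alpha> powr p * \<bar>h i\<bar> powr p))"
      unfolding pw_def by (intro sum_mono) auto
    also have "\<dots> = pw p u + Cp * (\<alpha> * ((pw p u + wsq (\<lambda>i. u i powr (p - 2)) h) / 2) + \<alpha> powr p * pw p h)"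
      unfolding pw_def wsq_def
      by (simp only: sum.distrib sum_distrib_left[symmetric] sum_divide_distrib[symmetric])
    also have "\<dots> \<le> pw p u + Cp * (\<alpha> * ((1 + 4) / 2) + \<alpha> powr p * \<tau>)"
      using pw_u_le[OF inv cnt] E(2) t pwh Cp_ge \<alpha>_pos
      by (intro add_left_mono mult_left_mono add_mono divide_right_mono) auto
    also have "\<dots> \<le> pw p u + 8 * Cp * \<alpha>"
      unfolding \<alpha>\<tau> using Cp_ge \<alpha>_pos by (simp add: algebra_simps)
    finally show ?thesis .
  qed
  moreover have "pw p u \<le> 8 * Cp * \<alpha> * cnt" using inv unfolding minv_def by auto
  ultimately have pw': "pw p u' \<le> 8 * Cp * \<alpha> * real (Suc cnt)" by (simp add: algebra_simps)
  have energy: "kw * (\<tau> powr (2 / p) / (2 * \<Lambda>)) \<le> wsq (mW racc u') (mv x)" if "dot g x = c" for x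
  proof -
    have "kw * (\<tau> powr (2 / p) / (2 * \<Lambda>)) \<le> wsq (mW racc u) (mv x)"
      using inv that unfolding minv_def by auto
    also have "\<dots> \<le> wsq (mW racc u') (mv x)"
      unfolding wsq_def mW_def using u'_ge u0 p
      by (intro sum_mono mult_right_mono add_left_mono mult_left_mono powr_mono2) auto
    finally show ?thesis .
  qed
  \<comment> \<open>This is the triangle inequality for the seminorm
    \<open>sqrt (a * wsq D)\<close>, in which every step has length at most \<open>2\<close>. It is
    proved for squares with weights \<open>1 / k\<close> and \<open>k\<close>, so the first step,
    \<open>k = 0\<close>, is separate.\<close>
  have quad: "a * wsq D (mv S') \<le> 4 * (real (Suc cnt))\<^sup>2"
  proof (cases "cnt = 0")
    case True
    have nn: "0 \<le> wsq D (mv S)" using D by (intro wsq_nonneg)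
    have "a * wsq D (mv S) \<le> 0" using inv True unfolding minv_def by auto
    then have "wsq D (mv S) = 0" using nn a by (simp add: mult_le_0_iff)
    then have "\<forall>i\<in>{..<n}. D i * (mv S i)\<^sup>2 = 0"
      unfolding wsq_def using D by (subst (asm) sum_nonneg_eq_0_iff) auto
    then have "wsq D (mv S') = wsq D y"
      unfolding wsq_def mvS' using y by (intro sum.cong) auto
    then show ?thesis using E(1) True by simp
  next
    case False
    let ?k = "real cnt"
    have k: "0 < ?k" using False by simp
    have "D i * (mv S' i)\<^sup>2 \<le> (1 + 1 / ?k) * (D i * (mv S i)\<^sup>2) + (1 + ?k) * (D i * (y i)\<^sup>2)" if i: "i < n" for i
    proof -
      have "0 \<le> (mv S i - ?k * y i)\<^sup>2 / ?k" using k by simp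
      also have "\<dots> = (1 / ?k) * (mv S i)\<^sup>2 + ?k * (y i)\<^sup>2 - 2 * mv S i * y i"
        using k by (simp add: field_simps power2_eq_square)
      finally have "(mv S i + y i)\<^sup>2 \<le> (1 + 1 / ?k) * (mv S i)\<^sup>2 + (1 + ?k) * (y i)\<^sup>2"
        by (simp add: power2_eq_square algebra_simps)
      then have "D i * (mv S i + y i)\<^sup>2 \<le> D i * ((1 + 1 / ?k) * (mv S i)\<^sup>2 + (1 + ?k) * (y i)\<^sup>2)"
        using D[OF i] by (rule mult_left_mono)
      then show ?thesis unfolding mvS' y[OF i] by (simp add: algebra_simps)
    qed
    then have "wsq D (mv S') \<le> (\<Sum>i<n. (1 + 1 / ?k) * (D i * (mv S i)\<^sup>2) + (1 + ?k) * (D i * (y i)\<^sup>2))"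
      unfolding wsq_def by (intro sum_mono) auto
    also have "\<dots> = (1 + 1 / ?k) * wsq D (mv S) + (1 + ?k) * wsq D y"
      unfolding wsq_def by (simp only: sum.distrib sum_distrib_left[symmetric])
    finally have "a * wsq D (mv S') \<le> a * ((1 + 1 / ?k) * wsq D (mv S) + (1 + ?k) * wsq D y)"
      using a by (intro mult_left_mono) auto
    also have "\<dots> = (1 + 1 / ?k) * (a * wsq D (mv S)) + (1 + ?k) * (a * wsq D y)"
      by (simp add: algebra_simps)
    also have "\<dots> \<le> (1 + 1 / ?k) * (4 * ?k\<^sup>2) + (1 + ?k) * 4"
      using inv E(1) k unfolding minv_def by (intro add_mono mult_left_mono) auto
    also have "\<dots> = 4 * (real (Suc cnt))\<^sup>2"
      using k by (simp add: field_simps power2_eq_square)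
    finally show ?thesis .
  qed
  have "\<alpha> * (a powr (1 / p) * \<bar>mv S' i\<bar>) \<le> u' i" if i: "i < n" for i
  proof -
    have "\<alpha> * (a powr (1 / p) * \<bar>mv S' i\<bar>) \<le> \<alpha> * (a powr (1 / p) * (\<bar>mv S i\<bar> + \<bar>y i\<bar>))"
      unfolding mvS' y[OF i] using \<alpha>_pos by (intro mult_left_mono abs_triangle_ineq) auto
    also have "\<dots> \<le> u' i"
      using inv i unfolding minv_def u'[OF i] by (simp add: distrib_left)
    finally show ?thesis .
  qed
  moreover have "dot g S' = real (Suc cnt) * c"
  proof -
    have "dot g S' = dot g (\<lambda>j. S j + \<Delta> j)" by (intro dot_cong) (simp_all add: S')
    then show ?thesis using inv dot_\<Delta> unfolding minv_def dot_add by (simp add: algebra_simps)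
  qed
  moreover have "\<forall>i<n. 0 \<le> racc i \<and> 0 \<le> u' i" using racc0 u0 u'_ge order_trans by blast
  ultimately show ?thesis using inv pw' energy quad unfolding minv_def by auto
qed

end

text \<open>Of at least \<open>\<iota>\<close> steps at most \<open>\<iota> / 2\<close> are width
  steps, so \<open>cnt \<ge> \<iota> / 2\<close> and
  \<open>1 / (\<alpha> * cnt) \<le> 32 * Cp\<close>; this factor converts the bound on
  \<open>u\<close> into one on the average of the steps.\<close>

lemma minv_final:
  assumes inv: "minv racc u S kw cnt" and "\<iota> \<le> kw + cnt" "kw + cnt \<le> 2 * \<iota>"
  shows "0 < cnt" "dot g (\<lambda>j. S j / cnt) = c" "a * wsq D (mv (\<lambda>j. S j / cnt)) \<le> 4"
    "a * pw p (mv (\<lambda>j. S j / cnt)) \<le> (32 * Cp) powr p"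
proof -
  have cnt: "cnt \<le> 2 * \<iota>" using assms by linarith
  have "kw \<le> \<iota> / 2" by (rule energy_bounds(2)[OF inv cnt])
  then have ge: "\<iota> / 2 \<le> cnt" using assms(2) by linarith
  then show pos: "0 < cnt" using \<iota> by linarith
  have eq: "(\<lambda>j. S j / cnt) = (\<lambda>j. (1 / real cnt) * S j)" by simp
  show "dot g (\<lambda>j. S j / cnt) = c"
    unfolding eq dot_scale using inv pos unfolding minv_def by simp
  have mveq: "mv (\<lambda>j. S j / cnt) = (\<lambda>i. (1 / real cnt) * mv S i)"
    unfolding eq using mv_scale by blast
  have "a * wsq D (mv (\<lambda>j. S j / cnt)) = (a * wsq D (mv S)) / (real cnt)\<^sup>2"
    unfolding mveq wsq_scale by (simp add: power_divide)
  also have "\<dots> \<le> 4 * (real cnt)\<^sup>2 / (real cnt)\<^sup>2"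
    using inv unfolding minv_def by (intro divide_right_mono) auto
  finally show "a * wsq D (mv (\<lambda>j. S j / cnt)) \<le> 4" using pos by simp
  have \<alpha>cnt: "1 / (32 * Cp) \<le> \<alpha> * cnt"
  proof -
    have "1 / (32 * Cp) = \<alpha> * (\<iota> / 2)" unfolding \<alpha>_def using Cp_ge \<iota> by (simp add: field_simps)
    also have "\<dots> \<le> \<alpha> * cnt" using ge \<alpha>_pos by (intro mult_left_mono) auto
    finally show ?thesis .
  qed
  then have inv\<alpha>: "0 < \<alpha> * cnt" "1 / (\<alpha> * cnt) \<le> 32 * Cp" using Cp_ge \<alpha>_pos pos by (auto simp: field_simps)
  have "a * pw p (mv (\<lambda>j. S j / cnt)) = pw p (\<lambda>i. a powr (1 / p) * ((1 / real cnt) * mv S i))"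
    unfolding mveq pw_scale[of p "a powr (1/p)"] using a p by (simp add: powr_powr)
  also have "\<dots> \<le> pw p (\<lambda>i. 1 / (\<alpha> * cnt) * u i)"
    unfolding pw_def
  proof (intro sum_mono powr_mono2)
    fix i assume i: "i \<in> {..<n}"
    have "\<alpha> * (a powr (1 / p) * \<bar>mv S i\<bar>) \<le> u i" and "0 \<le> u i" using inv i unfolding minv_def by auto
    then have "\<alpha> * (a powr (1 / p) * \<bar>mv S i\<bar>) / (\<alpha> * cnt) \<le> u i / (\<alpha> * cnt)"
      using inv\<alpha> by (intro divide_right_mono) auto
    then show "\<bar>a powr (1 / p) * (1 / real cnt * mv S i)\<bar> \<le> \<bar>1 / (\<alpha> * cnt) * u i\<bar>"
      using \<alpha>_pos pos \<open>0 \<le> u i\<close> by (simp add: abs_mult)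
  qed (use p in auto)
  also have "\<dots> = (1 / (\<alpha> * cnt)) powr p * pw p u"
    unfolding pw_scale using inv\<alpha> by simp
  also have "\<dots> \<le> (32 * Cp) powr p * 1"
    using pw_u_le[OF inv cnt] inv\<alpha> p pw_nonneg by (intro mult_mono powr_mono2) auto
  finally show "a * pw p (mv (\<lambda>j. S j / cnt)) \<le> (32 * Cp) powr p" by simp
qed

lemma minv_initial:
  assumes "\<And>i. i < n \<Longrightarrow> racc i = 0" "\<And>i. i < n \<Longrightarrow> u i = 0" "\<And>j. j < d \<Longrightarrow> S j = 0"
  shows "minv racc u S 0 0"
proof -
  have "mv S i = 0" for i unfolding mv_def using assms by simp
  moreover have "wsq racc x = 0" for x unfolding wsq_def using assms by simp
  moreover have "pw p u = 0" unfolding pw_def using assms p by simp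
  moreover have "dot g S = 0" unfolding dot_def using assms by simp
  moreover have "0 \<le> wsq (mW racc u) (mv x)" for x
    using assms a D r0 unfolding mW_def
    by (intro wsq_nonneg) (auto intro!: add_nonneg_nonneg mult_nonneg_nonneg simp: less_imp_le)
  ultimately show ?thesis unfolding minv_def hb_def using assms by (auto simp: wsq_def)
qed

end

section \<open>Random signs and Lewis weights\<close>

text \<open>Expectation over independent fair bits in the listed positions, the other values of
  \<open>h\<close> being kept. The recursion draws the bits in the order of the loop of
  \<open>Flip\<close> commands, so it can be matched with the program without a product probability
  space.\<close>

fun bavg :: "nat list \<Rightarrow> ((nat \<Rightarrow> nat) \<Rightarrow> real) \<Rightarrow> (nat \<Rightarrow> nat) \<Rightarrow> real" where
  "bavg [] F h = F h"
| "bavg (i # is) F h = (bavg is F (h(i := 0)) + bavg is F (h(i := 1))) / 2"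

lemma bavg_mono_strong:
  assumes "\<And>h'. (\<forall>j. j \<notin> set is \<longrightarrow> h' j = h j) \<Longrightarrow> F h' \<le> G h'"
  shows "bavg is F h \<le> bavg is G h"
  using assms
proof (induction "is" arbitrary: h)
  case (Cons i "is")
  have "bavg is F (h(i := 0)) \<le> bavg is G (h(i := 0))" "bavg is F (h(i := 1)) \<le> bavg is G (h(i := 1))"
    by (rule Cons.IH, rule Cons.prems, auto)+
  then show ?case by simp
qed simp

lemma bavg_cong:
  assumes "\<And>h'. (\<forall>j. j \<notin> set is \<longrightarrow> h' j = h j) \<Longrightarrow> F h' = G h'"
  shows "bavg is F h = bavg is G h"
  by (intro antisym bavg_mono_strong) (use assms in auto)

lemma bavg_mono: "(\<And>h. F h \<le> G h) \<Longrightarrow> bavg is F h \<le> bavg is G h"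
  by (rule bavg_mono_strong)

lemma bavg_const: "bavg is (\<lambda>_. c) h = c"
  by (induction "is" arbitrary: h) auto

lemma bavg_add: "bavg is (\<lambda>h. F h + G h) h = bavg is F h + bavg is G h"
  by (induction "is" arbitrary: h) (auto simp: field_simps)

lemma bavg_scale: "bavg is (\<lambda>h. c * F h) h = c * bavg is F h"
  by (induction "is" arbitrary: h) (auto simp: field_simps)

lemma bavg_sum: "finite I \<Longrightarrow> bavg is (\<lambda>h. \<Sum>i\<in>I. F i h) h = (\<Sum>i\<in>I. bavg is (F i) h)"
  by (induction I rule: finite_induct) (auto simp: bavg_const bavg_add)

definition sg :: "(nat \<Rightarrow> nat) \<Rightarrow> nat \<Rightarrow> real" where
  "sg h i = 2 * real (h i) - 1"

text \<open>The offset \<open>z\<close> collects the signs already drawn, which turns moments of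
  sign sums into inductions along the list.\<close>

lemma bavg_Cons_sign_sum:
  assumes "distinct (i # is)"
  shows "bavg (i # is) (\<lambda>h. G (z + (\<Sum>j\<in>set (i # is). c j * sg h j))) h
    = (bavg is (\<lambda>h. G ((z - c i) + (\<Sum>j\<in>set is. c j * sg h j))) (h(i := 0))
       + bavg is (\<lambda>h. G ((z + c i) + (\<Sum>j\<in>set is. c j * sg h j))) (h(i := 1))) / 2"
proof -
  have "bavg is (\<lambda>h. G (z + (\<Sum>j\<in>set (i # is). c j * sg h j))) (h(i := k))
      = bavg is (\<lambda>h. G ((z + c i * (2 * real k - 1)) + (\<Sum>j\<in>set is. c j * sg h j))) (h(i := k))" for k
  proof (rule bavg_cong)
    fix h' assume "\<forall>j. j \<notin> set is \<longrightarrow> h' j = (h(i := k)) j"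
    then have "sg h' i = 2 * real k - 1" using assms by (simp add: sg_def)
    then show "G (z + (\<Sum>j\<in>set (i # is). c j * sg h' j))
      = G (z + c i * (2 * real k - 1) + (\<Sum>j\<in>set is. c j * sg h' j))"
      using assms by (simp add: add.assoc)
  qed
  from this[of 0] this[of 1] show ?thesis by simp
qed

lemma sign_sum_second_moment:
  assumes "distinct is"
  shows "bavg is (\<lambda>h. (z + (\<Sum>j\<in>set is. c j * sg h j))\<^sup>2) h = z\<^sup>2 + (\<Sum>j\<in>set is. (c j)\<^sup>2)"
  using assms
proof (induction "is" arbitrary: z h)
  case (Cons i "is")
  then have "distinct is" "i \<notin> set is" by auto
  then show ?case
    unfolding bavg_Cons_sign_sum[OF Cons.prems, of "\<lambda>x. x\<^sup>2"]
    by (simp add: Cons.IH) (simp add: power2_eq_square algebra_simps)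
qed simp

text \<open>The right-hand side is the fourth moment of \<open>z\<close> plus a centred Gaussian
  with the variance of the sum; drawing one sign reproduces it up to the term
  \<open>- 2 * (c i)^4\<close>.\<close>

lemma sign_sum_fourth_moment:
  assumes "distinct is"
  shows "bavg is (\<lambda>h. (z + (\<Sum>j\<in>set is. c j * sg h j))^4) h
    \<le> z^4 + 6 * z\<^sup>2 * (\<Sum>j\<in>set is. (c j)\<^sup>2) + 3 * (\<Sum>j\<in>set is. (c j)\<^sup>2)\<^sup>2"
  using assms
proof (induction "is" arbitrary: z h)
  case (Cons i "is")
  let ?Q = "\<Sum>j\<in>set is. (c j)\<^sup>2"
  have dis: "distinct is" "i \<notin> set is" using Cons.prems by auto
  have "bavg (i # is) (\<lambda>h. (z + (\<Sum>j\<in>set (i # is). c j * sg h j))^4) h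
    \<le> (((z - c i)^4 + 6 * (z - c i)\<^sup>2 * ?Q + 3 * ?Q\<^sup>2) + ((z + c i)^4 + 6 * (z + c i)\<^sup>2 * ?Q + 3 * ?Q\<^sup>2)) / 2"
    unfolding bavg_Cons_sign_sum[OF Cons.prems, of "\<lambda>x. x^4"]
    using Cons.IH[OF dis(1)] by (intro divide_right_mono add_mono) auto
  also have "\<dots> = z^4 + 6 * z\<^sup>2 * ((c i)\<^sup>2 + ?Q) + 3 * ((c i)\<^sup>2 + ?Q)\<^sup>2 - 2 * (c i)^4"
    by (simp add: power2_eq_square power4_eq_xxxx algebra_simps)
  also have "\<dots> \<le> z^4 + 6 * z\<^sup>2 * ((c i)\<^sup>2 + ?Q) + 3 * ((c i)\<^sup>2 + ?Q)\<^sup>2" by simp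
  finally show ?case using dis by simp
qed simp

text \<open>The Paley--Zygmund argument: the indicator is bounded by a quadratic polynomial in the square
  of the sum.\<close>

lemma sign_sum_anticoncentration:
  assumes "distinct is" and \<sigma>: "\<sigma> = (\<Sum>j\<in>set is. (c j)\<^sup>2)"
  shows "bavg is (\<lambda>h. if (\<Sum>j\<in>set is. c j * sg h j)\<^sup>2 < \<sigma> / 2 then 1 else 0) h \<le> 8 / 9"
proof (cases "\<sigma> = 0")
  case True
  then show ?thesis by (simp add: bavg_const)
next
  case False
  then have pos: "0 < \<sigma>" unfolding \<sigma> by (simp add: sum_nonneg order_less_le)
  let ?S = "\<lambda>h. \<Sum>j\<in>set is. c j * sg h j"
  have m2: "bavg is (\<lambda>h. (?S h)\<^sup>2) h = \<sigma>"
    using sign_sum_second_moment[OF assms(1), of 0 c h] \<sigma> by simp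
  have m4: "bavg is (\<lambda>h. (?S h)^4) h \<le> 3 * \<sigma>\<^sup>2"
    using sign_sum_fourth_moment[OF assms(1), of 0 c h] \<sigma> by simp
  \<comment> \<open>The polynomial is the square of a decreasing linear function with value
    \<open>1\<close> at \<open>x = \<sigma> / 2\<close>. Its slope
    \<open>- 2 / (9 * \<sigma>)\<close> minimizes the expectation when the first two moments of
    \<open>x\<close> are \<open>\<sigma>\<close> and \<open>3 * \<sigma>\<^sup>2\<close>.\<close>
  have pt: "(if x < \<sigma> / 2 then 1 else 0) \<le> 100 / 81 + (- (40 / 81) / \<sigma>) * x + (4 / 81 / \<sigma>\<^sup>2) * x\<^sup>2" for x :: real
  proof -
    define u where "u = 4 / 9 * (x / \<sigma> - 1 / 2)"
    have "100 / 81 + (- (40 / 81) / \<sigma>) * x + (4 / 81 / \<sigma>\<^sup>2) * x\<^sup>2 = (1 - u / 2)\<^sup>2"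
      unfolding u_def using pos by (simp add: field_simps power2_eq_square)
    moreover have "(if x < \<sigma> / 2 then 1 else 0) \<le> (1 - u / 2)\<^sup>2"
    proof (cases "x < \<sigma> / 2")
      case True
      then have "u < 0" unfolding u_def using pos by (simp add: field_simps)
      then have "1\<^sup>2 \<le> (1 - u / 2)\<^sup>2" by (intro power_mono) auto
      then show ?thesis using True by simp
    qed simp
    ultimately show ?thesis by simp
  qed
  have "bavg is (\<lambda>h. if (?S h)\<^sup>2 < \<sigma> / 2 then 1 else 0) h
    \<le> bavg is (\<lambda>h. 100 / 81 + (- (40 / 81) / \<sigma>) * (?S h)\<^sup>2 + (4 / 81 / \<sigma>\<^sup>2) * (?S h)^4) h"
  proof (rule bavg_mono)
    fix h
    show "(if (?S h)\<^sup>2 < \<sigma> / 2 then 1 else 0)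
      \<le> 100 / 81 + (- (40 / 81) / \<sigma>) * (?S h)\<^sup>2 + (4 / 81 / \<sigma>\<^sup>2) * (?S h)^4"
      using pt[of "(?S h)\<^sup>2"] unfolding power_mult[symmetric] by simp
  qed
  also have "\<dots> = 100 / 81 + (- (40 / 81) / \<sigma>) * \<sigma> + (4 / 81 / \<sigma>\<^sup>2) * bavg is (\<lambda>h. (?S h)^4) h"
    unfolding bavg_add bavg_scale bavg_const m2 ..
  also have "\<dots> \<le> 100 / 81 + (- (40 / 81) / \<sigma>) * \<sigma> + (4 / 81 / \<sigma>\<^sup>2) * (3 * \<sigma>\<^sup>2)"
    using m4 by (intro add_left_mono mult_left_mono) auto
  also have "\<dots> = 8 / 9" using pos by simp
  finally show ?thesis .
qed

text \<open>Dividing by \<open>d + T\<close>, where \<open>T\<close> is the sum of all squares, keeps the estimates bounded by \<open>d\<close>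
  and their sum too, and costs a constant factor unless \<open>T > 36 d\<close>.\<close>

lemma sample_failure:
  fixes c :: "nat \<Rightarrow> nat \<Rightarrow> real" and d :: real
  assumes "0 < d" and tr: "(\<Sum>i<n. \<Sum>j<n. (c i j)\<^sup>2) \<le> d" and "i < n"
  shows "bavg [0..<n] (\<lambda>h. if (\<Sum>j<n. c i j * sg h j)\<^sup>2 * d / (d + (\<Sum>i<n. (\<Sum>j<n. c i j * sg h j)\<^sup>2))
      < (\<Sum>j<n. (c i j)\<^sup>2) / 74 then 1 else 0) h \<le> 11 / 12"
proof -
  let ?S = "\<lambda>i h. \<Sum>j<n. c i j * sg h j" and ?\<sigma> = "\<Sum>j<n. (c i j)\<^sup>2"
  let ?T = "\<lambda>h. \<Sum>i<n. (?S i h)\<^sup>2"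
  have set: "set [0..<n] = {..<n}" by auto
  have T0: "0 \<le> ?T h" for h by (intro sum_nonneg) auto
  \<comment> \<open>Either the square is below half of its mean, with probability at most
    \<open>8 / 9\<close>, or \<open>?T\<close> exceeds \<open>36 * d\<close>, with probability at
    most \<open>1 / 36\<close> by Markov's inequality; the sum is \<open>11 / 12\<close>. Otherwise
    the denominator is at most \<open>37 * d\<close>, whence the constant \<open>74\<close>.\<close>
  have "bavg [0..<n] (\<lambda>h. if (?S i h)\<^sup>2 * d / (d + ?T h) < ?\<sigma> / 74 then 1 else 0) h
    \<le> bavg [0..<n] (\<lambda>h. (if (?S i h)\<^sup>2 < ?\<sigma> / 2 then 1 else 0) + 1 / (36 * d) * ?T h) h"
  proof (rule bavg_mono)
    fix h
    show "(if (?S i h)\<^sup>2 * d / (d + ?T h) < ?\<sigma> / 74 then 1 else 0)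
      \<le> (if (?S i h)\<^sup>2 < ?\<sigma> / 2 then 1 else 0) + 1 / (36 * d) * ?T h"
    proof (cases "(?S i h)\<^sup>2 < ?\<sigma> / 2")
      case True
      then show ?thesis using T0 assms by simp
    next
      case False
      show ?thesis
      proof (cases "?T h \<le> 36 * d")
        case True
        have "?\<sigma> / 74 = ?\<sigma> / 2 * d / (37 * d)" using assms by simp
        also have "\<dots> \<le> (?S i h)\<^sup>2 * d / (d + ?T h)"
          using False True T0[of h] assms by (intro frac_le mult_right_mono) (auto simp: add_pos_nonneg)
        finally show ?thesis using T0[of h] assms by simp
      next
        case False
        then have "1 \<le> 1 / (36 * d) * ?T h" using assms by (simp add: field_simps)
        then show ?thesis by simp
      qed
    qed
  qed
  also have "\<dots> = bavg [0..<n] (\<lambda>h. if (?S i h)\<^sup>2 < ?\<sigma> / 2 then 1 else 0) h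
      + 1 / (36 * d) * (\<Sum>i<n. bavg [0..<n] (\<lambda>h. (?S i h)\<^sup>2) h)"
    unfolding bavg_add bavg_scale bavg_sum[OF finite_lessThan] ..
  also have "\<dots> \<le> 8 / 9 + 1 / (36 * d) * d"
  proof (intro add_mono mult_left_mono)
    show "bavg [0..<n] (\<lambda>h. if (?S i h)\<^sup>2 < ?\<sigma> / 2 then 1 else 0) h \<le> 8 / 9"
      using sign_sum_anticoncentration[of "[0..<n]" ?\<sigma> "c i" h] unfolding set by simp
    have "bavg [0..<n] (\<lambda>h. (?S i h)\<^sup>2) h = (\<Sum>j<n. (c i j)\<^sup>2)" for i
      using sign_sum_second_moment[of "[0..<n]" 0 "c i" h] unfolding set by simp
    then show "(\<Sum>i<n. bavg [0..<n] (\<lambda>h. (?S i h)\<^sup>2) h) \<le> d" using tr by simp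
  qed (use assms in auto)
  also have "\<dots> \<le> 11 / 12" using assms by simp
  finally show ?thesis .
qed

section \<open>Leverage scores under full column rank\<close>

locale full_design = design +
  assumes ex_nsol: "(\<And>i. i < n \<Longrightarrow> 0 < W i) \<Longrightarrow> \<exists>z. nsol W g z"
    and inj: "(\<And>i. i < n \<Longrightarrow> mv x i = 0) \<Longrightarrow> j < d \<Longrightarrow> x j = 0"
begin

lemma nsol_unique:
  assumes "\<And>i. i < n \<Longrightarrow> 0 < W i" "nsol W g z" "nsol W g z'" "j < d"
  shows "z j = z' j"
proof -
  let ?x = "\<lambda>j. z j - z' j"
  have "(\<Sum>i<n. W i * mv z i * mv ?x i) = (\<Sum>i<n. W i * mv z' i * mv ?x i)"
    using nsol_dot[OF assms(2), of ?x] nsol_dot[OF assms(3), of ?x] by simp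
  then have "(\<Sum>i<n. W i * mv z i * mv ?x i - W i * mv z' i * mv ?x i) = 0" by (simp add: sum_subtractf)
  moreover have "W i * mv z i * mv ?x i - W i * mv z' i * mv ?x i = W i * (mv ?x i)\<^sup>2" for i
    unfolding mv_diff by (simp add: power2_eq_square algebra_simps)
  ultimately have "(\<Sum>i<n. W i * (mv ?x i)\<^sup>2) = 0" by simp
  then have "\<forall>i\<in>{..<n}. W i * (mv ?x i)\<^sup>2 = 0"
    using assms(1) by (subst (asm) sum_nonneg_eq_0_iff) (auto simp: less_imp_le)
  then have "mv ?x i = 0" if "i < n" for i
  proof -
    have "W i * (mv ?x i)\<^sup>2 = 0" using \<open>\<forall>i\<in>{..<n}. _\<close> that by blast
    then show ?thesis using assms(1)[OF that] by simp
  qed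
  from inj[OF this assms(4)] show ?thesis by simp
qed

lemma nsol_sum:
  assumes "\<And>k. k < m \<Longrightarrow> nsol W (G k) (Z k)"
  shows "nsol W (\<lambda>j. \<Sum>k<m. t k * G k j) (\<lambda>j. \<Sum>k<m. t k * Z k j)"
proof -
  have mv: "mv (\<lambda>j. \<Sum>k<m. t k * Z k j) i = (\<Sum>k<m. t k * mv (Z k) i)" for i
    unfolding mv_def sum_distrib_left by (subst sum.swap) (simp add: algebra_simps)
  have "mt (\<lambda>i. W i * mv (\<lambda>j. \<Sum>k<m. t k * Z k j) i) j = (\<Sum>k<m. t k * mt (\<lambda>i. W i * mv (Z k) i) j)" for j
    unfolding mv unfolding mt_def sum_distrib_left by (subst sum.swap) (simp add: algebra_simps)
  then show ?thesis using assms unfolding nsol_def by simp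
qed

text \<open>\<open>c\<close> is the matrix of the orthogonal projection onto the range of \<open>V\<^bsup>1/2\<^esup>M\<close>; the squared norms of
  its rows are the leverage scores, and its trace is \<open>d\<close>.\<close>

lemma leverage_matrix:
  assumes v: "\<And>i. i < n \<Longrightarrow> 0 < v i"
  obtains c where
    "\<And>\<xi> z i. nsol v (mt (\<lambda>i. sqrt (v i) * \<xi> i)) z \<Longrightarrow> i < n \<Longrightarrow> sqrt (v i) * mv z i = (\<Sum>j<n. c i j * \<xi> j)"
    "(\<Sum>i<n. \<Sum>j<n. (c i j)\<^sup>2) = d"
    "\<And>x i. i < n \<Longrightarrow> v i * (mv x i)\<^sup>2 \<le> (\<Sum>j<n. (c i j)\<^sup>2) * wsq v (mv x)"
proof -
  \<comment> \<open>\<open>Z j\<close> solves for the scaled row \<open>j\<close> of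
    \<open>M\<close> and yields column \<open>j\<close> of the projection; \<open>Y k\<close> below
    is column \<open>k\<close> of the inverse Gram matrix and serves to compute the trace.\<close>
  have "\<forall>j. \<exists>z. nsol v (\<lambda>k. sqrt (v j) * M j k) z" using ex_nsol v by auto
  then obtain Z where Z: "\<And>j. nsol v (\<lambda>k. sqrt (v j) * M j k) (Z j)" by metis
  have "\<forall>k. \<exists>z. nsol v (\<lambda>l. if l = k then 1 else 0) z" using ex_nsol v by auto
  then obtain Y where Y: "\<And>k. nsol v (\<lambda>l. if l = k then 1 else 0) (Y k)" by metis
  define c where "c i j = sqrt (v i) * mv (Z j) i" for i j
  have lin: "sqrt (v i) * mv z i = (\<Sum>j<n. c i j * \<xi> j)"
    if z: "nsol v (mt (\<lambda>i. sqrt (v i) * \<xi> i)) z" and i: "i < n" for \<xi> z i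
  proof -
    have "nsol v (\<lambda>k. \<Sum>j<n. \<xi> j * (sqrt (v j) * M j k)) (\<lambda>k. \<Sum>j<n. \<xi> j * Z j k)"
      by (rule nsol_sum) (rule Z)
    moreover have "(\<lambda>k. \<Sum>j<n. \<xi> j * (sqrt (v j) * M j k)) = mt (\<lambda>i. sqrt (v i) * \<xi> i)"
      unfolding mt_def by (simp add: fun_eq_iff algebra_simps)
    ultimately have "nsol v (mt (\<lambda>i. sqrt (v i) * \<xi> i)) (\<lambda>k. \<Sum>j<n. \<xi> j * Z j k)" by simp
    from nsol_unique[OF v z this] have "mv z i = mv (\<lambda>k. \<Sum>j<n. \<xi> j * Z j k) i" by (intro mv_cong)
    also have "\<dots> = (\<Sum>j<n. \<xi> j * mv (Z j) i)"
      unfolding mv_def sum_distrib_left by (subst sum.swap) (simp add: algebra_simps)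
    finally show ?thesis unfolding c_def by (simp add: sum_distrib_left algebra_simps)
  qed
  moreover have "v i * (mv x i)\<^sup>2 \<le> (\<Sum>j<n. (c i j)\<^sup>2) * wsq v (mv x)" if i: "i < n" for x i
  proof -
    \<comment> \<open>The projection fixes its range: \<open>x\<close> itself solves the system
      whose right-hand side comes from its own image. Cauchy-Schwarz on row \<open>i\<close> then
      gives the bound.\<close>
    have "nsol v (mt (\<lambda>i. sqrt (v i) * (sqrt (v i) * mv x i))) x"
      unfolding nsol_def mt_def using v by (auto intro!: sum.cong simp: less_imp_le simp flip: mult.assoc)
    from lin[OF this i] have eq: "sqrt (v i) * mv x i = (\<Sum>j<n. c i j * (sqrt (v j) * mv x j))" .
    have "v i * (mv x i)\<^sup>2 = (sqrt (v i) * mv x i)\<^sup>2" using v[OF i] by (simp add: power_mult_distrib)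
    also have "\<dots> \<le> (\<Sum>j<n. (c i j)\<^sup>2) * (\<Sum>j<n. (sqrt (v j) * mv x j)\<^sup>2)"
      unfolding eq by (rule Cauchy_Schwarz_ineq_sum)
    also have "(\<Sum>j<n. (sqrt (v j) * mv x j)\<^sup>2) = wsq v (mv x)"
      unfolding wsq_def using v by (intro sum.cong) (auto simp: power_mult_distrib less_imp_le)
    finally show ?thesis .
  qed
  \<comment> \<open>For an orthogonal projection the sum of squared entries is the trace, and by
    cyclicity the trace is that of the inverse Gram matrix times the Gram matrix.\<close>
  moreover have "(\<Sum>i<n. \<Sum>j<n. (c i j)\<^sup>2) = d"
  proof -
    have "(\<Sum>i<n. \<Sum>j<n. (c i j)\<^sup>2) = (\<Sum>j<n. \<Sum>i<n. v i * mv (Z j) i * mv (Z j) i)"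
      unfolding c_def using v
      by (subst sum.swap) (auto intro!: sum.cong simp: power_mult_distrib less_imp_le power2_eq_square)
    also have "\<dots> = (\<Sum>j<n. sqrt (v j) * mv (Z j) j)"
      unfolding nsol_dot[OF Z, symmetric] unfolding dot_def mv_def
      by (simp add: sum_distrib_left mult.assoc)
    also have "\<dots> = (\<Sum>j<n. \<Sum>k<d. M j k * (v j * mv (Y k) j))"
    proof (rule sum.cong[OF refl])
      fix j assume "j \<in> {..<n}"
      then have vj: "0 \<le> v j" using v[of j] by simp
      have "nsol v (\<lambda>l. \<Sum>k<d. (sqrt (v j) * M j k) * (if l = k then 1 else 0)) (\<lambda>l. \<Sum>k<d. (sqrt (v j) * M j k) * Y k l)"
        by (rule nsol_sum) (rule Y)
      then have "nsol v (\<lambda>k. sqrt (v j) * M j k) (\<lambda>l. \<Sum>k<d. (sqrt (v j) * M j k) * Y k l)"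
        unfolding nsol_def by (simp add: sum.delta' if_distrib[of "(*) _"] cong: if_cong)
      from nsol_unique[OF v Z this] have "mv (Z j) j = mv (\<lambda>l. \<Sum>k<d. (sqrt (v j) * M j k) * Y k l) j"
        by (intro mv_cong)
      also have "\<dots> = (\<Sum>k<d. sqrt (v j) * M j k * mv (Y k) j)"
        unfolding mv_def sum_distrib_left by (subst sum.swap) (simp add: algebra_simps)
      finally have "sqrt (v j) * mv (Z j) j = (\<Sum>k<d. sqrt (v j) * (sqrt (v j) * M j k * mv (Y k) j))"
        by (simp only: sum_distrib_left)
      also have "\<dots> = (\<Sum>k<d. M j k * (v j * mv (Y k) j))"
      proof (rule sum.cong[OF refl])
        fix k
        have "sqrt (v j) * (sqrt (v j) * M j k * mv (Y k) j) = (sqrt (v j) * sqrt (v j)) * (M j k * mv (Y k) j)"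
          by (simp only: mult.assoc)
        then show "sqrt (v j) * (sqrt (v j) * M j k * mv (Y k) j) = M j k * (v j * mv (Y k) j)"
          using vj by simp
      qed
      finally show "sqrt (v j) * mv (Z j) j = (\<Sum>k<d. M j k * (v j * mv (Y k) j))" .
    qed
    also have "\<dots> = (\<Sum>k<d. mt (\<lambda>i. v i * mv (Y k) i) k)"
      unfolding mt_def by (rule sum.swap)
    also have "\<dots> = (\<Sum>k<d. 1)" using Y unfolding nsol_def by (intro sum.cong) auto
    finally show ?thesis by simp
  qed
  ultimately show thesis using that by blast
qed

end

section \<open>Averaging over the rounds of the Lewis weight iteration\<close>

lemma exp_mean_le:
  fixes f :: "nat \<Rightarrow> real"
  assumes "0 < K"
  shows "exp ((\<Sum>k<K. f k) / K) \<le> (\<Sum>k<K. exp (f k)) / K"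
proof -
  define m where "m = (\<Sum>k<K. f k) / K"
  have "exp m * (1 + (f k - m)) \<le> exp (f k)" for k
  proof -
    have "exp m * (1 + (f k - m)) \<le> exp m * exp (f k - m)"
      using exp_ge_add_one_self[of "f k - m"] by (intro mult_left_mono) auto
    then show ?thesis by (simp flip: exp_add)
  qed
  then have "(\<Sum>k<K. exp m * (1 + (f k - m))) \<le> (\<Sum>k<K. exp (f k))" by (intro sum_mono)
  also have "(\<Sum>k<K. exp m * (1 + (f k - m))) = exp m * (K + ((\<Sum>k<K. f k) - K * m))"
    by (simp add: sum_distrib_left[symmetric] sum.distrib sum_subtractf)
  also have "\<dots> = exp m * K" unfolding m_def using assms by simp
  finally show ?thesis unfolding m_def[symmetric] using assms by (simp add: field_simps)
qed

lemma mean_ln_le: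
  fixes f :: "nat \<Rightarrow> real"
  assumes "0 < K" "\<And>k. k < K \<Longrightarrow> 0 < f k"
  shows "(\<Sum>k<K. ln (f k)) / K \<le> ln ((\<Sum>k<K. f k) / K)"
proof -
  have "exp ((\<Sum>k<K. ln (f k)) / K) \<le> (\<Sum>k<K. exp (ln (f k))) / K" by (rule exp_mean_le[OF assms(1)])
  also have "(\<Sum>k<K. exp (ln (f k))) = (\<Sum>k<K. f k)" using assms by (intro sum.cong) auto
  finally have "exp ((\<Sum>k<K. ln (f k)) / K) \<le> (\<Sum>k<K. f k) / K" .
  moreover have "0 < (\<Sum>k<K. f k) / K" using assms by (intro divide_pos_pos sum_pos) auto
  ultimately show ?thesis by (simp add: ln_ge_iff)
qed

text \<open>Since \<open>y k\<close> is a power of \<open>w k\<close>, the logarithm of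
  \<open>y k / w (Suc k)\<close> is a telescoping difference minus \<open>q * ln (y k)\<close>. The
  telescoped part costs at most \<open>ln 4\<close> per round by \<open>ratio\<close>, the mean of
  \<open>ln (y k)\<close> is at most \<open>ln V\<close>, and Jensen's inequality for
  \<open>exp\<close> leads back from logarithms.\<close>

lemma lewis_mean:
  fixes w :: "nat \<Rightarrow> real" and p :: real
  assumes p: "2 < p" and K: "0 < K" and w: "\<And>k. k \<le> K \<Longrightarrow> 0 < w k" and ratio: "w K \<le> 4 ^ K * w 0"
    and y: "\<And>k. k < K \<Longrightarrow> y k = w k powr ((p - 2) / p)" and V: "V = (\<Sum>k<K. y k) / K"
  shows "1 \<le> 4 * V powr (2 / (p - 2)) * ((\<Sum>k<K. y k / w (Suc k)) / K)"
proof -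
  define q where "q = 2 / (p - 2)"
  have q0: "0 < q" unfolding q_def using p by simp
  have y0: "0 < y k" if "k < K" for k using y[OF that] w[of k] that by simp
  have V0: "0 < V" unfolding V using y0 K by (intro divide_pos_pos sum_pos) auto
  have lny: "ln (y k) - ln (w (Suc k)) = - (ln (w (Suc k)) - ln (w k)) - q * ln (y k)" if "k < K" for k
  proof -
    have "ln (y k) = (p - 2) / p * ln (w k)" using y[OF that] w[of k] that by (simp add: ln_powr)
    moreover have "(1 + q) * ((p - 2) / p) = 1"
      unfolding q_def using p by (simp add: field_simps)
    ultimately have "(1 + q) * ln (y k) = ln (w k)" by (metis mult.assoc mult.left_neutral)
    then show ?thesis by (simp add: algebra_simps)
  qed
  have "exp ((\<Sum>k<K. ln (y k) - ln (w (Suc k))) / K) \<le> (\<Sum>k<K. exp (ln (y k) - ln (w (Suc k)))) / K"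
    by (rule exp_mean_le[OF K])
  also have "(\<Sum>k<K. exp (ln (y k) - ln (w (Suc k)))) = (\<Sum>k<K. y k / w (Suc k))"
    using y0 w by (intro sum.cong) (auto simp: exp_diff)
  finally have jensen: "exp ((\<Sum>k<K. ln (y k) - ln (w (Suc k))) / K) \<le> (\<Sum>k<K. y k / w (Suc k)) / K" .
  have "(\<Sum>k<K. ln (y k) - ln (w (Suc k))) = (\<Sum>k<K. - (ln (w (Suc k)) - ln (w k)) - q * ln (y k))"
    using lny by (intro sum.cong) auto
  also have "\<dots> = - (\<Sum>k<K. ln (w (Suc k)) - ln (w k)) - q * (\<Sum>k<K. ln (y k))"
    by (simp only: sum_subtractf sum_negf sum_distrib_left)
  also have "(\<Sum>k<K. ln (w (Suc k)) - ln (w k)) = ln (w K) - ln (w 0)"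
    by (rule sum_lessThan_telescope)
  finally have sum: "(\<Sum>k<K. ln (y k) - ln (w (Suc k))) = - (ln (w K) - ln (w 0)) - q * (\<Sum>k<K. ln (y k))" .
  have "ln (w K) \<le> ln (4 ^ K * w 0)" using ratio w[of K] by simp
  also have "\<dots> = K * ln 4 + ln (w 0)" using w[of 0] by (simp add: ln_mult ln_realpow)
  finally have "(ln (w K) - ln (w 0)) / K \<le> ln 4" using K by (simp add: field_simps)
  moreover have "q * ((\<Sum>k<K. ln (y k)) / K) \<le> q * ln V"
    unfolding V using mean_ln_le[OF K y0] q0 by (intro mult_left_mono) auto
  ultimately have "- ln 4 - q * ln V \<le> (\<Sum>k<K. ln (y k) - ln (w (Suc k))) / K"
    unfolding sum by (simp add: diff_divide_distrib)
  then have "exp (- ln 4 - q * ln V) \<le> (\<Sum>k<K. y k / w (Suc k)) / K"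
    using jensen by (meson exp_le_cancel_iff order_trans)
  moreover have "4 * V powr q * exp (- ln 4 - q * ln V) = 1"
    using V0 by (simp add: powr_def exp_diff exp_minus)
  ultimately show ?thesis unfolding q_def[symmetric]
    by (metis mult_left_mono mult_nonneg_nonneg powr_ge_zero zero_le_numeral)
qed

context design
begin

context
  fixes p :: real and K :: nat and w y :: "nat \<Rightarrow> nat \<Rightarrow> real" and B :: real and V :: "nat \<Rightarrow> real"
  assumes p: "2 < p" and K: "0 < K" and w: "\<And>k i. k \<le> K \<Longrightarrow> i < n \<Longrightarrow> 0 < w k i"
    and y: "\<And>k i. k < K \<Longrightarrow> i < n \<Longrightarrow> y k i = w k i powr ((p - 2) / p)"
    and V: "\<And>i. i < n \<Longrightarrow> V i = (\<Sum>k<K. y k i) / K"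
begin

text \<open>Each \<open>y k\<close> is the power \<open>p - 2\<close> of a vector whose
  \<open>p\<close>-th powers sum to at most \<open>B\<close>. Hoelder's inequality applies round by
  round and passes to the average.\<close>

lemma lewis_hb:
  assumes B: "0 \<le> B" "\<And>k. k < K \<Longrightarrow> (\<Sum>i<n. w k i) \<le> B"
  shows "hb p V (B powr ((p - 2) / p))"
  unfolding hb_def
proof
  fix x
  have "wsq V x = (\<Sum>k<K. wsq (y k) x) / K"
  proof -
    have "wsq V x = (\<Sum>i<n. \<Sum>k<K. y k i * (x i)\<^sup>2 / K)"
      unfolding wsq_def using V by (simp add: sum_distrib_right sum_divide_distrib)
    also have "\<dots> = (\<Sum>k<K. \<Sum>i<n. y k i * (x i)\<^sup>2 / K)" by (rule sum.swap)
    finally show ?thesis unfolding wsq_def by (simp add: sum_divide_distrib)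
  qed
  also have "\<dots> \<le> (\<Sum>k<K. B powr ((p - 2) / p) * pw p x powr (2 / p)) / K"
  proof (intro divide_right_mono sum_mono)
    fix k assume "k \<in> {..<K}"
    then have k: "k < K" by simp
    let ?u = "\<lambda>i. w k i powr (1 / p)"
    have "wsq (y k) x = wsq (\<lambda>i. \<bar>?u i\<bar> powr (p - 2)) x"
      using y[OF k] p by (intro wsq_cong) (simp_all add: powr_powr)
    also have "\<dots> \<le> pw p ?u powr ((p - 2) / p) * pw p x powr (2 / p)"
      using hb_powr[OF p, of ?u] unfolding hb_def by auto
    also have "pw p ?u = (\<Sum>i<n. w k i)"
      unfolding pw_def using p w[of k] k by (intro sum.cong) (auto simp: powr_powr less_imp_le)
    also have "(\<Sum>i<n. w k i) powr ((p - 2) / p) * pw p x powr (2 / p)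
        \<le> B powr ((p - 2) / p) * pw p x powr (2 / p)"
      using B(2)[OF k] w[of k] k p
      by (intro mult_right_mono powr_mono2 sum_nonneg) (auto simp: less_imp_le)
    finally show "wsq (y k) x \<le> B powr ((p - 2) / p) * pw p x powr (2 / p)" .
  qed simp
  also have "\<dots> = B powr ((p - 2) / p) * pw p x powr (2 / p)" using K by simp
  finally show "wsq V x \<le> B powr ((p - 2) / p) * pw p x powr (2 / p)" .
qed

text \<open>The leverage inequality of round \<open>k\<close> is divided by
  \<open>w (Suc k) i\<close> and averaged over \<open>k\<close>, so that its right-hand side becomes
  the form of \<open>V\<close>; this is how concavity of the reciprocal score is exploited. With
  \<open>lewis_mean\<close> it bounds each squared coordinate, with \<open>296 = 4 * 74\<close>, and
  the power \<open>(p - 2) / 2\<close> of that bound is summed against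
  \<open>V i * (mv x i)\<^sup>2\<close>.\<close>

lemma lewis_norm:
  assumes ratio: "\<And>i. i < n \<Longrightarrow> w K i \<le> 4 ^ K * w 0 i"
    and lev: "\<And>k i x. k < K \<Longrightarrow> i < n \<Longrightarrow> y k i * (mv x i)\<^sup>2 \<le> 74 * w (Suc k) i * wsq (y k) (mv x)"
  shows "pw p (mv x) powr (2 / p) \<le> 296 powr ((p - 2) / p) * wsq V (mv x)"
proof -
  let ?N = "wsq V (mv x)"
  have V0: "0 < V i" if i: "i < n" for i
  proof -
    have "0 < y k i" if "k < K" for k using y[OF that i] w[of k i] that i by simp
    then show ?thesis unfolding V[OF i] using K by (intro divide_pos_pos sum_pos) auto
  qed
  have N0: "0 \<le> ?N" using V0 by (intro wsq_nonneg) (simp add: less_imp_le)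
  have coord: "(mv x i)\<^sup>2 \<le> 296 * V i powr (2 / (p - 2)) * ?N" if i: "i < n" for i
  proof -
    have "((\<Sum>k<K. y k i / w (Suc k) i) / K) * (mv x i)\<^sup>2 \<le> 74 * ?N"
    proof -
      have "(\<Sum>k<K. y k i / w (Suc k) i) * (mv x i)\<^sup>2 = (\<Sum>k<K. y k i * (mv x i)\<^sup>2 / w (Suc k) i)"
        by (simp add: sum_distrib_right)
      also have "\<dots> \<le> (\<Sum>k<K. 74 * wsq (y k) (mv x))"
      proof (rule sum_mono)
        fix k assume "k \<in> {..<K}"
        then show "y k i * (mv x i)\<^sup>2 / w (Suc k) i \<le> 74 * wsq (y k) (mv x)"
          using lev[of k i x] w[of "Suc k" i] i by (simp add: field_simps)
      qed
      also have "\<dots> = 74 * (K * ?N)"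
      proof -
        have "(\<Sum>k<K. wsq (y k) (mv x)) = (\<Sum>i<n. \<Sum>k<K. y k i * (mv x i)\<^sup>2)"
          unfolding wsq_def by (rule sum.swap)
        also have "\<dots> = K * ?N"
          unfolding wsq_def sum_distrib_left using V K
          by (intro sum.cong) (simp_all add: sum_distrib_right[symmetric])
        finally show ?thesis by (simp add: sum_distrib_left[symmetric])
      qed
      finally show ?thesis using K by (simp add: field_simps)
    qed
    have one: "1 \<le> 4 * V i powr (2 / (p - 2)) * ((\<Sum>k<K. y k i / w (Suc k) i) / K)"
      by (rule lewis_mean[OF p K]) (use w y V ratio i in auto)
    have "1 * (mv x i)\<^sup>2 \<le> (4 * V i powr (2 / (p - 2)) * ((\<Sum>k<K. y k i / w (Suc k) i) / K)) * (mv x i)\<^sup>2"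
      using one by (rule mult_right_mono) simp
    also have "\<dots> = 4 * V i powr (2 / (p - 2)) * (((\<Sum>k<K. y k i / w (Suc k) i) / K) * (mv x i)\<^sup>2)"
      by (simp only: mult.assoc)
    also have "\<dots> \<le> 4 * V i powr (2 / (p - 2)) * (74 * ?N)"
      using \<open>_ \<le> 74 * ?N\<close> by (intro mult_left_mono) auto
    finally show ?thesis by simp
  qed
  have "\<bar>mv x i\<bar> powr p \<le> 296 powr ((p - 2) / 2) * ?N powr ((p - 2) / 2) * (V i * (mv x i)\<^sup>2)" if i: "i < n" for i
  proof -
    have "\<bar>mv x i\<bar> powr (p - 2) = ((mv x i)\<^sup>2) powr ((p - 2) / 2)"
    proof -
      have "2 * ((p - 2) / 2) = p - 2" by simp
      then show ?thesis using square_powr[of "mv x i" "(p - 2) / 2"] by (simp only: power2_eq_square)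
    qed
    also have "\<dots> \<le> (296 * V i powr (2 / (p - 2)) * ?N) powr ((p - 2) / 2)"
      using coord[OF i] p by (intro powr_mono2) auto
    also have "\<dots> = 296 powr ((p - 2) / 2) * ?N powr ((p - 2) / 2) * V i"
    proof -
      have "(V i powr (2 / (p - 2))) powr ((p - 2) / 2) = V i powr (2 / (p - 2) * ((p - 2) / 2))"
        by (rule powr_powr)
      also have "2 / (p - 2) * ((p - 2) / 2) = 1" using p by simp
      finally have "(V i powr (2 / (p - 2))) powr ((p - 2) / 2) = V i" using V0[OF i] by simp
      then show ?thesis by (simp only: powr_mult ac_simps)
    qed
    finally have "\<bar>mv x i\<bar> powr (p - 2) * (mv x i)\<^sup>2
        \<le> 296 powr ((p - 2) / 2) * ?N powr ((p - 2) / 2) * V i * (mv x i)\<^sup>2" by (rule mult_right_mono) simp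
    then show ?thesis unfolding abs_powr_diff_two by (simp only: mult.assoc)
  qed
  then have "pw p (mv x) \<le> (\<Sum>i<n. 296 powr ((p - 2) / 2) * ?N powr ((p - 2) / 2) * (V i * (mv x i)\<^sup>2))"
    unfolding pw_def by (intro sum_mono) auto
  also have "\<dots> = 296 powr ((p - 2) / 2) * ?N powr ((p - 2) / 2) * ?N"
    unfolding sum_distrib_left[symmetric] wsq_def ..
  also have "\<dots> = 296 powr ((p - 2) / 2) * ?N powr (p / 2)"
  proof (cases "?N = 0")
    case False
    then have "?N powr (1 + (p - 2) / 2) = ?N * ?N powr ((p - 2) / 2)" using N0 by (simp only: powr_mult_base)
    moreover have "1 + (p - 2) / 2 = p / 2" by (simp add: field_simps)
    ultimately have "?N powr ((p - 2) / 2) * ?N = ?N powr (p / 2)" by (simp only: mult.commute)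
    then show ?thesis by (simp only: mult.assoc)
  qed simp
  finally have "pw p (mv x) powr (2 / p) \<le> (296 powr ((p - 2) / 2) * ?N powr (p / 2)) powr (2 / p)"
    using p pw_nonneg by (intro powr_mono2) auto
  also have "\<dots> = 296 powr ((p - 2) / p) * ?N"
  proof -
    have e1: "(p - 2) / 2 * (2 / p) = (p - 2) / p" by (simp only: times_divide_times_eq)
    have e2: "p / 2 * (2 / p) = 1" using p by (simp only: times_divide_times_eq) simp
    have e3: "?N powr 1 = ?N" using N0 by (rule powr_one)
    show ?thesis by (simp only: powr_mult powr_powr e1 e2 e3)
  qed
  finally show ?thesis .
qed

end

end

section \<open>A program logic for the machine model\<close>

definition halting :: "config set \<Rightarrow> bool" where
  "halting L \<longleftrightarrow> (\<forall>c\<in>L. fst c = [])"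

text \<open>For \<open>halting\<close> sets the probabilities increase with the number of steps, so
  the supremum is a limit and a first step can be split off. Time and output bounds will be part of
  \<open>L\<close>.\<close>

definition hit :: "real mat \<Rightarrow> nat \<Rightarrow> config set \<Rightarrow> config \<Rightarrow> real" where
  "hit A \<tau> L c = (SUP m. measure_pmf.prob (run A \<tau> m c) L)"

lemma prob_run_det:
  assumes "step A \<tau> c = return_pmf c'"
  shows "measure_pmf.prob (run A \<tau> (Suc m) c) L = measure_pmf.prob (run A \<tau> m c') L"
  by (simp add: assms bind_return_pmf)

lemma measure_bind_bernoulli_half:
  "measure_pmf.prob (bind_pmf (map_pmf f (bernoulli_pmf (1 / 2))) g) L
    = (measure_pmf.prob (g (f True)) L + measure_pmf.prob (g (f False)) L) / 2"
proof -
  have "emeasure (measure_pmf (bind_pmf (map_pmf f (bernoulli_pmf (1 / 2))) g)) L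
    = ennreal (1 / 2) * emeasure (measure_pmf (g (f True))) L + ennreal (1 / 2) * emeasure (measure_pmf (g (f False))) L"
    by (simp add: mult.commute)
  also have "\<dots> = ennreal (1 / 2 * measure_pmf.prob (g (f True)) L + 1 / 2 * measure_pmf.prob (g (f False)) L)"
  proof -
    have m: "ennreal (1 / 2 * x) = ennreal (1 / 2) * ennreal x" if "0 \<le> x" for x
      using that by (intro ennreal_mult) auto
    have "ennreal (1 / 2 * measure_pmf.prob (g (f True)) L + 1 / 2 * measure_pmf.prob (g (f False)) L)
      = ennreal (1 / 2 * measure_pmf.prob (g (f True)) L) + ennreal (1 / 2 * measure_pmf.prob (g (f False)) L)"
      by (rule ennreal_plus) auto
    then show ?thesis unfolding measure_pmf.emeasure_eq_measure m[OF measure_nonneg] by simp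
  qed
  finally show ?thesis
    unfolding measure_pmf.emeasure_eq_measure by (subst (asm) ennreal_inj) (auto simp: add_nonneg_nonneg)
qed

lemma prob_run_flip:
  "measure_pmf.prob (run A \<tau> (Suc m) (Flip a i # cs, s, t)) L
    = (measure_pmf.prob (run A \<tau> m (cs, write_nat a (nval i s) 1 s, t + 1)) L
       + measure_pmf.prob (run A \<tau> m (cs, write_nat a (nval i s) 0 s, t + 1)) L) / 2"
  by (simp add: measure_bind_bernoulli_half)

lemma step_cases:
  obtains (det) c' where "step A \<tau> c = return_pmf c'"
  | (flip) a i cs s t where "c = (Flip a i # cs, s, t)"
proof -
  obtain cs s t where c: "c = (cs, s, t)" by (cases c)
  show thesis
  proof (cases cs)
    case Nil
    then show ?thesis using det c by auto
  next
    case (Cons x xs)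
    then show ?thesis using c by (cases x) (use det flip in auto)
  qed
qed

lemma prob_run_mono:
  assumes "halting L"
  shows "measure_pmf.prob (run A \<tau> m c) L \<le> measure_pmf.prob (run A \<tau> (Suc m) c) L"
proof (induction m arbitrary: c)
  case 0
  show ?case
  proof (cases "c \<in> L")
    case True
    then obtain s t where "c = ([], s, t)" using assms unfolding halting_def by (cases c) auto
    then show ?thesis by (simp add: bind_return_pmf)
  next
    case False
    then show ?thesis by simp
  qed
next
  case (Suc m)
  show ?case
  proof (cases A \<tau> c rule: step_cases)
    case (det c')
    then show ?thesis using Suc.IH[of c'] by (simp only: prob_run_det)
  next
    case (flip a i cs s t)
    show ?thesis unfolding flip prob_run_flip
      by (intro divide_right_mono add_mono Suc.IH) auto
  qed
qed

lemma bdd_prob_run: "bdd_above (range (\<lambda>m. measure_pmf.prob (run A \<tau> m c) L))"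
  by (intro bdd_aboveI[of _ 1]) auto

lemma hit_upper: "measure_pmf.prob (run A \<tau> m c) L \<le> hit A \<tau> L c"
  unfolding hit_def by (intro cSUP_upper bdd_prob_run) auto

lemma hit_nonneg: "0 \<le> hit A \<tau> L c"
  using hit_upper[of A \<tau> 0 c L] by (meson measure_nonneg order_trans)

lemma hit_limit:
  assumes "halting L"
  shows "(\<lambda>m. measure_pmf.prob (run A \<tau> m c) L) \<longlonglongrightarrow> hit A \<tau> L c"
  unfolding hit_def
  by (intro LIMSEQ_incseq_SUP bdd_prob_run incseq_SucI prob_run_mono assms)

lemma hit_det:
  assumes "halting L" "step A \<tau> c = return_pmf c'"
  shows "hit A \<tau> L c = hit A \<tau> L c'"
proof -
  have "(\<lambda>m. measure_pmf.prob (run A \<tau> (Suc m) c) L) \<longlonglongrightarrow> hit A \<tau> L c"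
    by (rule LIMSEQ_Suc[OF hit_limit[OF assms(1)]])
  then have "(\<lambda>m. measure_pmf.prob (run A \<tau> m c') L) \<longlonglongrightarrow> hit A \<tau> L c"
    unfolding prob_run_det[OF assms(2)] .
  then show ?thesis using hit_limit[OF assms(1)] LIMSEQ_unique by blast
qed

lemma hit_flip:
  assumes "halting L"
  shows "hit A \<tau> L (Flip a i # cs, s, t)
    = (hit A \<tau> L (cs, write_nat a (nval i s) 1 s, t + 1) + hit A \<tau> L (cs, write_nat a (nval i s) 0 s, t + 1)) / 2"
proof -
  have "(\<lambda>m. measure_pmf.prob (run A \<tau> (Suc m) (Flip a i # cs, s, t)) L) \<longlonglongrightarrow> hit A \<tau> L (Flip a i # cs, s, t)"
    by (rule LIMSEQ_Suc[OF hit_limit[OF assms]])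
  moreover have "(\<lambda>m. measure_pmf.prob (run A \<tau> (Suc m) (Flip a i # cs, s, t)) L) \<longlonglongrightarrow>
    (hit A \<tau> L (cs, write_nat a (nval i s) 1 s, t + 1) + hit A \<tau> L (cs, write_nat a (nval i s) 0 s, t + 1)) / 2"
    unfolding prob_run_flip by (intro tendsto_intros hit_limit assms) auto
  ultimately show ?thesis using LIMSEQ_unique by blast
qed

lemma hit_halted: "([], s, t) \<in> L \<Longrightarrow> 1 \<le> hit A \<tau> L ([], s, t)"
  using hit_upper[of A \<tau> 0 "([], s, t)" L] by simp

text \<open>Continuation style: \<open>c\<close> in front of any commands \<open>cs\<close> is, for
  halting sets, indistinguishable from starting \<open>cs\<close> in \<open>s'\<close> after
  \<open>k\<close> more time units. Numbers of small steps never appear, and composition is a chain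
  of equations.\<close>

definition exec :: "real mat \<Rightarrow> nat \<Rightarrow> com \<Rightarrow> store \<Rightarrow> store \<Rightarrow> nat \<Rightarrow> bool" where
  "exec A \<tau> c s s' k \<longleftrightarrow>
     (\<forall>L cs t. halting L \<longrightarrow> hit A \<tau> L (c # cs, s, t) = hit A \<tau> L (cs, s', t + k))"

text \<open>Total correctness with a time bound, for code without random choices.\<close>

definition wpc :: "real mat \<Rightarrow> nat \<Rightarrow> com \<Rightarrow> nat \<Rightarrow> store \<Rightarrow> (store \<Rightarrow> bool) \<Rightarrow> bool" where
  "wpc A \<tau> c T s Q \<longleftrightarrow> (\<exists>s' k. exec A \<tau> c s s' k \<and> k \<le> T \<and> Q s')"

lemma wpc_mono: "wpc A \<tau> c T s Q \<Longrightarrow> T \<le> T' \<Longrightarrow> (\<And>s'. Q s' \<Longrightarrow> Q' s') \<Longrightarrow> wpc A \<tau> c T' s Q'"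
  unfolding wpc_def by (meson order_trans)

lemma wpc_NAssign: "Q (write_nat a (nval i s) (nval e s) s) \<Longrightarrow> wpc A \<tau> (NAssign a i e) 1 s Q"
  unfolding wpc_def exec_def by (intro exI[of _ "write_nat a (nval i s) (nval e s) s"] exI[of _ 1]) (simp add: hit_det)

lemma wpc_RAssign: "Q (write_real a (nval i s) (rval e s) s) \<Longrightarrow> wpc A \<tau> (RAssign a i e) 1 s Q"
  unfolding wpc_def exec_def by (intro exI[of _ "write_real a (nval i s) (rval e s) s"] exI[of _ 1]) (simp add: hit_det)

lemma wpc_SKIP: "Q s \<Longrightarrow> wpc A \<tau> SKIP 1 s Q"
  unfolding wpc_def exec_def by (intro exI[of _ s] exI[of _ 1]) (simp add: hit_det)

lemma wpc_Solve: "Q (solve_effect A w v x s) \<Longrightarrow> wpc A \<tau> (Solve w v x) (solve_time A \<tau>) s Q"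
  unfolding wpc_def exec_def
  by (intro exI[of _ "solve_effect A w v x s"] exI[of _ "solve_time A \<tau>"]) (simp add: hit_det)

lemma wpc_Seq:
  assumes "wpc A \<tau> c1 T1 s (\<lambda>s1. wpc A \<tau> c2 T2 s1 Q)"
  shows "wpc A \<tau> (Seq c1 c2) (T1 + T2 + 1) s Q"
proof -
  obtain s1 k1 s2 k2 where *: "exec A \<tau> c1 s s1 k1" "k1 \<le> T1" "exec A \<tau> c2 s1 s2 k2" "k2 \<le> T2" "Q s2"
    using assms unfolding wpc_def by blast
  have "exec A \<tau> (Seq c1 c2) s s2 (k1 + k2 + 1)"
    unfolding exec_def
  proof (intro allI impI)
    fix L cs t assume L: "halting L"
    have "hit A \<tau> L (Seq c1 c2 # cs, s, t) = hit A \<tau> L (c1 # c2 # cs, s, t + 1)"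
      by (rule hit_det[OF L]) simp
    also have "\<dots> = hit A \<tau> L (cs, s2, t + 1 + k1 + k2)" using * L unfolding exec_def by simp
    finally show "hit A \<tau> L (Seq c1 c2 # cs, s, t) = hit A \<tau> L (cs, s2, t + (k1 + k2 + 1))"
      by (simp add: ac_simps)
  qed
  then show ?thesis unfolding wpc_def using * by (intro exI[of _ s2] exI[of _ "k1 + k2 + 1"]) simp
qed

lemma wpc_Cond:
  assumes "bval b s \<Longrightarrow> wpc A \<tau> c1 T s Q" "\<not> bval b s \<Longrightarrow> wpc A \<tau> c2 T s Q"
  shows "wpc A \<tau> (Cond b c1 c2) (T + 1) s Q"
proof -
  define c where "c = (if bval b s then c1 else c2)"
  have "wpc A \<tau> c T s Q" unfolding c_def using assms by simp
  then obtain s' k where *: "exec A \<tau> c s s' k" "k \<le> T" "Q s'" unfolding wpc_def by blast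
  have "exec A \<tau> (Cond b c1 c2) s s' (k + 1)"
    unfolding exec_def
  proof (intro allI impI)
    fix L cs t assume L: "halting L"
    have "hit A \<tau> L (Cond b c1 c2 # cs, s, t) = hit A \<tau> L (c # cs, s, t + 1)"
      by (rule hit_det[OF L]) (simp add: c_def)
    then show "hit A \<tau> L (Cond b c1 c2 # cs, s, t) = hit A \<tau> L (cs, s', t + (k + 1))"
      using * L unfolding exec_def by (simp add: ac_simps)
  qed
  then show ?thesis unfolding wpc_def using * by (intro exI[of _ s'] exI[of _ "k + 1"]) simp
qed

lemma exec_While_False: "\<not> bval b s \<Longrightarrow> exec A \<tau> (While b c) s s 1"
  unfolding exec_def by (simp add: hit_det)

lemma exec_While_True:
  assumes "bval b s" "exec A \<tau> c s s1 k1" "exec A \<tau> (While b c) s1 s2 k2"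
  shows "exec A \<tau> (While b c) s s2 (k1 + k2 + 1)"
  unfolding exec_def
proof (intro allI impI)
  fix L cs t assume L: "halting L"
  have "hit A \<tau> L (While b c # cs, s, t) = hit A \<tau> L (c # While b c # cs, s, t + 1)"
    by (rule hit_det[OF L]) (simp add: assms)
  also have "\<dots> = hit A \<tau> L (cs, s2, t + 1 + k1 + k2)" using assms L unfolding exec_def by simp
  finally show "hit A \<tau> L (While b c # cs, s, t) = hit A \<tau> L (cs, s2, t + (k1 + k2 + 1))"
    by (simp add: ac_simps)
qed

text \<open>The invariant is indexed by the number of completed rounds, and the bound
  \<open>N\<close> on this index serves for termination and time alike.\<close>

lemma wpc_While:
  assumes "I 0 s"
    and body: "\<And>k s. I k s \<Longrightarrow> bval b s \<Longrightarrow> k < N \<and> wpc A \<tau> c T s (I (Suc k))"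
    and exit: "\<And>k s. I k s \<Longrightarrow> \<not> bval b s \<Longrightarrow> Q s"
  shows "wpc A \<tau> (While b c) (N * (T + 1) + 1) s Q"
proof -
  have "wpc A \<tau> (While b c) ((N - k) * (T + 1) + 1) s Q" if "I k s" for k s
    using that
  proof (induction "N - k" arbitrary: k s)
    case 0
    then have "\<not> bval b s" using body by fastforce
    then show ?case
      unfolding wpc_def using exec_While_False exit[OF 0(2)] by (intro exI[of _ s] exI[of _ 1]) auto
  next
    case (Suc m)
    show ?case
    proof (cases "bval b s")
      case True
      then obtain s1 k1 where 1: "exec A \<tau> c s s1 k1" "k1 \<le> T" "I (Suc k) s1"
        using body[OF Suc.prems] unfolding wpc_def by blast
      have "m = N - Suc k" using Suc.hyps by simp
      from Suc.hyps(1)[OF this 1(3)] obtain s2 k2 where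
        2: "exec A \<tau> (While b c) s1 s2 k2" "k2 \<le> m * (T + 1) + 1" "Q s2"
        unfolding wpc_def using \<open>m = N - Suc k\<close> by blast
      have "k1 + k2 + 1 \<le> Suc m * (T + 1) + 1" using 1 2 by simp
      then show ?thesis unfolding wpc_def
        using exec_While_True[OF True 1(1) 2(1)] 2(3) Suc.hyps(2)
        by (intro exI[of _ s2] exI[of _ "k1 + k2 + 1"]) simp
    next
      case False
      then show ?thesis
        unfolding wpc_def using exec_While_False exit[OF Suc.prems] by (intro exI[of _ s] exI[of _ 1]) auto
    qed
  qed
  from this[OF assms(1)] show ?thesis by simp
qed

text \<open>\<open>\<phi>\<close> and \<open>\<psi>\<close> bound the probability of failure before and after running \<open>c\<close>; assertions are
  expressed by the value \<open>1\<close>.\<close>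

definition safe :: "real mat \<Rightarrow> nat \<Rightarrow> com \<Rightarrow> nat \<Rightarrow> (store \<Rightarrow> real) \<Rightarrow> (store \<Rightarrow> real) \<Rightarrow> bool" where
  "safe A \<tau> c T \<phi> \<psi> \<longleftrightarrow>
     (\<forall>s cs t L. halting L \<longrightarrow> (\<forall>s' t'. t' \<le> t + T \<longrightarrow> 1 - \<psi> s' \<le> hit A \<tau> L (cs, s', t')) \<longrightarrow>
        1 - \<phi> s \<le> hit A \<tau> L (c # cs, s, t))"

lemma safe_wpc:
  assumes "\<And>s. \<phi> s < 1 \<Longrightarrow> wpc A \<tau> c T s (\<lambda>s'. \<psi> s' \<le> \<phi> s)"
  shows "safe A \<tau> c T \<phi> \<psi>"
  unfolding safe_def
proof (intro allI impI)
  fix s cs t L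
  assume L: "halting L" and post: "\<forall>s' t'. t' \<le> t + T \<longrightarrow> 1 - \<psi> s' \<le> hit A \<tau> L (cs, s', t')"
  show "1 - \<phi> s \<le> hit A \<tau> L (c # cs, s, t)"
  proof (cases "\<phi> s < 1")
    case True
    then obtain s' k where *: "exec A \<tau> c s s' k" "k \<le> T" "\<psi> s' \<le> \<phi> s"
      using assms unfolding wpc_def by blast
    then have "1 - \<psi> s' \<le> hit A \<tau> L (cs, s', t + k)" using post by simp
    then show ?thesis using * L unfolding exec_def by simp
  next
    case False
    then show ?thesis using hit_nonneg[of A \<tau> L "(c # cs, s, t)"] by linarith
  qed
qed

lemma safe_mono:
  assumes "safe A \<tau> c T \<phi> \<psi>" "T \<le> T'" "\<And>s. \<phi> s < 1 \<or> \<phi>' s < 1 \<Longrightarrow> \<phi> s \<le> \<phi>' s" "\<And>s. \<psi>' s \<le> \<psi> s"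
  shows "safe A \<tau> c T' \<phi>' \<psi>'"
  unfolding safe_def
proof (intro allI impI)
  fix s cs t L
  assume L: "halting L" and post: "\<forall>s' t'. t' \<le> t + T' \<longrightarrow> 1 - \<psi>' s' \<le> hit A \<tau> L (cs, s', t')"
  have "1 - \<psi> s' \<le> hit A \<tau> L (cs, s', t')" if "t' \<le> t + T" for s' t'
  proof -
    have "t' \<le> t + T'" using that assms(2) by simp
    then have "1 - \<psi>' s' \<le> hit A \<tau> L (cs, s', t')" using post by blast
    then show ?thesis using assms(4)[of s'] by linarith
  qed
  then have "1 - \<phi> s \<le> hit A \<tau> L (c # cs, s, t)" using assms(1) L unfolding safe_def by blast
  then show "1 - \<phi>' s \<le> hit A \<tau> L (c # cs, s, t)"
    using assms(3)[of s] hit_nonneg[of A \<tau> L "(c # cs, s, t)"] by linarith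
qed

lemma safe_Seq:
  assumes "safe A \<tau> c1 T1 \<phi> \<omega>" "safe A \<tau> c2 T2 \<omega> \<psi>"
  shows "safe A \<tau> (Seq c1 c2) (T1 + T2 + 1) \<phi> \<psi>"
  unfolding safe_def
proof (intro allI impI)
  fix s cs t L
  assume L: "halting L" and post: "\<forall>s' t'. t' \<le> t + (T1 + T2 + 1) \<longrightarrow> 1 - \<psi> s' \<le> hit A \<tau> L (cs, s', t')"
  have "1 - \<omega> s' \<le> hit A \<tau> L (c2 # cs, s', t')" if "t' \<le> t + 1 + T1" for s' t'
  proof -
    have "\<forall>s'' t''. t'' \<le> t' + T2 \<longrightarrow> 1 - \<psi> s'' \<le> hit A \<tau> L (cs, s'', t'')" using post that by simp
    then show ?thesis using assms(2) L unfolding safe_def by blast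
  qed
  then have "1 - \<phi> s \<le> hit A \<tau> L (c1 # c2 # cs, s, t + 1)"
    using assms(1) L unfolding safe_def by blast
  moreover have "hit A \<tau> L (Seq c1 c2 # cs, s, t) = hit A \<tau> L (c1 # c2 # cs, s, t + 1)"
    by (rule hit_det[OF L]) simp
  ultimately show "1 - \<phi> s \<le> hit A \<tau> L (Seq c1 c2 # cs, s, t)" by simp
qed

lemma safe_Flip:
  "safe A \<tau> (Flip a i) 1
     (\<lambda>s. (\<psi> (write_nat a (nval i s) 1 s) + \<psi> (write_nat a (nval i s) 0 s)) / 2) \<psi>"
  unfolding safe_def
proof (intro allI impI)
  fix s cs t L
  assume L: "halting L" and post: "\<forall>s' t'. t' \<le> t + 1 \<longrightarrow> 1 - \<psi> s' \<le> hit A \<tau> L (cs, s', t')"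
  have "1 - \<psi> s' \<le> hit A \<tau> L (cs, s', t + 1)" for s' using post by simp
  from this[of "write_nat a (nval i s) 1 s"] this[of "write_nat a (nval i s) 0 s"]
  show "1 - (\<psi> (write_nat a (nval i s) 1 s) + \<psi> (write_nat a (nval i s) 0 s)) / 2
      \<le> hit A \<tau> L (Flip a i # cs, s, t)"
    unfolding hit_flip[OF L] by (simp add: field_simps)
qed

text \<open>\<open>I k\<close> bounds failure after \<open>k\<close> completed rounds. By
  \<open>last\<close>, a run that would enter yet another round after \<open>N\<close> counts as
  failed, which settles termination.\<close>

lemma safe_While:
  assumes body: "\<And>k. k < N \<Longrightarrow> safe A \<tau> c T (\<lambda>s. if bval b s then I k s else 1) (I (Suc k))"
    and exit: "\<And>k s. k \<le> N \<Longrightarrow> \<not> bval b s \<Longrightarrow> \<psi> s \<le> I k s"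
    and last: "\<And>s. bval b s \<Longrightarrow> 1 \<le> I N s"
  shows "safe A \<tau> (While b c) (N * (T + 1) + 1) (I 0) \<psi>"
proof -
  have "safe A \<tau> (While b c) (j * (T + 1) + 1) (I (N - j)) \<psi>" if "j \<le> N" for j
    using that
  proof (induction j)
    case 0
    show ?case unfolding safe_def
    proof (intro allI impI)
      fix s cs t L
      assume L: "halting L"
        and post: "\<forall>s' t'. t' \<le> t + (0 * (T + 1) + 1) \<longrightarrow> 1 - \<psi> s' \<le> hit A \<tau> L (cs, s', t')"
      show "1 - I (N - 0) s \<le> hit A \<tau> L (While b c # cs, s, t)"
      proof (cases "bval b s")
        case True
        then show ?thesis using last[of s] hit_nonneg[of A \<tau> L "(While b c # cs, s, t)"] by simp
      next
        case False
        then have "hit A \<tau> L (While b c # cs, s, t) = hit A \<tau> L (cs, s, t + 1)"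
          by (intro hit_det[OF L]) simp
        moreover have "1 - \<psi> s \<le> hit A \<tau> L (cs, s, t + 1)" using post by simp
        ultimately show ?thesis using exit[of N s] False by simp
      qed
    qed
  next
    case (Suc j)
    let ?k = "N - Suc j"
    have k: "?k < N" "Suc ?k = N - j" using Suc.prems by auto
    have IH: "safe A \<tau> (While b c) (j * (T + 1) + 1) (I (Suc ?k)) \<psi>" using Suc k by simp
    show ?case unfolding safe_def
    proof (intro allI impI)
      fix s cs t L
      assume L: "halting L"
        and post: "\<forall>s' t'. t' \<le> t + (Suc j * (T + 1) + 1) \<longrightarrow> 1 - \<psi> s' \<le> hit A \<tau> L (cs, s', t')"
      show "1 - I ?k s \<le> hit A \<tau> L (While b c # cs, s, t)"
      proof (cases "bval b s")
        case True
        then have eq: "hit A \<tau> L (While b c # cs, s, t) = hit A \<tau> L (c # While b c # cs, s, t + 1)"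
          by (intro hit_det[OF L]) simp
        have "1 - I (Suc ?k) s' \<le> hit A \<tau> L (While b c # cs, s', t')" if "t' \<le> t + 1 + T" for s' t'
        proof -
          have "\<forall>s'' t''. t'' \<le> t' + (j * (T + 1) + 1) \<longrightarrow> 1 - \<psi> s'' \<le> hit A \<tau> L (cs, s'', t'')"
            using post that by simp
          then show ?thesis using IH L unfolding safe_def by blast
        qed
        then have "1 - (if bval b s then I ?k s else 1) \<le> hit A \<tau> L (c # While b c # cs, s, t + 1)"
          using body[OF k(1)] L unfolding safe_def by blast
        then show ?thesis using eq True by simp
      next
        case False
        then have "hit A \<tau> L (While b c # cs, s, t) = hit A \<tau> L (cs, s, t + 1)"
          by (intro hit_det[OF L]) simp
        moreover have "1 - \<psi> s \<le> hit A \<tau> L (cs, s, t + 1)" using post by simp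
        ultimately show ?thesis using exit[of ?k s] False k by simp
      qed
    qed
  qed
  from this[of N] show ?thesis by simp
qed

section \<open>Loops over vectors, sparse products and coin flips\<close>

abbreviation ncell :: "nat \<Rightarrow> nexp" where "ncell a \<equiv> NRead a (NConst 0)"
abbreviation rcell :: "nat \<Rightarrow> rexp" where "rcell a \<equiv> RRead a (NConst 0)"
abbreviation rnum :: "nat \<Rightarrow> rexp" where "rnum k \<equiv> ROfNat (NConst k)"

text \<open>The loop counter of \<open>forl\<close> is cell \<open>0\<close> of the array \<open>10\<close> of naturals; \<open>q\<close> selects the bound
  \<open>n\<close>, \<open>d\<close> or \<open>nnz A\<close> from the array \<open>0\<close>.\<close>

definition forl :: "nat \<Rightarrow> com \<Rightarrow> com" where
  "forl q body = Seq (NAssign 10 (NConst 0) (NConst 0))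
     (While (NLess (ncell 10) (NRead 0 (NConst q)))
       (Seq body (NAssign 10 (NConst 0) (NAdd (ncell 10) (NConst 1)))))"

definition vmap :: "nat \<Rightarrow> nat \<Rightarrow> rexp \<Rightarrow> com" where
  "vmap dst q e = forl q (RAssign dst (ncell 10) e)"

definition vsum :: "nat \<Rightarrow> nat \<Rightarrow> rexp \<Rightarrow> com" where
  "vsum dst q e = Seq (RAssign dst (NConst 0) (rnum 0))
     (forl q (RAssign dst (NConst 0) (RAdd (rcell dst) e)))"

text \<open>Sparse matrix-vector product: \<open>ri\<close> and \<open>ci\<close> hold row and
  column indices of the nonzero entries, and exchanging them multiplies by the transpose. The time
  is linear in \<open>nnz A\<close> and the length of the result.\<close>

definition scatter :: "nat \<Rightarrow> nat \<Rightarrow> nat \<Rightarrow> nat \<Rightarrow> nat \<Rightarrow> com" where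
  "scatter dst q ri ci src = Seq (vmap dst q (rnum 0))
     (forl 2 (RAssign dst (NRead ri (ncell 10))
       (RAdd (RRead dst (NRead ri (ncell 10))) (RMul (RRead 2 (ncell 10)) (RRead src (NRead ci (ncell 10)))))))"

definition cnts :: "store \<Rightarrow> nat \<Rightarrow> nat \<Rightarrow> nat \<Rightarrow> nat" where
  "cnts s i = (nats s)(10 := (nats s 10)(0 := i))"

lemma cnts_simps [simp]:
  "a \<noteq> 10 \<Longrightarrow> cnts s i a = nats s a" "cnts s i 10 0 = i"
  by (auto simp: cnts_def)

lemma nats_write [simp]:
  "nats (write_nat a i k s) = (nats s)(a := (nats s a)(i := k))" "nats (write_real a i x s) = nats s"
  "reals (write_nat a i k s) = reals s" "reals (write_real a i x s) = (reals s)(a := (reals s a)(i := x))"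
  by (auto simp: write_nat_def write_real_def)

text \<open>\<open>R i\<close> is the intended real memory after \<open>i\<close> rounds; this
  closed form takes the place of a loop invariant.\<close>

lemma wpc_forl:
  assumes m: "nats s 0 q = m" and R0: "R 0 = reals s"
    and step: "\<And>i s'. i < m \<Longrightarrow> nats s' = cnts s i \<Longrightarrow> reals s' = R i \<Longrightarrow>
      (R i)(a := (R i a)(nval ie s' := rval e s')) = R (Suc i)"
    and Q: "\<And>s'. nats s' = cnts s m \<Longrightarrow> reals s' = R m \<Longrightarrow> Q s'"
  shows "wpc A \<tau> (forl q (RAssign a ie e)) (4 * m + 3) s Q"
proof -
  let ?b = "NLess (ncell 10) (NRead 0 (NConst q))"
  let ?body = "Seq (RAssign a ie e) (NAssign 10 (NConst 0) (NAdd (ncell 10) (NConst 1)))"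
  let ?I = "\<lambda>k s'. k \<le> m \<and> nats s' = cnts s k \<and> reals s' = R k"
  have "wpc A \<tau> (While ?b ?body) (m * (1 + 1 + 1 + 1) + 1) (write_nat 10 0 0 s) Q"
  proof (rule wpc_While[where I = ?I])
    show "?I 0 (write_nat 10 0 0 s)" by (simp add: cnts_def R0)
    show "k < m \<and> wpc A \<tau> ?body (1 + 1 + 1) s' (?I (Suc k))" if "?I k s'" "bval ?b s'" for k s'
    proof
      show k: "k < m" using that m by simp
      show "wpc A \<tau> ?body (1 + 1 + 1) s' (?I (Suc k))"
        using that k step[of k s'] by (intro wpc_Seq wpc_RAssign wpc_NAssign) (auto simp: cnts_def)
    qed
    show "Q s'" if "?I k s'" "\<not> bval ?b s'" for k s' using that m Q by simp
  qed
  then have "wpc A \<tau> (forl q (RAssign a ie e)) (1 + (m * (1 + 1 + 1 + 1) + 1) + 1) s Q"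
    unfolding forl_def by (intro wpc_Seq wpc_NAssign) simp
  then show ?thesis by (rule wpc_mono) auto
qed

text \<open>The premise on \<open>e\<close> refers to the partially updated memory, in which entry
  \<open>i\<close> of \<open>dst\<close> is still old; this covers updates in place.\<close>

lemma wpc_vmap:
  assumes m: "nats s 0 q = m"
    and step: "\<And>i s'. i < m \<Longrightarrow> nats s' = cnts s i \<Longrightarrow>
      reals s' = (reals s)(dst := (\<lambda>j. if j < i then g j else reals s dst j)) \<Longrightarrow> rval e s' = g i"
    and Q: "\<And>s'. nats s' = cnts s m \<Longrightarrow>
      reals s' = (reals s)(dst := (\<lambda>j. if j < m then g j else reals s dst j)) \<Longrightarrow> Q s'"
  shows "wpc A \<tau> (vmap dst q e) (4 * m + 3) s Q"
  unfolding vmap_def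
proof (rule wpc_forl[where R = "\<lambda>i. (reals s)(dst := (\<lambda>j. if j < i then g j else reals s dst j))", OF m])
  fix i and s' :: store assume "i < m" and s': "nats s' = cnts s i"
    "reals s' = (reals s)(dst := (\<lambda>j. if j < i then g j else reals s dst j))"
  from step[OF this] s'(1)
  show "((reals s)(dst := (\<lambda>j. if j < i then g j else reals s dst j)))
      (dst := (((reals s)(dst := (\<lambda>j. if j < i then g j else reals s dst j))) dst)(nval (ncell 10) s' := rval e s'))
      = (reals s)(dst := (\<lambda>j. if j < Suc i then g j else reals s dst j))"
    by (auto simp: fun_eq_iff less_Suc_eq)
qed (use Q in \<open>auto simp: fun_eq_iff\<close>)

lemma wpc_vsum:
  assumes m: "nats s 0 q = m"
    and step: "\<And>i s' x. i < m \<Longrightarrow> nats s' = cnts s i \<Longrightarrow>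
      reals s' = (reals s)(dst := (reals s dst)(0 := x)) \<Longrightarrow> rval e s' = g i"
    and Q: "\<And>s'. nats s' = cnts s m \<Longrightarrow>
      reals s' = (reals s)(dst := (reals s dst)(0 := \<Sum>i<m. g i)) \<Longrightarrow> Q s'"
  shows "wpc A \<tau> (vsum dst q e) (4 * m + 5) s Q"
proof -
  let ?s = "write_real dst 0 0 s"
  have "wpc A \<tau> (forl q (RAssign dst (NConst 0) (RAdd (rcell dst) e))) (4 * m + 3) ?s Q"
  proof (rule wpc_forl[where R = "\<lambda>i. (reals s)(dst := (reals s dst)(0 := \<Sum>i<i. g i))"])
    show "nats ?s 0 q = m" using m by simp
    fix i and s' :: store assume "i < m" "nats s' = cnts ?s i" and s': "reals s' = (reals s)(dst := (reals s dst)(0 := \<Sum>i<i. g i))"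
    then have "rval e s' = g i" by (intro step) (auto simp: cnts_def)
    then show "((reals s)(dst := (reals s dst)(0 := \<Sum>i<i. g i)))
       (dst := (((reals s)(dst := (reals s dst)(0 := \<Sum>i<i. g i))) dst)(nval (NConst 0) s' := rval (RAdd (rcell dst) e) s'))
       = (reals s)(dst := (reals s dst)(0 := \<Sum>i<Suc i. g i))"
      using s' by simp
  qed (use Q in \<open>auto simp: cnts_def\<close>)
  then have "wpc A \<tau> (vsum dst q e) (1 + (4 * m + 3) + 1) s Q"
    unfolding vsum_def by (intro wpc_Seq wpc_RAssign) simp
  then show ?thesis by (rule wpc_mono) auto
qed

lemma wpc_scatter:
  assumes m: "nats s 0 q = m" and l: "nats s 0 2 = l" and idx: "\<And>k. k < l \<Longrightarrow> nats s ri k < m"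
    and distinct: "dst \<noteq> src" "dst \<noteq> 2" "ri \<noteq> 10" "ci \<noteq> 10"
    and Q: "\<And>s'. nats s' = cnts s l \<Longrightarrow> reals s' = (reals s)(dst := (\<lambda>j. if j < m then
      \<Sum>k<l. if nats s ri k = j then reals s 2 k * reals s src (nats s ci k) else 0 else reals s dst j)) \<Longrightarrow> Q s'"
  shows "wpc A \<tau> (scatter dst q ri ci src) (4 * m + 4 * l + 7) s Q"
proof -
  let ?t = "\<lambda>j k. if nats s ri k = j then reals s 2 k * reals s src (nats s ci k) else 0"
  let ?R = "\<lambda>i. (reals s)(dst := (\<lambda>j. if j < m then \<Sum>k<i. ?t j k else reals s dst j))"
  have "wpc A \<tau> (scatter dst q ri ci src) ((4 * m + 3) + (4 * l + 3) + 1) s Q"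
    unfolding scatter_def
  proof (intro wpc_Seq wpc_vmap[where g = "\<lambda>_. 0"])
    fix s1 :: store assume s1: "nats s1 = cnts s m" "reals s1 = (reals s)(dst := (\<lambda>j. if j < m then 0 else reals s dst j))"
    show "wpc A \<tau> (forl 2 (RAssign dst (NRead ri (ncell 10)) (RAdd (RRead dst (NRead ri (ncell 10)))
        (RMul (RRead 2 (ncell 10)) (RRead src (NRead ci (ncell 10))))))) (4 * l + 3) s1 Q"
    proof (rule wpc_forl[where R = ?R])
      show "nats s1 0 2 = l" using s1 l by simp
      show "?R 0 = reals s1" using s1 by (auto simp: fun_eq_iff)
      fix i and s' :: store assume i: "i < l" and s': "nats s' = cnts s1 i" "reals s' = ?R i"
      have "nats s' ri i = nats s ri i" "nats s' ci i = nats s ci i" "nats s' 10 0 = i"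
        using s' s1 distinct by simp_all
      then show "(?R i)(dst := (?R i dst)(nval (NRead ri (ncell 10)) s' := rval (RAdd (RRead dst (NRead ri (ncell 10)))
          (RMul (RRead 2 (ncell 10)) (RRead src (NRead ci (ncell 10))))) s')) = ?R (Suc i)"
        using s' distinct idx[OF i] by (auto simp: fun_eq_iff)
    next
      fix s' :: store assume "nats s' = cnts s1 l" "reals s' = ?R l"
      then show "Q s'" using s1 by (intro Q) (auto simp: cnts_def)
    qed
  qed (use m in auto)
  then show ?thesis by (rule wpc_mono) auto
qed

text \<open>\<open>I k\<close> in the proof averages over the bits not yet drawn, and drawing bit
  \<open>k\<close> unfolds one step of \<open>bavg\<close>. The counter is \<open>n\<close> inside
  the average because the loop leaves it there.\<close>

lemma safe_flips:
  assumes \<psi>: "\<And>s. \<psi> s \<le> 1"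
  shows "safe A \<tau> (forl 0 (Flip 3 (ncell 10))) (4 * n + 3)
    (\<lambda>s. if nats s 0 0 = n then bavg [0..<n] (\<lambda>h. \<psi> (s\<lparr>nats := (cnts s n)(3 := h)\<rparr>)) (nats s 3) else 1) \<psi>"
proof -
  let ?b = "NLess (ncell 10) (NRead 0 (NConst 0))"
  let ?inc = "NAssign 10 (NConst 0) (NAdd (ncell 10) (NConst 1))"
  let ?body = "Seq (Flip 3 (ncell 10)) ?inc"
  define I where "I k s = (if nats s 0 0 = n \<and> nats s 10 0 = k
      then bavg [k..<n] (\<lambda>h. \<psi> (s\<lparr>nats := (cnts s n)(3 := h)\<rparr>)) (nats s 3) else 1)" for k and s :: store
  have "safe A \<tau> (While ?b ?body) (n * (1 + 1 + 1 + 1) + 1) (I 0) \<psi>"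
  proof (rule safe_While)
    fix k assume k: "k < n"
    let ?c = "\<lambda>s. I (Suc k) (write_nat 10 0 (nats s 10 0 + 1) s)"
    have "safe A \<tau> ?inc 1 ?c (I (Suc k))"
      by (intro safe_wpc wpc_NAssign) simp
    from safe_Seq[OF safe_Flip[where a = 3 and i = "ncell 10"] this]
    have sf: "safe A \<tau> ?body (1 + 1 + 1)
      (\<lambda>s. (?c (write_nat 3 (nval (ncell 10) s) 1 s) + ?c (write_nat 3 (nval (ncell 10) s) 0 s)) / 2) (I (Suc k))" .
    show "safe A \<tau> ?body (1 + 1 + 1) (\<lambda>s. if bval ?b s then I k s else 1) (I (Suc k))"
    proof (rule safe_mono[OF sf])
      fix s
      have up: "[k..<n] = k # [Suc k..<n]" using k by (rule upt_conv_Cons)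
      have Ile: "I (Suc k) s' \<le> 1" for s'
        unfolding I_def using bavg_mono[of "\<lambda>h. \<psi> (s'\<lparr>nats := (cnts s' n)(3 := h)\<rparr>)" "\<lambda>_. 1"] \<psi>
        by (simp add: bavg_const)
      show "(?c (write_nat 3 (nval (ncell 10) s) 1 s) + ?c (write_nat 3 (nval (ncell 10) s) 0 s)) / 2
          \<le> (if bval ?b s then I k s else 1)"
      proof (cases "bval ?b s \<and> nats s 0 0 = n \<and> nats s 10 0 = k")
        case True
        have eq: "(write_nat 10 0 (Suc k) (write_nat 3 k x s))\<lparr>nats := (cnts (write_nat 10 0 (Suc k) (write_nat 3 k x s)) n)(3 := h)\<rparr>
          = s\<lparr>nats := (cnts s n)(3 := h)\<rparr>" for x h
          by (simp add: write_nat_def cnts_def fun_upd_twist)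
        show ?thesis using True k unfolding I_def up by (simp add: eq)
      next
        case False
        have "(?c (write_nat 3 (nval (ncell 10) s) 1 s) + ?c (write_nat 3 (nval (ncell 10) s) 0 s)) / 2 \<le> (1 + 1) / 2"
          by (intro divide_right_mono add_mono Ile) auto
        also have "\<dots> \<le> (if bval ?b s then I k s else 1)" using False unfolding I_def by auto
        finally show ?thesis .
      qed
    qed auto
  next
    fix k s assume "k \<le> n" "\<not> bval ?b s"
    then show "\<psi> s \<le> I k s"
    proof (cases "nats s 0 0 = n \<and> nats s 10 0 = k")
      case True
      then have "k = n" using \<open>k \<le> n\<close> \<open>\<not> bval ?b s\<close> by simp
      moreover have "s\<lparr>nats := (cnts s n)(3 := nats s 3)\<rparr> = s"
        using True \<open>k = n\<close> by (simp add: cnts_def fun_upd_idem fun_upd_twist)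
      ultimately show ?thesis using True unfolding I_def by simp
    next
      case False
      then show ?thesis using \<psi> unfolding I_def by auto
    qed
  next
    fix s assume "bval ?b s"
    then show "1 \<le> I n s" unfolding I_def by simp
  qed
  moreover have "safe A \<tau> (NAssign 10 (NConst 0) (NConst 0)) 1 (\<lambda>s. I 0 (write_nat 10 0 0 s)) (I 0)"
    by (intro safe_wpc wpc_NAssign) simp
  ultimately have "safe A \<tau> (forl 0 (Flip 3 (ncell 10))) (1 + (n * (1 + 1 + 1 + 1) + 1) + 1)
      (\<lambda>s. I 0 (write_nat 10 0 0 s)) \<psi>"
    unfolding forl_def by (intro safe_Seq)
  moreover have "I 0 (write_nat 10 0 0 s) = (if nats s 0 0 = n
      then bavg [0..<n] (\<lambda>h. \<psi> (s\<lparr>nats := (cnts s n)(3 := h)\<rparr>)) (nats s 3) else 1)" for s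
  proof -
    have "(write_nat 10 0 0 s)\<lparr>nats := (cnts (write_nat 10 0 0 s) n)(3 := h)\<rparr> = s\<lparr>nats := (cnts s n)(3 := h)\<rparr>" for h
      by (simp add: write_nat_def cnts_def)
    then show ?thesis unfolding I_def by simp
  qed
  ultimately have "safe A \<tau> (forl 0 (Flip 3 (ncell 10))) (1 + (n * (1 + 1 + 1 + 1) + 1) + 1)
    (\<lambda>s. if nats s 0 0 = n then bavg [0..<n] (\<lambda>h. \<psi> (s\<lparr>nats := (cnts s n)(3 := h)\<rparr>)) (nats s 3) else 1) \<psi>"
    by simp
  then show ?thesis by (rule safe_mono) auto
qed

section \<open>The regression instance on the machine\<close>

text \<open>Linear independence concerns the set of columns, so repetitions are excluded first: they
  would leave fewer than \<open>nc\<close> columns, and a maximal independent set smaller than the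
  rank.\<close>

lemma (in vec_space) full_column_rank_inj:
  assumes A: "A \<in> carrier_mat n nc" and rank: "rank A = nc"
    and v: "v \<in> carrier_vec nc" "A *\<^sub>v v = 0\<^sub>v n"
  shows "v = 0\<^sub>v nc"
proof (rule ccontr)
  assume "v \<noteq> 0\<^sub>v nc"
  have dist: "distinct (cols A)"
  proof (rule ccontr)
    assume "\<not> distinct (cols A)"
    then have "card (set (cols A)) \<noteq> length (cols A)" using card_distinct by blast
    then have "card (set (cols A)) < nc" using A card_length[of "cols A"] by simp
    moreover obtain S where S: "maximal S (\<lambda>T. T \<subseteq> set (cols A) \<and> lin_indpt T)"
      using maximal_exists[of "(\<lambda>T. T \<subseteq> set (cols A) \<and> lin_indpt T)" "card (set (cols A))" "{}"]
      by (meson List.finite_set card_mono empty_iff empty_subsetI finite_lin_indpt2 rev_finite_subset)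
    moreover have "card S \<le> card (set (cols A))" using S by (simp add: card_mono maximal_def)
    ultimately show False using rank_card_indpt[OF A S] rank by simp
  qed
  then have "lin_indpt (set (cols A))" using full_rank_lin_indpt A rank by auto
  then show False using lin_depI[OF A v(1) \<open>v \<noteq> 0\<^sub>v nc\<close> v(2) dist] by blast
qed

lemma sum_nth_distinct:
  assumes "distinct xs"
  shows "(\<Sum>k<length xs. f (xs ! k)) = (\<Sum>x\<in>set xs. f x)"
proof -
  have "(\<Sum>x\<in>set xs. f x) = sum_list (map f xs)" using assms by (simp add: sum_list_distinct_conv_sum_set)
  also have "\<dots> = (\<Sum>k<length xs. f (xs ! k))" by (simp add: sum_list_sum_nth atLeast0LessThan)
  finally show ?thesis ..
qed

definition block :: "com list \<Rightarrow> com" where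
  "block cs = foldr Seq cs SKIP"

locale regression =
  fixes A :: "real mat" and b :: "real Matrix.vec" and p \<epsilon> :: real and \<tau> n d :: nat
  assumes A: "A \<in> carrier_mat n d" and d0: "0 < d" and dn: "d \<le> n" and rank: "vec_space.rank n A = d"
    and b: "b \<in> carrier_vec n" and eps: "0 < \<epsilon>"
begin

abbreviation M :: "nat \<Rightarrow> nat \<Rightarrow> real" where "M \<equiv> \<lambda>i j. A $$ (i, j)"

lemma dims [simp]: "dim_row A = n" "dim_col A = d" "dim_vec b = n" using A b by auto

sublocale design n d M .

lemma mult_index: "i < n \<Longrightarrow> (A *\<^sub>v Matrix.vec d x) $ i = mv x i"
  using A unfolding mv_def by (simp add: scalar_prod_def atLeast0LessThan)

lemma weighted_gram_carrier: "weighted_gram A w \<in> carrier_mat d d"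
  unfolding weighted_gram_def using A by auto

lemma weighted_gram_index:
  assumes "j < d"
  shows "(weighted_gram A w *\<^sub>v Matrix.vec d x) $ j = mt (\<lambda>i. w i * mv x i) j"
proof -
  let ?x = "Matrix.vec d x"
  have eq: "weighted_gram A w *\<^sub>v ?x = transpose_mat A *\<^sub>v (mat_diag n w *\<^sub>v (A *\<^sub>v ?x))"
  proof -
    have At: "transpose_mat A \<in> carrier_mat d n" using A by simp
    have D: "mat_diag n w \<in> carrier_mat n n" by (rule mat_diag_dim)
    have x: "?x \<in> carrier_vec d" by simp
    have Ax: "A *\<^sub>v ?x \<in> carrier_vec n" using A by simp
    have "weighted_gram A w *\<^sub>v ?x = (transpose_mat A * mat_diag n w) *\<^sub>v (A *\<^sub>v ?x)"
      unfolding weighted_gram_def dims by (rule assoc_mult_mat_vec[OF mult_carrier_mat[OF At D] A x])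
    then show ?thesis using assoc_mult_mat_vec[OF At D Ax] by simp
  qed
  have "(mat_diag n w *\<^sub>v (A *\<^sub>v ?x)) $ i = w i * mv x i" if i: "i < n" for i
  proof -
    have "(mat_diag n w *\<^sub>v (A *\<^sub>v ?x)) $ i = (\<Sum>k<n. (if i = k then w k else 0) * (A *\<^sub>v ?x) $ k)"
      using i A unfolding mat_diag_def by (simp add: scalar_prod_def atLeast0LessThan)
    also have "\<dots> = (\<Sum>k<n. if k = i then w i * (A *\<^sub>v ?x) $ i else 0)"
      by (intro sum.cong) auto
    also have "\<dots> = w i * (A *\<^sub>v ?x) $ i" using i by simp
    finally show ?thesis using mult_index[OF i] by simp
  qed
  then show ?thesis
    unfolding eq mt_def using assms A
    by (simp add: scalar_prod_def atLeast0LessThan mat_diag_def)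
qed

lemma nsol_iff:
  "nsol w g z \<longleftrightarrow> weighted_gram A w *\<^sub>v Matrix.vec d z = Matrix.vec d g"
proof
  assume sol: "nsol w g z"
  show "weighted_gram A w *\<^sub>v Matrix.vec d z = Matrix.vec d g"
  proof (rule eq_vecI)
    fix i assume "i < dim_vec (Matrix.vec d g)"
    then have i: "i < d" by simp
    show "(weighted_gram A w *\<^sub>v Matrix.vec d z) $ i = Matrix.vec d g $ i"
      unfolding weighted_gram_index[OF i] using sol i unfolding nsol_def by simp
  qed (use weighted_gram_carrier[of w] in simp)
next
  assume eq: "weighted_gram A w *\<^sub>v Matrix.vec d z = Matrix.vec d g"
  show "nsol w g z" unfolding nsol_def
  proof (intro allI impI)
    fix j assume j: "j < d"
    then show "mt (\<lambda>i. w i * mv z i) j = g j"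
      using weighted_gram_index[OF j, of w z] unfolding eq by simp
  qed
qed

lemma mv_inj:
  assumes "\<And>i. i < n \<Longrightarrow> mv x i = 0" "j < d"
  shows "x j = 0"
proof -
  have "A *\<^sub>v Matrix.vec d x = 0\<^sub>v n" using assms(1) mult_index A by (intro eq_vecI) auto
  from vec_space.full_column_rank_inj[OF A rank _ this] have "Matrix.vec d x = 0\<^sub>v d" by simp
  then show ?thesis using assms(2) by (metis index_vec index_zero_vec(1))
qed

text \<open>A kernel vector of the Gram matrix has energy zero, hence image zero, and vanishes by
  full column rank.\<close>

lemma nsol_exists:
  assumes W: "\<And>i. i < n \<Longrightarrow> 0 < W i"
  shows "\<exists>z. nsol W g z"
proof -
  let ?G = "weighted_gram A W"
  have det: "Determinant.det ?G \<noteq> 0"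
  proof
    assume "Determinant.det ?G = 0"
    then obtain v where v: "v \<in> carrier_vec d" "v \<noteq> 0\<^sub>v d" "?G *\<^sub>v v = 0\<^sub>v d"
      using det_0_iff_vec_prod_zero_field[OF weighted_gram_carrier] by blast
    define x where "x j = v $ j" for j
    have vx: "v = Matrix.vec d x" using v(1) unfolding x_def by auto
    have "nsol W (\<lambda>_. 0) x" unfolding nsol_iff vx[symmetric] v(3) by auto
    then have "(\<Sum>i<n. W i * mv x i * mv x i) = 0"
      using nsol_dot[of W "\<lambda>_. 0" x x] unfolding dot_def by simp
    then have "\<forall>i\<in>{..<n}. W i * mv x i * mv x i = 0"
      using W by (subst (asm) sum_nonneg_eq_0_iff) (auto simp: less_imp_le mult.assoc)
    then have prod0: "W i * mv x i * mv x i = 0" if "i < n" for i using that by blast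
    have "mv x i = 0" if "i < n" for i using prod0[OF that] W[OF that] by simp
    then have "x j = 0" if "j < d" for j using mv_inj that by blast
    then have "v = 0\<^sub>v d" unfolding vx by auto
    then show False using v(2) by simp
  qed
  from det_non_zero_imp_unit[OF weighted_gram_carrier this, unfolded Units_def, of "()"]
  obtain B where B: "B \<in> carrier_mat d d" "?G * B = 1\<^sub>m d" by (auto simp: ring_mat_def)
  let ?z = "B *\<^sub>v Matrix.vec d g"
  have "Matrix.vec d (vec_index ?z) = ?z" using B(1) by auto
  moreover have "?G *\<^sub>v ?z = Matrix.vec d g"
  proof -
    have g: "Matrix.vec d g \<in> carrier_vec d" by simp
    show ?thesis
      using assoc_mult_mat_vec[OF weighted_gram_carrier[of W] B(1) g] unfolding B(2)
      using one_mult_mat_vec[OF g] by simp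
  qed
  ultimately show ?thesis unfolding nsol_iff by metis
qed

sublocale full_design n d M
  by unfold_locales (use nsol_exists mv_inj in auto)

definition SS :: nat where "SS = solve_time A \<tau>"
text \<open>A common time unit that pays for any vector operation, sparse product or solver call; a
  second \<open>U\<close> per command covers sequencing, so the time of a \<open>block\<close>
  depends on its length only.\<close>

definition U :: nat where "U = 16 * SS"

lemma SS_ge: "n \<le> SS" "d \<le> SS" "1 \<le> SS" "n + nnz A \<le> SS" "d + nnz A \<le> SS"
  unfolding SS_def solve_time_def using d0 by auto

lemma U_pos: "0 < U" "1 \<le> U" unfolding U_def using SS_ge by auto

definition inp :: "store \<Rightarrow> bool" where
  "inp s \<longleftrightarrow> nats s 0 0 = n \<and> nats s 0 1 = d \<and> nats s 0 2 = nnz A \<and>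
     (\<forall>k<nnz A. nats s 1 k = fst (support_list A ! k) \<and> nats s 2 k = snd (support_list A ! k) \<and>
        reals s 2 k = A $$ (support_list A ! k)) \<and>
     reals s 0 0 = p \<and> reals s 0 1 = \<epsilon> \<and> (\<forall>i<n. reals s 1 i = b $ i)"

lemma inp_cong:
  assumes "inp s" "\<And>a. a < 3 \<Longrightarrow> nats s' a = nats s a" "\<And>a. a < 3 \<Longrightarrow> reals s' a = reals s a"
  shows "inp s'"
  using assms(1) assms(2)[of 0] assms(2)[of 1] assms(2)[of 2] assms(3)[of 0] assms(3)[of 1] assms(3)[of 2]
  unfolding inp_def by simp

lemma inp_input_store: "inp (input_store A b p \<epsilon>)"
  unfolding inp_def input_store_def by simp

lemma set_support: "set (support_list A) = {(i, j). i < n \<and> j < d \<and> A $$ (i, j) \<noteq> 0}"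
  unfolding support_list_def by auto

lemma distinct_support: "distinct (support_list A)"
  unfolding support_list_def by (intro distinct_filter distinct_product) auto

lemma support_nth:
  assumes "k < nnz A"
  shows "fst (support_list A ! k) < n" "snd (support_list A ! k) < d"
proof -
  have "support_list A ! k \<in> set (support_list A)" using assms unfolding nnz_def by simp
  then show "fst (support_list A ! k) < n" "snd (support_list A ! k) < d" unfolding set_support by auto
qed

lemma support_sum:
  assumes "\<And>i j. i < n \<Longrightarrow> j < d \<Longrightarrow> A $$ (i, j) = 0 \<Longrightarrow> f (i, j) = (0::real)"
  shows "(\<Sum>k<nnz A. f (support_list A ! k)) = (\<Sum>i<n. \<Sum>j<d. f (i, j))"
proof -
  have "(\<Sum>k<nnz A. f (support_list A ! k)) = (\<Sum>x\<in>set (support_list A). f x)"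
    unfolding nnz_def by (rule sum_nth_distinct[OF distinct_support])
  also have "\<dots> = (\<Sum>x\<in>{..<n} \<times> {..<d}. f x)"
    using assms unfolding set_support by (intro sum.mono_neutral_left) auto
  also have "\<dots> = (\<Sum>i<n. \<Sum>j<d. f (i, j))" by (simp add: sum.cartesian_product)
  finally show ?thesis .
qed

lemma support_mv:
  assumes "i < n"
  shows "(\<Sum>k<nnz A. if fst (support_list A ! k) = i then A $$ (support_list A ! k) * x (snd (support_list A ! k)) else 0)
    = mv x i"
proof -
  have "(\<Sum>k<nnz A. (\<lambda>e. if fst e = i then A $$ e * x (snd e) else 0) (support_list A ! k))
    = (\<Sum>i'<n. \<Sum>j<d. if i' = i then A $$ (i', j) * x j else 0)"
    by (subst support_sum) (auto intro!: sum.cong)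
  also have "\<dots> = (\<Sum>i'<n. if i' = i then mv x i else 0)"
    unfolding mv_def by (intro sum.cong) auto
  finally show ?thesis using assms by simp
qed

lemma support_mt:
  assumes "j < d"
  shows "(\<Sum>k<nnz A. if snd (support_list A ! k) = j then A $$ (support_list A ! k) * y (fst (support_list A ! k)) else 0)
    = mt y j"
proof -
  have "(\<Sum>k<nnz A. (\<lambda>e. if snd e = j then A $$ e * y (fst e) else 0) (support_list A ! k))
    = (\<Sum>i<n. \<Sum>j'<d. if j' = j then A $$ (i, j') * y i else 0)"
    by (subst support_sum) (auto intro!: sum.cong)
  also have "\<dots> = mt y j"
    unfolding mt_def using assms by (intro sum.cong) auto
  finally show ?thesis by simp
qed

lemma wp_block_Nil: "Q s \<Longrightarrow> wpc A \<tau> (block []) ((2 * length ([]::com list) + 1) * U) s Q"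
  unfolding block_def using U_pos wpc_mono[OF wpc_SKIP, of Q s U Q] by simp

lemma wp_block_Cons:
  assumes "wpc A \<tau> c U s (\<lambda>s1. wpc A \<tau> (block cs) ((2 * length cs + 1) * U) s1 Q)"
  shows "wpc A \<tau> (block (c # cs)) ((2 * length (c # cs) + 1) * U) s Q"
proof -
  have "wpc A \<tau> (block (c # cs)) (U + (2 * length cs + 1) * U + 1) s Q"
    unfolding block_def using wpc_Seq[OF assms] by (simp add: block_def)
  then show ?thesis by (rule wpc_mono) (use U_pos in auto)
qed

lemma wp_block:
  assumes "wpc A \<tau> (block cs) ((2 * length cs + 1) * U) s Q" "2 * length cs + 1 \<le> k"
  shows "wpc A \<tau> (block cs) (k * U) s Q"
  by (rule wpc_mono[OF assms(1)]) (intro mult_le_mono1 assms(2))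

lemma wp_vmap:
  assumes "inp s" "m = (if q = 0 then n else d)" "q \<le> 1"
    and "\<And>i s'. i < m \<Longrightarrow> nats s' = cnts s i \<Longrightarrow>
      reals s' = (reals s)(dst := (\<lambda>j. if j < i then g j else reals s dst j)) \<Longrightarrow> rval e s' = g i"
    and "\<And>s'. nats s' = cnts s m \<Longrightarrow>
      reals s' = (reals s)(dst := (\<lambda>j. if j < m then g j else reals s dst j)) \<Longrightarrow> Q s'"
  shows "wpc A \<tau> (vmap dst q e) U s Q"
proof (rule wpc_mono)
  show "wpc A \<tau> (vmap dst q e) (4 * m + 3) s Q"
  proof (rule wpc_vmap)
    have "q = 0 \<or> q = 1" using assms(3) by auto
    then show "nats s 0 q = m" using assms(1,2) unfolding inp_def by auto
  qed (rule assms(4,5); assumption)+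
  show "4 * m + 3 \<le> U" unfolding U_def using SS_ge assms(2) by (auto split: if_splits)
qed

lemma wp_vsum:
  assumes "inp s" "m = (if q = 0 then n else d)" "q \<le> 1"
    and "\<And>i s' x. i < m \<Longrightarrow> nats s' = cnts s i \<Longrightarrow>
      reals s' = (reals s)(dst := (reals s dst)(0 := x)) \<Longrightarrow> rval e s' = g i"
    and "\<And>s'. nats s' = cnts s m \<Longrightarrow>
      reals s' = (reals s)(dst := (reals s dst)(0 := \<Sum>i<m. g i)) \<Longrightarrow> Q s'"
  shows "wpc A \<tau> (vsum dst q e) U s Q"
proof (rule wpc_mono)
  show "wpc A \<tau> (vsum dst q e) (4 * m + 5) s Q"
  proof (rule wpc_vsum)
    have "q = 0 \<or> q = 1" using assms(3) by auto
    then show "nats s 0 q = m" using assms(1,2) unfolding inp_def by auto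
  qed (rule assms(4,5); assumption)+
  show "4 * m + 5 \<le> U" unfolding U_def using SS_ge assms(2) by (auto split: if_splits)
qed

lemma wp_mulA:
  assumes inp: "inp s" and "dst \<noteq> src" "dst \<noteq> 2"
    and Q: "\<And>s'. nats s' = cnts s (nnz A) \<Longrightarrow>
      reals s' = (reals s)(dst := (\<lambda>i. if i < n then mv (reals s src) i else reals s dst i)) \<Longrightarrow> Q s'"
  shows "wpc A \<tau> (scatter dst 0 1 2 src) U s Q"
proof (rule wpc_mono)
  let ?t = "\<lambda>j k. if nats s 1 k = j then reals s 2 k * reals s src (nats s 2 k) else 0"
  have eq: "(\<Sum>k<nnz A. ?t i k) = mv (reals s src) i" if "i < n" for i
    unfolding support_mv[OF that, symmetric] using inp unfolding inp_def by (intro sum.cong) auto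
  show "wpc A \<tau> (scatter dst 0 1 2 src) (4 * n + 4 * nnz A + 7) s Q"
  proof (rule wpc_scatter)
    fix s' :: store assume "nats s' = cnts s (nnz A)"
      "reals s' = (reals s)(dst := (\<lambda>j. if j < n then \<Sum>k<nnz A. ?t j k else reals s dst j))"
    moreover have "(\<lambda>j. if j < n then \<Sum>k<nnz A. ?t j k else reals s dst j)
      = (\<lambda>j. if j < n then mv (reals s src) j else reals s dst j)" using eq by (auto simp: fun_eq_iff)
    ultimately show "Q s'" by (intro Q) simp_all
  qed (use inp support_nth assms(2,3) in \<open>auto simp: inp_def\<close>)
  show "4 * n + 4 * nnz A + 7 \<le> U" unfolding U_def using SS_ge by simp
qed

lemma wp_mulAT:
  assumes inp: "inp s" and "dst \<noteq> src" "dst \<noteq> 2"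
    and Q: "\<And>s'. nats s' = cnts s (nnz A) \<Longrightarrow>
      reals s' = (reals s)(dst := (\<lambda>j. if j < d then mt (reals s src) j else reals s dst j)) \<Longrightarrow> Q s'"
  shows "wpc A \<tau> (scatter dst 1 2 1 src) U s Q"
proof (rule wpc_mono)
  let ?t = "\<lambda>j k. if nats s 2 k = j then reals s 2 k * reals s src (nats s 1 k) else 0"
  have eq: "(\<Sum>k<nnz A. ?t i k) = mt (reals s src) i" if "i < d" for i
    unfolding support_mt[OF that, symmetric] using inp unfolding inp_def by (intro sum.cong) auto
  show "wpc A \<tau> (scatter dst 1 2 1 src) (4 * d + 4 * nnz A + 7) s Q"
  proof (rule wpc_scatter)
    fix s' :: store assume "nats s' = cnts s (nnz A)"
      "reals s' = (reals s)(dst := (\<lambda>j. if j < d then \<Sum>k<nnz A. ?t j k else reals s dst j))"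
    moreover have "(\<lambda>j. if j < d then \<Sum>k<nnz A. ?t j k else reals s dst j)
      = (\<lambda>j. if j < d then mt (reals s src) j else reals s dst j)" using eq by (auto simp: fun_eq_iff)
    ultimately show "Q s'" by (intro Q) simp_all
  qed (use inp support_nth assms(2,3) in \<open>auto simp: inp_def\<close>)
  show "4 * d + 4 * nnz A + 7 \<le> U" unfolding U_def using SS_ge by simp
qed

lemma wp_Solve:
  assumes pos: "\<And>i. i < n \<Longrightarrow> 0 < reals s w i"
    and Q: "\<And>s' z. nsol (reals s w) (reals s v) z \<Longrightarrow> nats s' = nats s \<Longrightarrow>
      reals s' = (reals s)(x := (\<lambda>j. if j < d then z j else reals s x j)) \<Longrightarrow> Q s'"
  shows "wpc A \<tau> (Solve w v x) U s Q"
proof -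
  obtain z where z: "nsol (reals s w) (reals s v) z" using ex_nsol pos by blast
  have the: "(THE z. z \<in> carrier_vec (dim_col A) \<and>
      weighted_gram A (reals s w) *\<^sub>v z = read_vec (dim_col A) v s) = Matrix.vec d z"
  proof (rule the_equality)
    show "Matrix.vec d z \<in> carrier_vec (dim_col A) \<and>
      weighted_gram A (reals s w) *\<^sub>v Matrix.vec d z = read_vec (dim_col A) v s"
      using z unfolding nsol_iff read_vec_def by simp
    fix u assume u: "u \<in> carrier_vec (dim_col A) \<and>
      weighted_gram A (reals s w) *\<^sub>v u = read_vec (dim_col A) v s"
    then have du: "dim_vec u = d" by simp
    have vu: "Matrix.vec d (vec_index u) = u" using du by (intro eq_vecI) simp_all
    have "nsol (reals s w) (reals s v) (vec_index u)"
      unfolding nsol_iff vu using u unfolding read_vec_def by simp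
    from nsol_unique[OF pos this z] have uz: "vec_index u j = z j" if "j < d" for j using that by blast
    show "u = Matrix.vec d z" using du uz by (intro eq_vecI) simp_all
  qed
  have "Q (solve_effect A w v x s)"
  proof (rule Q[OF z])
    show "nats (solve_effect A w v x s) = nats s"
      unfolding solve_effect_def write_vec_def by simp
    show "reals (solve_effect A w v x s) = (reals s)(x := (\<lambda>j. if j < d then z j else reals s x j))"
    proof -
      have "\<forall>i<dim_row A. reals s w i > 0" using pos by simp
      then have "reals (solve_effect A w v x s) = reals (write_vec x (Matrix.vec d z) s)"
        unfolding solve_effect_def the by simp
      also have "\<dots> = (reals s)(x := (\<lambda>j. if j < d then z j else reals s x j))"
        unfolding write_vec_def by (auto simp: fun_eq_iff)
      finally show ?thesis .
    qed
  qed
  then show ?thesis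
    by (rule wpc_mono[OF wpc_Solve[of Q]]) (simp_all add: U_def SS_def)
qed

lemma wp_RAssign:
  assumes "\<And>s'. nats s' = nats s \<Longrightarrow> reals s' = (reals s)(a := (reals s a)(nval i s := rval e s)) \<Longrightarrow> Q s'"
  shows "wpc A \<tau> (RAssign a i e) U s Q"
  by (rule wpc_mono[OF wpc_RAssign[of Q]], rule assms) (use U_pos in auto)

lemma wp_NAssign:
  assumes "\<And>s'. nats s' = (nats s)(a := (nats s a)(nval i s := nval e s)) \<Longrightarrow> reals s' = reals s \<Longrightarrow> Q s'"
  shows "wpc A \<tau> (NAssign a i e) U s Q"
  by (rule wpc_mono[OF wpc_NAssign[of Q]], rule assms) (use U_pos in auto)

end

section \<open>Computing approximate Lewis weights\<close>

text \<open>Memory layout, by array number. Naturals: 3 random signs; 11 to 13 powers of two, number of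
  rounds, number of samples per round; 14, 15 round and sample counters; 16, 17 all steps and primal
  steps of the multiplicative weights loop. Reals: 3 the current \<open>x\<close>; 4 diagonal passed to the solver;
  5 sum of the \<open>v\<close> and finally the normalized Lewis weights; 6 leverage estimates; 7 the current \<open>w\<close>; 8, 9, 10 right-hand
  side, solution and its image under \<open>A\<close>; 12, 13 residual \<open>Ax - b\<close> and \<open>f(x)\<close>; 14 the gap bound \<open>\<nu>\<close>; 16, 20 the
  diagonal \<open>D\<close> and the gradient \<open>g\<close>; 17, 18 increments of \<open>r\<close> from width and from primal steps; 19 sum of the
  \<open>\<Delta>\<close>; 22, 23, 24 candidate, its residual and value; 25 the scale \<open>a\<close>; 26 to 30 constants.\<close>

abbreviation ent :: "nat \<Rightarrow> rexp" where "ent a \<equiv> RRead a (ncell 10)"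
abbreviation eP :: rexp where "eP \<equiv> rcell 0"
abbreviation eN :: rexp where "eN \<equiv> ROfNat (ncell 0)"
abbreviation eD :: rexp where "eD \<equiv> ROfNat (NRead 0 (NConst 1))"

text \<open>The machine power is \<open>0\<close> on nonpositive bases, as \<open>powr\<close> is at
  \<open>0\<close>, so it is exact on nonnegative ones. Expressions have no conditionals: powers of
  absolute values use half the exponent on the square, and maxima use absolute differences.\<close>

definition Rpow :: "rexp \<Rightarrow> rexp \<Rightarrow> rexp" where "Rpow e q = RPowr e q"
definition Rabs :: "rexp \<Rightarrow> rexp \<Rightarrow> rexp" where "Rabs e q = RPowr (RMul e e) (RDiv q (rnum 2))"
definition Rmax :: "rexp \<Rightarrow> rexp \<Rightarrow> rexp" where
  "Rmax e f = RDiv (RAdd (RAdd e f) (Rabs (RSub e f) (rnum 1))) (rnum 2)"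

lemma rval_Rpow: "0 \<le> rval e s \<Longrightarrow> rval (Rpow e q) s = rval e s powr rval q s"
  unfolding Rpow_def by auto

lemma rval_Rabs [simp]: "rval (Rabs e q) s = \<bar>rval e s\<bar> powr rval q s"
proof -
  have "rval (Rabs e q) s = (rval e s * rval e s) powr (rval q s / 2)"
    unfolding Rabs_def by (cases "rval e s = 0") (auto simp: zero_less_mult_iff)
  then show ?thesis by (simp add: square_powr)
qed

lemma rval_Rmax [simp]: "rval (Rmax e f) s = max (rval e s) (rval f s)"
  unfolding Rmax_def by (auto simp: max_def abs_if powr_one)

text \<open>In the absence of multiplication of naturals, the binary logarithm of \<open>n\<close>
  is found by doubling, and the number of samples grows by \<open>8 * cc\<close> with each
  doubling.\<close>

definition p_log :: "nat \<Rightarrow> com" where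
  "p_log cc = Seq (block [NAssign 11 (NConst 0) (NConst 1), NAssign 12 (NConst 0) (NConst 0),
       NAssign 13 (NConst 0) (NConst 0)])
     (While (NLess (ncell 11) (ncell 0)) (block [
       NAssign 11 (NConst 0) (NAdd (ncell 11) (ncell 11)),
       NAssign 12 (NConst 0) (NAdd (ncell 12) (NConst 1)),
       NAssign 13 (NConst 0) (NAdd (ncell 13) (NConst (8 * cc)))]))"

text \<open>The right-hand side is the transpose of \<open>A\<close> applied to the signs times the
  root of the diagonal. Row \<open>i\<close> of the rescaled image of the solution is then the sign
  sum of row \<open>i\<close> of the projection in \<open>leverage_matrix\<close>, so one solve
  samples all scores.\<close>

definition p_sample :: com where
  "p_sample = block [
     vmap 10 0 (RMul (Rpow (ent 4) (RDiv (rnum 1) (rnum 2))) (RSub (RMul (rnum 2) (ROfNat (NRead 3 (ncell 10)))) (rnum 1))),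
     scatter 8 1 2 1 10,
     Solve 4 8 9,
     scatter 10 0 1 2 9,
     vsum 11 0 (RMul (ent 4) (RMul (ent 10) (ent 10))),
     vmap 6 0 (Rmax (ent 6) (RDiv (RMul (RMul (ent 4) (RMul (ent 10) (ent 10))) eD) (RAdd eD (rcell 11)))),
     NAssign 15 (NConst 0) (NAdd (ncell 15) (NConst 1))]"

text \<open>Adding \<open>d / n\<close> to the estimates keeps all weights positive and adds only
  \<open>d\<close> to their sum.\<close>

definition p_round :: com where
  "p_round = Seq (block [
       vmap 4 0 (Rpow (ent 7) (RDiv (RSub eP (rnum 2)) eP)),
       vmap 5 0 (RAdd (ent 5) (ent 4)),
       vmap 6 0 (rnum 0),
       NAssign 15 (NConst 0) (NConst 0)])
     (Seq (While (NLess (ncell 15) (ncell 13)) (Seq (forl 0 (Flip 3 (ncell 10))) p_sample))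
       (block [
         vmap 7 0 (RAdd (ent 6) (RDiv eD eN)),
         NAssign 14 (NConst 0) (NAdd (ncell 14) (NConst 1))]))"

text \<open>The final division averages over the rounds and scales the result to the dual norm bound
  \<open>1\<close> that \<open>hb0\<close> of \<open>mwu\<close> demands.\<close>

definition p_lewis :: "nat \<Rightarrow> com" where
  "p_lewis cc = Seq (p_log cc)
     (Seq (block [vmap 7 0 (RDiv eD eN), vmap 5 0 (rnum 0), NAssign 14 (NConst 0) (NConst 0)])
     (Seq (While (NLess (ncell 14) (ncell 12)) p_round)
       (block [vmap 5 0 (RDiv (ent 5) (RMul (ROfNat (ncell 12))
          (Rpow (RMul (RAdd (ROfNat (ncell 13)) (rnum 1)) eD) (RDiv (RSub eP (rnum 2)) eP))))])))"

text \<open>\<open>X\<close> is a ghost copy of the real memory before this phase; with it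
  \<open>base\<close> says that the current point, its residual and its value survive.\<close>

locale lewis_run = regression +
  fixes cc :: nat and X :: "nat \<Rightarrow> nat \<Rightarrow> real"
  assumes p: "2 < p" and n2: "2 \<le> n"
begin

definition base :: "store \<Rightarrow> bool" where
  "base s \<longleftrightarrow> inp s \<and> reals s 3 = X 3 \<and> reals s 12 = X 12 \<and> reals s 13 = X 13"

lemma base_cong:
  assumes "base s" "\<And>a. a < 3 \<Longrightarrow> nats s' a = nats s a"
    "\<And>a. a \<in> {0, 1, 2, 3, 12, 13} \<Longrightarrow> reals s' a = reals s a"
  shows "base s'"
proof -
  have "inp s'"
  proof (rule inp_cong[of s])
    show "inp s" using assms(1) unfolding base_def by simp
    show "reals s' a = reals s a" if "a < 3" for a
      using assms(3)[of a] that by (auto simp: less_Suc_eq numeral_eq_Suc)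
  qed (rule assms(2))
  then show ?thesis using assms(1) assms(3)[of 3] assms(3)[of 12] assms(3)[of 13] unfolding base_def by simp
qed

lemma baseD: "base s \<Longrightarrow> inp s" unfolding base_def by simp

lemma inpD:
  assumes "inp s"
  shows "nats s 0 0 = n" "nats s 0 (Suc 0) = d" "reals s 0 0 = p" "reals s 0 (Suc 0) = \<epsilon>"
  using assms unfolding inp_def by auto

definition ell :: nat where "ell = (LEAST l. n \<le> 2 ^ l)"
definition JJ :: nat where "JJ = 8 * cc * ell"

lemma ell: "n \<le> 2 ^ ell" "2 ^ k < n \<Longrightarrow> k < ell" "1 \<le> ell" "2 ^ (ell - 1) < n"
proof -
  have "n \<le> 2 ^ n" by (simp add: less_imp_le)
  then show 1: "n \<le> 2 ^ ell" unfolding ell_def by (rule LeastI)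
  show 2: "k < ell" if "2 ^ k < n" for k
  proof (rule ccontr)
    assume "\<not> k < ell"
    then have "(2::nat) ^ ell \<le> 2 ^ k" by (intro power_increasing) auto
    then show False using 1 that by linarith
  qed
  show 3: "1 \<le> ell" using 2[of 0] n2 by simp
  show "2 ^ (ell - 1) < n"
  proof (rule ccontr)
    assume "\<not> 2 ^ (ell - 1) < n"
    then have "ell \<le> ell - 1" unfolding ell_def by (intro Least_le) simp
    then show False using 3 by simp
  qed
qed

definition logged :: "store \<Rightarrow> bool" where
  "logged s \<longleftrightarrow> base s \<and> nats s 12 0 = ell \<and> nats s 13 0 = JJ"

lemma logged_cong:
  assumes "logged s" "\<And>a. a \<in> {0, 1, 2, 12, 13} \<Longrightarrow> nats s' a = nats s a"
    "\<And>a. a \<in> {0, 1, 2, 3, 12, 13} \<Longrightarrow> reals s' a = reals s a"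
  shows "logged s'"
proof -
  have "base s'"
  proof (rule base_cong[of s])
    show "base s" using assms(1) unfolding logged_def by simp
    show "nats s' a = nats s a" if "a < 3" for a
      using assms(2)[of a] that by (auto simp: less_Suc_eq numeral_eq_Suc)
  qed (rule assms(3))
  then show ?thesis using assms(1) assms(2)[of 12] assms(2)[of 13] unfolding logged_def by simp
qed

lemma wp_log:
  assumes "base s"
  shows "wpc A \<tau> (p_log cc) (7 * U + (ell * (7 * U + 1) + 1) + 1) s logged"
proof -
  let ?I = "\<lambda>k s. base s \<and> k \<le> ell \<and> nats s 11 0 = 2 ^ k \<and> nats s 12 0 = k \<and> nats s 13 0 = 8 * cc * k"
  show ?thesis
    unfolding p_log_def
    apply (rule wpc_Seq, rule wp_block, (rule wp_block_Cons, rule wp_NAssign)+, rule wp_block_Nil)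
    subgoal premises s1 for s1 s2 s3
    proof (rule wpc_While[where I = ?I])
      have "base s3" by (rule base_cong[OF assms]) (use s1 in auto)
      then show "?I 0 s3" using s1 by simp
    next
      fix k s assume I: "?I k s" and b: "bval (NLess (ncell 11) (ncell 0)) s"
      have "nats s 0 0 = n" using I inpD(1) baseD by blast
      then have k: "k < ell" using I b ell(2)[of k] by simp
      show "k < ell \<and> wpc A \<tau> (block [NAssign 11 (NConst 0) (NAdd (ncell 11) (ncell 11)),
         NAssign 12 (NConst 0) (NAdd (ncell 12) (NConst 1)), NAssign 13 (NConst 0) (NAdd (ncell 13) (NConst (8 * cc)))])
         (7 * U) s (?I (Suc k))"
        apply (rule conjI[OF k], rule wp_block, (rule wp_block_Cons, rule wp_NAssign)+, rule wp_block_Nil)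
        subgoal premises st for s1 s2 s3
        proof -
          have "base s3" by (rule base_cong[of s]) (use I st in auto)
          then show ?thesis using I k st by simp
        qed
        by simp
    next
      fix k s assume I: "?I k s" and b: "\<not> bval (NLess (ncell 11) (ncell 0)) s"
      have "nats s 0 0 = n" using I inpD(1) baseD by blast
      then have "\<not> 2 ^ k < n" using I b by simp
      then have "ell \<le> k" unfolding ell_def by (intro Least_le) simp
      then have "k = ell" using I by simp
      then show "logged s" using I unfolding logged_def JJ_def by simp
    qed
    by simp
qed

section \<open>Leverage estimates and the failure bound of the Lewis phase\<close>

definition is_lev :: "(nat \<Rightarrow> real) \<Rightarrow> (nat \<Rightarrow> nat \<Rightarrow> real) \<Rightarrow> bool" where
  "is_lev v c \<longleftrightarrow>
    (\<forall>\<xi> z i. nsol v (mt (\<lambda>i. sqrt (v i) * \<xi> i)) z \<longrightarrow> i < n \<longrightarrow> sqrt (v i) * mv z i = (\<Sum>j<n. c i j * \<xi> j)) \<and>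
    (\<Sum>i<n. \<Sum>j<n. (c i j)\<^sup>2) = d \<and>
    (\<forall>x i. i < n \<longrightarrow> v i * (mv x i)\<^sup>2 \<le> (\<Sum>j<n. (c i j)\<^sup>2) * wsq v (mv x))"

text \<open>One fixed projection matrix per diagonal, so that failure bounds become functions of the
  store.\<close>

definition lev :: "(nat \<Rightarrow> real) \<Rightarrow> nat \<Rightarrow> nat \<Rightarrow> real" where
  "lev v = (SOME c. is_lev v c)"

lemma is_lev_lev:
  assumes "\<And>i. i < n \<Longrightarrow> 0 < v i"
  shows "is_lev v (lev v)"
proof -
  have "\<exists>c. is_lev v c"
  proof (rule leverage_matrix[of v])
    fix c assume c:
      "\<And>\<xi> z i. nsol v (mt (\<lambda>i. sqrt (v i) * \<xi> i)) z \<Longrightarrow> i < n \<Longrightarrow> sqrt (v i) * mv z i = (\<Sum>j<n. c i j * \<xi> j)"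
      "(\<Sum>i<n. \<Sum>j<n. (c i j)\<^sup>2) = d"
      "\<And>x i. i < n \<Longrightarrow> v i * (mv x i)\<^sup>2 \<le> (\<Sum>j<n. (c i j)\<^sup>2) * wsq v (mv x)"
    have "is_lev v c" unfolding is_lev_def
      by (intro conjI allI impI) (rule c(1), assumption+, rule c(2), rule c(3), assumption)
    then show "\<exists>c. is_lev v c" by blast
  qed (rule assms)
  then show ?thesis unfolding lev_def by (rule someI_ex)
qed

definition sq :: "(nat \<Rightarrow> real) \<Rightarrow> (nat \<Rightarrow> nat) \<Rightarrow> nat \<Rightarrow> real" where
  "sq v h i = (\<Sum>j<n. lev v i j * sg h j)\<^sup>2"

definition est :: "(nat \<Rightarrow> real) \<Rightarrow> (nat \<Rightarrow> nat) \<Rightarrow> nat \<Rightarrow> real" where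
  "est v h i = sq v h i * d / (d + (\<Sum>i<n. sq v h i))"

text \<open>The exact leverage score, which exists in the analysis only.\<close>

definition lsc :: "(nat \<Rightarrow> real) \<Rightarrow> nat \<Rightarrow> real" where
  "lsc v i = (\<Sum>j<n. (lev v i j)\<^sup>2)"

lemma est_nonneg: "0 \<le> est v h i"
  unfolding est_def sq_def by (intro divide_nonneg_nonneg mult_nonneg_nonneg add_nonneg_nonneg sum_nonneg) auto

lemma est_sum_le: "(\<Sum>i<n. est v h i) \<le> d"
proof -
  have T: "0 \<le> (\<Sum>i<n. sq v h i)" unfolding sq_def by (intro sum_nonneg) auto
  have "(\<Sum>i<n. est v h i) = (\<Sum>i<n. sq v h i) * d / (d + (\<Sum>i<n. sq v h i))"
    unfolding est_def by (simp add: sum_distrib_right sum_divide_distrib)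
  also have "\<dots> \<le> d" using T d0 by (simp add: divide_le_eq add_pos_nonneg algebra_simps)
  finally show ?thesis .
qed

lemma est_le: "i < n \<Longrightarrow> est v h i \<le> d"
  using est_sum_le[of v h] member_le_sum[of i "{..<n}" "est v h"] est_nonneg by simp

lemma wp_sample:
  assumes base: "base s" and v: "\<And>i. i < n \<Longrightarrow> 0 < reals s 4 i"
  shows "wpc A \<tau> p_sample (15 * U) s (\<lambda>s'.
    (\<forall>a. a \<noteq> 10 \<longrightarrow> a \<noteq> 15 \<longrightarrow> nats s' a = nats s a) \<and> nats s' 15 0 = nats s 15 0 + 1 \<and>
    (\<forall>a\<in>{0, 1, 2, 3, 4, 5, 7, 12, 13}. reals s' a = reals s a) \<and>
    (\<forall>i<n. reals s' 6 i = max (reals s 6 i) (est (reals s 4) (nats s 3) i)))"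
proof -
  define v where "v = reals s 4"
  define h where "h = nats s 3"
  note inp = baseD[OF base] note ip = inpD[OF inp]
  have lv: "is_lev v (lev v)" unfolding v_def by (rule is_lev_lev) (rule v)
  show ?thesis
    unfolding p_sample_def
    apply (rule wp_block, rule wp_block_Cons, rule wp_vmap[OF inp, where g = "\<lambda>i. sqrt (v i) * sg h i" and m = n], simp, simp)
    subgoal premises s' for i s'
      using s' v[OF s'(1)] by (simp add: rval_Rpow powr_half_sqrt v_def h_def sg_def)
    subgoal premises s1 for s1
    proof -
      have inp1: "inp s1" by (rule inp_cong[OF inp]) (use s1 in auto)
      show ?thesis
        apply (rule wp_block_Cons, rule wp_mulAT[OF inp1], simp, simp)
        subgoal premises s2 for s2
          apply (rule wp_block_Cons, rule wp_Solve)
          subgoal premises i for i using v[OF i] s2 s1 by simp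
          subgoal premises s3 for s3 z
          proof -
            have inp3: "inp s3" by (rule inp_cong[OF inp]) (use s1 s2 s3 in auto)
            have "nsol v (mt (\<lambda>i. sqrt (v i) * sg h i)) z"
            proof -
              have "reals s2 4 = v" using s2 s1 by (simp add: v_def)
              moreover have "reals s2 8 j = mt (\<lambda>i. sqrt (v i) * sg h i) j" if "j < d" for j
                using that s2 s1 unfolding mt_def by simp
              ultimately show ?thesis using s3(1) unfolding nsol_def by simp
            qed
            then have root: "sqrt (v i) * mv z i = (\<Sum>j<n. lev v i j * sg h j)" if "i < n" for i
              using lv that unfolding is_lev_def by blast
            have Xi: "v i * (mv z i * mv z i) = sq v h i" if "i < n" for i
              unfolding sq_def root[OF that, symmetric] using v[OF that]
              by (simp add: v_def power_mult_distrib power2_eq_square[of "mv z i"] less_imp_le)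
            show ?thesis
              apply (rule wp_block_Cons, rule wp_mulA[OF inp3], simp, simp)
              subgoal premises s4 for s4
              proof -
                have inp4: "inp s4" by (rule inp_cong[OF inp3]) (use s4 in auto)
                have y: "reals s4 10 i = mv z i" if "i < n" for i
                  using that s4 s3 by (simp add: mv_def)
                have v4: "reals s4 4 = v" using s4 s3 s2 s1 by (simp add: v_def)
                show ?thesis
                  apply (rule wp_block_Cons, rule wp_vsum[OF inp4, where m = n and g = "sq v h"], simp, simp)
                  subgoal premises s' for i s' x
                    using s' y[OF s'(1)] v4 Xi[OF s'(1)] by simp
                  subgoal premises s5 for s5
                  proof -
                    have inp5: "inp s5" by (rule inp_cong[OF inp4]) (use s5 in auto)
                    have e6: "reals s5 6 = reals s 6" using s5 s4 s3 s2 s1 by simp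
                    show ?thesis
                      apply (rule wp_block_Cons,
                          rule wp_vmap[OF inp5, where m = n and g = "\<lambda>i. max (reals s 6 i) (est v h i)"], simp, simp)
                      subgoal premises s' for i s'
                        using s' s5 y[OF s'(1)] v4 Xi[OF s'(1)] inpD[OF inp5] e6 unfolding est_def by simp
                      subgoal premises s6 for s6
                        apply (rule wp_block_Cons, rule wp_NAssign, rule wp_block_Nil)
                        subgoal premises s7 for s7
                          using s7 s6 s5 s4 s3 s2 s1 unfolding v_def[symmetric] h_def[symmetric] by auto
                        done
                      done
                  qed
                  done
              qed
              done
          qed
          done
        done
    qed
    by simp
qed

definition yy :: "(nat \<Rightarrow> nat \<Rightarrow> real) \<Rightarrow> nat \<Rightarrow> nat \<Rightarrow> real" where
  "yy W k i = W k i powr ((p - 2) / p)"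

text \<open>Ghost history of the weights of all rounds: the program overwrites them, but
  \<open>lewis_norm\<close> speaks of every round. The bound \<open>2 * d\<close> is
  \<open>d\<close> for an estimate plus at most \<open>d\<close> for the summand
  \<open>d / n\<close>.\<close>

definition hist :: "(nat \<Rightarrow> nat \<Rightarrow> real) \<Rightarrow> nat \<Rightarrow> bool" where
  "hist W k \<longleftrightarrow> (\<forall>k'\<le>k. \<forall>i<n. 0 < W k' i \<and> W k' i \<le> 2 * real d) \<and> (\<forall>i<n. W 0 i = real d / real n) \<and>
     (\<forall>k'\<le>k. (\<Sum>i<n. W k' i) \<le> (real JJ + 1) * d) \<and>
     (\<forall>k'<k. \<forall>i<n. \<forall>x. yy W k' i * (mv x i)\<^sup>2 \<le> 74 * W (Suc k') i * wsq (yy W k') (mv x))"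

definition linv :: "nat \<Rightarrow> store \<Rightarrow> bool" where
  "linv k s \<longleftrightarrow> (\<exists>W. hist W k \<and> logged s \<and> nats s 14 0 = k \<and>
     (\<forall>i<n. reals s 7 i = W k i \<and> reals s 5 i = (\<Sum>k'<k. yy W k' i)))"

definition linv2 :: "nat \<Rightarrow> nat \<Rightarrow> store \<Rightarrow> bool" where
  "linv2 k j s \<longleftrightarrow> (\<exists>W. hist W k \<and> logged s \<and> nats s 14 0 = k \<and> nats s 15 0 = j \<and>
     (\<forall>i<n. reals s 7 i = W k i \<and> reals s 5 i = (\<Sum>k'<Suc k. yy W k' i) \<and> reals s 4 i = yy W k i \<and>
        0 \<le> reals s 6 i \<and> reals s 6 i \<le> d) \<and>
     (\<Sum>i<n. reals s 6 i) \<le> real j * d)"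

definition q0 :: real where "q0 = 11 / 12"

definition bad :: "store \<Rightarrow> nat \<Rightarrow> real" where
  "bad s i = (if reals s 6 i < lsc (reals s 4) i / 74 then 1 else 0)"

text \<open>\<open>FF k\<close> and \<open>GG k j\<close> bound the probability that some leverage score is underestimated from round
  \<open>k\<close>, respectively from sample \<open>j\<close> of round \<open>k\<close>, on: one sample fails for a given row with
  probability at most \<open>q0\<close>, whatever happened before.\<close>

definition FF :: "nat \<Rightarrow> store \<Rightarrow> real" where
  "FF k s = (if linv k s then min 1 (real (ell - k) * n * q0 ^ JJ) else 1)"

definition GG :: "nat \<Rightarrow> nat \<Rightarrow> store \<Rightarrow> real" where
  "GG k j s = (if linv2 k j s
     then min 1 ((\<Sum>i<n. bad s i) * q0 ^ (JJ - j) + real (ell - Suc k) * n * q0 ^ JJ) else 1)"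

lemma q0_pos: "0 < q0" unfolding q0_def by simp

lemma safe_start:
  "safe A \<tau> (block [
       vmap 4 0 (Rpow (ent 7) (RDiv (RSub eP (rnum 2)) eP)),
       vmap 5 0 (RAdd (ent 5) (ent 4)),
       vmap 6 0 (rnum 0),
       NAssign 15 (NConst 0) (NConst 0)]) (9 * U)
     (\<lambda>s. if bval (NLess (ncell 14) (ncell 12)) s then FF k s else 1) (GG k 0)"
proof (rule safe_wpc)
  fix s assume lt: "(if bval (NLess (ncell 14) (ncell 12)) s then FF k s else 1) < 1"
  then have b: "bval (NLess (ncell 14) (ncell 12)) s" and "linv k s"
    unfolding FF_def by (auto split: if_splits)
  then obtain W where W: "hist W k" "logged s" "nats s 14 0 = k"
    and r: "\<And>i. i < n \<Longrightarrow> reals s 7 i = W k i" "\<And>i. i < n \<Longrightarrow> reals s 5 i = (\<Sum>k'<k. yy W k' i)"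
    unfolding linv_def by blast
  have k: "k < ell" using b W unfolding logged_def by simp
  have inp: "inp s" using W(2) baseD unfolding logged_def by blast
  have Wpos: "0 < W k i" if "i < n" for i using W(1) that unfolding hist_def by blast
  have post: "GG k 0 s' \<le> (if bval (NLess (ncell 14) (ncell 12)) s then FF k s else 1)"
    if nats: "\<And>a. a \<noteq> 10 \<Longrightarrow> a \<noteq> 15 \<Longrightarrow> nats s' a = nats s a" "nats s' 15 0 = 0"
      and reals: "\<And>a. a \<notin> {4, 5, 6} \<Longrightarrow> reals s' a = reals s a"
        "\<And>i. i < n \<Longrightarrow> reals s' 4 i = yy W k i" "\<And>i. i < n \<Longrightarrow> reals s' 5 i = (\<Sum>k'<Suc k. yy W k' i)"
        "\<And>i. i < n \<Longrightarrow> reals s' 6 i = 0" for s'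
  proof -
    have "logged s'" by (rule logged_cong[OF W(2)]) (use nats reals in auto)
    then have l20: "linv2 k 0 s'" unfolding linv2_def
      by (intro exI[of _ W] conjI allI impI) (simp_all add: W nats reals r)
    \<comment> \<open>Before the first sample every row may be underestimated; this is the share
      \<open>n * q0 ^ JJ\<close> of the present round.\<close>
    have "(\<Sum>i<n. bad s' i) \<le> n" using sum_bounded_above[of "{..<n}" "bad s'" 1] unfolding bad_def by auto
    then have "(\<Sum>i<n. bad s' i) * q0 ^ JJ + real (ell - Suc k) * n * q0 ^ JJ
        \<le> n * q0 ^ JJ + real (ell - Suc k) * n * q0 ^ JJ"
      using q0_pos by (intro add_right_mono mult_right_mono) auto
    also have "\<dots> = real (ell - k) * n * q0 ^ JJ"
    proof -
      have "real (ell - k) = 1 + real (ell - Suc k)" using k by (simp add: of_nat_diff)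
      then show ?thesis by (simp add: algebra_simps)
    qed
    finally show ?thesis using b \<open>linv k s\<close> l20 unfolding GG_def FF_def by auto
  qed
  show "wpc A \<tau> (block [
       vmap 4 0 (Rpow (ent 7) (RDiv (RSub eP (rnum 2)) eP)),
       vmap 5 0 (RAdd (ent 5) (ent 4)),
       vmap 6 0 (rnum 0),
       NAssign 15 (NConst 0) (NConst 0)]) (9 * U) s
     (\<lambda>s'. GG k 0 s' \<le> (if bval (NLess (ncell 14) (ncell 12)) s then FF k s else 1))"
    apply (rule wp_block, rule wp_block_Cons, rule wp_vmap[OF inp, where g = "yy W k" and m = n], simp, simp)
    subgoal premises s' for i s'
      using s' r(1)[OF s'(1)] Wpos[OF s'(1)] inpD[OF inp] by (simp add: rval_Rpow yy_def)
    subgoal premises s1 for s1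
    proof -
      have inp1: "inp s1" by (rule inp_cong[OF inp]) (use s1 in auto)
      show ?thesis
        apply (rule wp_block_Cons, rule wp_vmap[OF inp1, where g = "\<lambda>i. \<Sum>k'<Suc k. yy W k' i" and m = n], simp, simp)
        subgoal premises s' for i s' using s' s1 r(2)[OF s'(1)] by simp
        subgoal premises s2 for s2
        proof -
          have inp2: "inp s2" by (rule inp_cong[OF inp1]) (use s2 in auto)
          show ?thesis
            apply (rule wp_block_Cons, rule wp_vmap[OF inp2, where g = "\<lambda>_. 0" and m = n], simp, simp, simp)
            subgoal premises s3 for s3
              apply (rule wp_block_Cons, rule wp_NAssign, rule wp_block_Nil)
              subgoal premises s4 for s4
                by (rule post) (use s4 s3 s2 s1 in auto)
              done
            done
        qed
        done
    qed
    by simp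
qed

text \<open>\<open>GG k (Suc j)\<close> pulled back through the deterministic part of the sample:
  \<open>est\<close> is evaluated at the bits just written to array \<open>3\<close>.\<close>

definition mid :: "nat \<Rightarrow> nat \<Rightarrow> store \<Rightarrow> real" where
  "mid k j s = (if linv2 k j s then min 1 ((\<Sum>i<n. if max (reals s 6 i) (est (reals s 4) (nats s 3) i)
       < lsc (reals s 4) i / 74 then 1 else 0) * q0 ^ (JJ - Suc j) + real (ell - Suc k) * n * q0 ^ JJ) else 1)"

lemma linv2E:
  assumes "linv2 k j s"
  obtains W where "hist W k" "logged s" "nats s 14 0 = k" "nats s 15 0 = j"
    "\<And>i. i < n \<Longrightarrow> reals s 7 i = W k i" "\<And>i. i < n \<Longrightarrow> reals s 5 i = (\<Sum>k'<Suc k. yy W k' i)"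
    "\<And>i. i < n \<Longrightarrow> reals s 4 i = yy W k i" "\<And>i. i < n \<Longrightarrow> 0 \<le> reals s 6 i" "\<And>i. i < n \<Longrightarrow> reals s 6 i \<le> d"
    "(\<Sum>i<n. reals s 6 i) \<le> real j * d"
  using assms unfolding linv2_def by blast

lemma linv2I:
  assumes "hist W k" "logged s" "nats s 14 0 = k" "nats s 15 0 = j"
    "\<And>i. i < n \<Longrightarrow> reals s 7 i = W k i" "\<And>i. i < n \<Longrightarrow> reals s 5 i = (\<Sum>k'<Suc k. yy W k' i)"
    "\<And>i. i < n \<Longrightarrow> reals s 4 i = yy W k i" "\<And>i. i < n \<Longrightarrow> 0 \<le> reals s 6 i" "\<And>i. i < n \<Longrightarrow> reals s 6 i \<le> d"
    "(\<Sum>i<n. reals s 6 i) \<le> real j * d"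
  shows "linv2 k j s"
  unfolding linv2_def by (intro exI[of _ W] conjI allI impI) (fact assms)+

lemma linv2_pos:
  assumes "linv2 k j s" "i < n"
  shows "0 < reals s 4 i"
proof -
  from assms(1) obtain W where W: "hist W k" "logged s" "nats s 14 0 = k" "nats s 15 0 = j"
    and r7: "\<And>i. i < n \<Longrightarrow> reals s 7 i = W k i" and r5: "\<And>i. i < n \<Longrightarrow> reals s 5 i = (\<Sum>k'<Suc k. yy W k' i)"
    and r4: "\<And>i. i < n \<Longrightarrow> reals s 4 i = yy W k i"
    and r6: "\<And>i. i < n \<Longrightarrow> 0 \<le> reals s 6 i" "\<And>i. i < n \<Longrightarrow> reals s 6 i \<le> d"
    and sum6: "(\<Sum>i<n. reals s 6 i) \<le> real j * d" by (rule linv2E) (rule that; assumption)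
  have "0 < W k i" using W(1) assms(2) unfolding hist_def by blast
  then show ?thesis using r4[OF assms(2)] by (simp add: yy_def)
qed

lemma safe_p_sample: "safe A \<tau> p_sample (15 * U) (mid k j) (GG k (Suc j))"
proof (rule safe_wpc)
  fix s assume "mid k j s < 1"
  then have l2: "linv2 k j s" unfolding mid_def by (auto split: if_splits)
  from l2 obtain W where W: "hist W k" "logged s" "nats s 14 0 = k" "nats s 15 0 = j"
    and r7: "\<And>i. i < n \<Longrightarrow> reals s 7 i = W k i" and r5: "\<And>i. i < n \<Longrightarrow> reals s 5 i = (\<Sum>k'<Suc k. yy W k' i)"
    and r4: "\<And>i. i < n \<Longrightarrow> reals s 4 i = yy W k i"
    and r6: "\<And>i. i < n \<Longrightarrow> 0 \<le> reals s 6 i" "\<And>i. i < n \<Longrightarrow> reals s 6 i \<le> d"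
    and sum6: "(\<Sum>i<n. reals s 6 i) \<le> real j * d" by (rule linv2E) (rule that; assumption)
  have base: "base s" using W(2) unfolding logged_def by blast
  show "wpc A \<tau> p_sample (15 * U) s (\<lambda>s'. GG k (Suc j) s' \<le> mid k j s)"
  proof (rule wpc_mono[OF wp_sample[OF base linv2_pos[OF l2]]])
    fix s' :: store assume post: "(\<forall>a. a \<noteq> 10 \<longrightarrow> a \<noteq> 15 \<longrightarrow> nats s' a = nats s a) \<and> nats s' 15 0 = nats s 15 0 + 1 \<and>
      (\<forall>a\<in>{0, 1, 2, 3, 4, 5, 7, 12, 13}. reals s' a = reals s a) \<and>
      (\<forall>i<n. reals s' 6 i = max (reals s 6 i) (est (reals s 4) (nats s 3) i))"
    let ?e = "est (reals s 4) (nats s 3)"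
    have nats: "\<And>a. a \<noteq> 10 \<Longrightarrow> a \<noteq> 15 \<Longrightarrow> nats s' a = nats s a" "nats s' 15 0 = Suc j"
      and s6: "\<And>i. i < n \<Longrightarrow> reals s' 6 i = max (reals s 6 i) (?e i)"
      using post W(4) by simp_all
    have reals: "\<And>a. a \<in> {0, 1, 2, 3, 4, 5, 7, 12, 13} \<Longrightarrow> reals s' a = reals s a"
      using post by blast
    have same: "reals s' 4 = reals s 4" "reals s' 5 = reals s 5" "reals s' 7 = reals s 7"
      by (rule reals, simp)+
    have "linv2 k (Suc j) s'"
    proof (rule linv2I[OF W(1)])
      show "logged s'" by (rule logged_cong[OF W(2)]) (rule nats reals; auto)+
      show "nats s' 14 0 = k" using nats(1)[of 14] W(3) by simp
      show "nats s' 15 0 = Suc j" by (rule nats)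
      fix i assume i: "i < n"
      show "reals s' 7 i = W k i" "reals s' 5 i = (\<Sum>k'<Suc k. yy W k' i)" "reals s' 4 i = yy W k i"
        unfolding same by (rule r7 r5 r4, rule i)+
      show "0 \<le> reals s' 6 i" "reals s' 6 i \<le> d" unfolding s6[OF i] using r6[OF i] est_le[OF i] by auto
    next
      have "(\<Sum>i<n. reals s' 6 i) \<le> (\<Sum>i<n. reals s 6 i + ?e i)"
      proof (rule sum_mono)
        fix i assume "i \<in> {..<n}"
        then have i: "i < n" by simp
        show "reals s' 6 i \<le> reals s 6 i + ?e i"
          unfolding s6[OF i] using r6(1)[OF i] est_nonneg[of "reals s 4" "nats s 3" i] by simp
      qed
      also have "\<dots> \<le> real j * d + d" unfolding sum.distrib using sum6 est_sum_le by (intro add_mono)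
      finally show "(\<Sum>i<n. reals s' 6 i) \<le> real (Suc j) * d" by (simp add: algebra_simps)
    qed
    moreover have "bad s' i = (if max (reals s 6 i) (?e i) < lsc (reals s 4) i / 74 then 1 else 0)" if "i < n" for i
      unfolding bad_def same s6[OF that] ..
    ultimately show "GG k (Suc j) s' \<le> mid k j s" using l2 unfolding GG_def mid_def by simp
  qed simp_all
qed

text \<open>A row stays bad only if it was bad before and the fresh sample fails too. The first
  factor does not involve the new bits, so averaging over them multiplies the number of bad rows by
  at most \<open>q0\<close>.\<close>

lemma safe_sample:
  assumes j: "j < JJ"
  shows "safe A \<tau> (Seq (forl 0 (Flip 3 (ncell 10))) p_sample) (17 * U)
    (\<lambda>s. if bval (NLess (ncell 15) (ncell 13)) s then GG k j s else 1) (GG k (Suc j))"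
proof (rule safe_mono[OF safe_Seq[OF safe_flips[where n = n] safe_p_sample]])
  show "mid k j s \<le> 1" for s unfolding mid_def by simp
  show "4 * n + 3 + 15 * U + 1 \<le> 17 * U" unfolding U_def using SS_ge by simp
  fix s
  let ?upd = "\<lambda>h. s\<lparr>nats := (cnts s n)(3 := h)\<rparr>"
  let ?L = "if nats s 0 0 = n then bavg [0..<n] (\<lambda>h. mid k j (?upd h)) (nats s 3) else 1"
  have "mid k j s' \<le> 1" for s' unfolding mid_def by simp
  then have L1: "?L \<le> 1" using bavg_mono[of "\<lambda>h. mid k j (?upd h)" "\<lambda>_. 1"] by (simp add: bavg_const)
  show "?L \<le> (if bval (NLess (ncell 15) (ncell 13)) s then GG k j s else 1)"
  proof (cases "linv2 k j s \<and> bval (NLess (ncell 15) (ncell 13)) s")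
    case False
    then show ?thesis using L1 unfolding GG_def by auto
  next
    case True
    then have l2: "linv2 k j s" by simp
    then have "inp s" unfolding linv2_def logged_def base_def by blast
    then have n: "nats s 0 0 = n" by (rule inpD)
    define v where "v = reals s 4"
    let ?R = "real (ell - Suc k) * n * q0 ^ JJ"
    let ?f = "\<lambda>i h. if est v h i < lsc v i / 74 then 1 else (0::real)"
    have lv: "is_lev v (lev v)" unfolding v_def by (rule is_lev_lev) (rule linv2_pos[OF l2])
    have fl: "bavg [0..<n] (?f i) (nats s 3) \<le> q0" if "i < n" for i
      unfolding q0_def est_def sq_def lsc_def
      using sample_failure[where d = "real d" and n = n and c = "lev v" and i = i] lv d0 that unfolding is_lev_def by simp
    have "linv2 k j (?upd h)" for h
    proof -
      have log: "logged (?upd h)" if "logged s" by (rule logged_cong[OF that]) auto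
      from l2 obtain W where W: "hist W k" "logged s" "nats s 14 0 = k" "nats s 15 0 = j"
    and r7: "\<And>i. i < n \<Longrightarrow> reals s 7 i = W k i" and r5: "\<And>i. i < n \<Longrightarrow> reals s 5 i = (\<Sum>k'<Suc k. yy W k' i)"
    and r4: "\<And>i. i < n \<Longrightarrow> reals s 4 i = yy W k i"
    and r6: "\<And>i. i < n \<Longrightarrow> 0 \<le> reals s 6 i" "\<And>i. i < n \<Longrightarrow> reals s 6 i \<le> d"
    and sum6: "(\<Sum>i<n. reals s 6 i) \<le> real j * d" by (rule linv2E) (rule that; assumption)
      show ?thesis by (rule linv2I[OF W(1)]) (use W(3,4) r7 r5 r4 r6 sum6 log[OF W(2)] in simp_all)
    qed
    then have pt: "mid k j (?upd h) \<le> (\<Sum>i<n. (bad s i * q0 ^ (JJ - Suc j)) * ?f i h) + ?R" for h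
    proof -
      have "mid k j (?upd h) \<le> (\<Sum>i<n. if max (reals s 6 i) (est v h i) < lsc v i / 74 then 1 else 0) * q0 ^ (JJ - Suc j) + ?R"
        using \<open>\<And>h. linv2 k j (?upd h)\<close> unfolding mid_def v_def by simp
      also have "\<dots> \<le> (\<Sum>i<n. bad s i * ?f i h) * q0 ^ (JJ - Suc j) + ?R"
        using q0_pos unfolding bad_def v_def by (intro add_right_mono mult_right_mono sum_mono) auto
      also have "(\<Sum>i<n. bad s i * ?f i h) * q0 ^ (JJ - Suc j) = (\<Sum>i<n. (bad s i * q0 ^ (JJ - Suc j)) * ?f i h)"
        unfolding sum_distrib_right by (intro sum.cong refl) (simp only: ac_simps)
      finally show ?thesis .
    qed
    have "bavg [0..<n] (\<lambda>h. mid k j (?upd h)) (nats s 3)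
      \<le> bavg [0..<n] (\<lambda>h. (\<Sum>i<n. (bad s i * q0 ^ (JJ - Suc j)) * ?f i h) + ?R) (nats s 3)"
      by (rule bavg_mono) (rule pt)
    also have "\<dots> = (\<Sum>i<n. (bad s i * q0 ^ (JJ - Suc j)) * bavg [0..<n] (?f i) (nats s 3)) + ?R"
      unfolding bavg_add bavg_sum[OF finite_lessThan] bavg_scale bavg_const ..
    also have "\<dots> \<le> (\<Sum>i<n. (bad s i * q0 ^ (JJ - Suc j)) * q0) + ?R"
      using fl q0_pos unfolding bad_def by (intro add_right_mono sum_mono mult_left_mono) auto
    also have "\<dots> = (\<Sum>i<n. bad s i) * q0 ^ (JJ - j) + ?R"
    proof -
      have "JJ - j = Suc (JJ - Suc j)" using j by simp
      then have "q0 ^ (JJ - j) = q0 ^ (JJ - Suc j) * q0" by simp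
      then show ?thesis by (simp add: sum_distrib_right mult.assoc)
    qed
    finally show ?thesis using True L1 n unfolding GG_def by auto
  qed
qed auto

lemma safe_finish_round:
  "safe A \<tau> (block [vmap 7 0 (RAdd (ent 6) (RDiv eD eN)), NAssign 14 (NConst 0) (NAdd (ncell 14) (NConst 1))]) (5 * U)
     (GG k JJ) (FF (Suc k))"
proof (rule safe_wpc)
  fix s assume lt: "GG k JJ s < 1"
  then have l2: "linv2 k JJ s" unfolding GG_def by (auto split: if_splits)
  from l2 obtain W where W: "hist W k" "logged s" "nats s 14 0 = k" "nats s 15 0 = JJ"
    and r7: "\<And>i. i < n \<Longrightarrow> reals s 7 i = W k i" and r5: "\<And>i. i < n \<Longrightarrow> reals s 5 i = (\<Sum>k'<Suc k. yy W k' i)"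
    and r4: "\<And>i. i < n \<Longrightarrow> reals s 4 i = yy W k i"
    and r6: "\<And>i. i < n \<Longrightarrow> 0 \<le> reals s 6 i" "\<And>i. i < n \<Longrightarrow> reals s 6 i \<le> d"
    and sum6: "(\<Sum>i<n. reals s 6 i) \<le> real JJ * d" by (rule linv2E) (rule that; assumption)
  have inp: "inp s" using W(2) baseD unfolding logged_def by blast
  \<comment> \<open>At \<open>j = JJ\<close> the factor \<open>q0 ^ 0\<close> is \<open>1\<close>
    and \<open>bad\<close> takes the values \<open>0\<close> and \<open>1\<close>, so a bound below
    \<open>1\<close> excludes every bad row.\<close>
  have bad0: "bad s i = 0" if i: "i < n" for i
  proof (rule ccontr)
    assume "bad s i \<noteq> 0"
    then have "1 \<le> bad s i" unfolding bad_def by (auto split: if_splits)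
    also have "\<dots> \<le> (\<Sum>i<n. bad s i)" using i by (intro member_le_sum) (auto simp: bad_def)
    finally have "1 \<le> (\<Sum>i<n. bad s i) * q0 ^ (JJ - JJ) + real (ell - Suc k) * n * q0 ^ JJ"
      using q0_pos by (simp add: add_increasing2)
    then show False using lt l2 unfolding GG_def by simp
  qed
  define W' where "W' = W(Suc k := \<lambda>i. reals s 6 i + real d / real n)"
  have W'_old: "W' k' = W k'" if "k' \<le> k" for k' using that unfolding W'_def by auto
  have W'_new: "W' (Suc k) i = reals s 6 i + real d / real n" for i unfolding W'_def by simp
  have dn0: "0 < real d / real n" "real d / real n \<le> d" using d0 dn by (auto simp: field_simps)
  have "hist W' (Suc k)"
    unfolding hist_def
  proof (intro conjI allI impI)
    fix k' i assume k': "k' \<le> Suc k" and i: "i < n"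
    have "0 < W' k' i \<and> W' k' i \<le> 2 * real d"
    proof (cases "k' = Suc k")
      case True
      then show ?thesis using r6[OF i] dn0 W'_new[of i] by simp
    next
      case False
      then have "k' \<le> k" using k' by simp
      then show ?thesis using W(1) i W'_old[of k'] unfolding hist_def by simp
    qed
    then show "0 < W' k' i" "W' k' i \<le> 2 * real d" by auto
  next
    show "W' 0 i = real d / real n" if "i < n" for i using W(1) that W'_old[of 0] unfolding hist_def by simp
  next
    fix k' assume k': "k' \<le> Suc k"
    show "(\<Sum>i<n. W' k' i) \<le> (real JJ + 1) * d"
    proof (cases "k' = Suc k")
      case True
      have "(\<Sum>i<n. W' k' i) = (\<Sum>i<n. reals s 6 i) + d"
        unfolding True W'_new sum.distrib using n2 by simp
      then show ?thesis using sum6 by (simp add: algebra_simps)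
    next
      case False
      then show ?thesis using W(1) W'_old[of k'] k' unfolding hist_def by auto
    qed
  next
    fix k' i x assume k': "k' < Suc k" and i: "i < n"
    show "yy W' k' i * (mv x i)\<^sup>2 \<le> 74 * W' (Suc k') i * wsq (yy W' k') (mv x)"
    proof (cases "k' = k")
      case False
      then have "k' < k" using k' by simp
      moreover have "yy W' k' = yy W k'" using W'_old[of k'] k' unfolding yy_def by auto
      ultimately show ?thesis using W(1) i W'_old[of "Suc k'"] unfolding hist_def by simp
    next
      case True
      have y4: "reals s 4 i = yy W' k i" if "i < n" for i
        using r4[OF that] W'_old[of k] unfolding yy_def by simp
      have lv: "is_lev (reals s 4) (lev (reals s 4))" by (rule is_lev_lev) (rule linv2_pos[OF l2])
      have wq: "wsq (reals s 4) (mv x) = wsq (yy W' k) (mv x)" by (intro wsq_cong) (simp_all add: y4)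
      have w0: "0 \<le> wsq (yy W' k) (mv x)" by (intro wsq_nonneg) (simp add: yy_def)
      have "yy W' k i * (mv x i)\<^sup>2 \<le> lsc (reals s 4) i * wsq (yy W' k) (mv x)"
      proof -
        have "reals s 4 i * (mv x i)\<^sup>2 \<le> lsc (reals s 4) i * wsq (reals s 4) (mv x)"
          using lv i unfolding is_lev_def lsc_def by blast
        then show ?thesis unfolding wq y4[OF i] .
      qed
      also have "\<dots> \<le> (74 * reals s 6 i) * wsq (yy W' k) (mv x)"
        using bad0[OF i] w0 unfolding bad_def by (intro mult_right_mono) (auto split: if_splits)
      also have "\<dots> \<le> 74 * W' (Suc k) i * wsq (yy W' k) (mv x)"
        unfolding W'_new using dn0 w0 by (intro mult_right_mono mult_left_mono) auto
      finally show ?thesis unfolding True .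
    qed
  qed
  then have post: "FF (Suc k) s' \<le> GG k JJ s"
    if "\<And>a. a \<noteq> 10 \<Longrightarrow> a \<noteq> 14 \<Longrightarrow> nats s' a = nats s a" "nats s' 14 0 = Suc k"
      "\<And>a. a \<noteq> 7 \<Longrightarrow> reals s' a = reals s a" "\<And>i. i < n \<Longrightarrow> reals s' 7 i = W' (Suc k) i" for s'
  proof -
    have "logged s'" by (rule logged_cong[OF W(2)]) (use that in auto)
    moreover have "(\<Sum>k'<Suc k. yy W' k' i) = (\<Sum>k'<Suc k. yy W k' i)" for i
      using W'_old by (intro sum.cong) (auto simp: yy_def)
    ultimately have "linv (Suc k) s'"
      unfolding linv_def using \<open>hist W' (Suc k)\<close>
      by (intro exI[of _ W'] conjI allI impI) (simp_all add: that r5)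
    then show ?thesis using l2 bad0 unfolding FF_def GG_def by simp
  qed
  show "wpc A \<tau> (block [vmap 7 0 (RAdd (ent 6) (RDiv eD eN)), NAssign 14 (NConst 0) (NAdd (ncell 14) (NConst 1))])
      (5 * U) s (\<lambda>s'. FF (Suc k) s' \<le> GG k JJ s)"
    apply (rule wp_block, rule wp_block_Cons, rule wp_vmap[OF inp, where g = "W' (Suc k)" and m = n], simp, simp)
    subgoal premises s' for i s' using s' inpD[OF inp] W'_new by simp
    subgoal premises s1 for s1
      apply (rule wp_block_Cons, rule wp_NAssign, rule wp_block_Nil)
      subgoal premises s2 for s2 by (rule post) (use s2 s1 W(3) in auto)
      done
    by simp
qed

lemma safe_round:
  "safe A \<tau> p_round ((18 * JJ + 18) * U) (\<lambda>s. if bval (NLess (ncell 14) (ncell 12)) s then FF k s else 1) (FF (Suc k))"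
proof -
  have "safe A \<tau> (While (NLess (ncell 15) (ncell 13)) (Seq (forl 0 (Flip 3 (ncell 10))) p_sample))
      (JJ * (17 * U + 1) + 1) (GG k 0) (GG k JJ)"
  proof (rule safe_While)
    show "safe A \<tau> (Seq (forl 0 (Flip 3 (ncell 10))) p_sample) (17 * U)
      (\<lambda>s. if bval (NLess (ncell 15) (ncell 13)) s then GG k j s else 1) (GG k (Suc j))" if "j < JJ" for j
      by (rule safe_sample[OF that])
    fix j s assume "j \<le> JJ" and b: "\<not> bval (NLess (ncell 15) (ncell 13)) s"
    show "GG k JJ s \<le> GG k j s"
    proof (cases "linv2 k j s")
      case True
      then have "j = JJ" using b \<open>j \<le> JJ\<close> unfolding linv2_def logged_def by auto
      then show ?thesis by simp
    qed (simp add: GG_def)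
  next
    fix s assume b: "bval (NLess (ncell 15) (ncell 13)) s"
    then have "\<not> linv2 k JJ s" unfolding linv2_def logged_def by auto
    then show "1 \<le> GG k JJ s" unfolding GG_def by simp
  qed
  from safe_Seq[OF safe_start safe_Seq[OF this safe_finish_round]]
  have "safe A \<tau> p_round (9 * U + (JJ * (17 * U + 1) + 1 + 5 * U + 1) + 1)
    (\<lambda>s. if bval (NLess (ncell 14) (ncell 12)) s then FF k s else 1) (FF (Suc k))"
    unfolding p_round_def .
  then show ?thesis
  proof (rule safe_mono)
    have "JJ * (17 * U + 1) \<le> JJ * (18 * U)" using U_pos by (intro mult_le_mono2) simp
    then have "9 * U + (JJ * (17 * U + 1) + 1 + 5 * U + 1) + 1 \<le> JJ * (18 * U) + 18 * U" using U_pos by linarith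
    also have "\<dots> = (18 * JJ + 18) * U" by (simp add: algebra_simps)
    finally show "9 * U + (JJ * (17 * U + 1) + 1 + 5 * U + 1) + 1 \<le> (18 * JJ + 18) * U" .
  qed auto
qed

definition lewis_post :: "store \<Rightarrow> bool" where
  "lewis_post s \<longleftrightarrow> logged s \<and> (\<forall>i<n. 0 < reals s 5 i) \<and> hb p (reals s 5) 1 \<and>
     (\<forall>x. pw p (mv x) powr (2 / p) \<le> (296 * ((real JJ + 1) * d)) powr ((p - 2) / p) * wsq (reals s 5) (mv x))"

lemma safe_normalize:
  "safe A \<tau> (block [vmap 5 0 (RDiv (ent 5) (RMul (ROfNat (ncell 12))
      (Rpow (RMul (RAdd (ROfNat (ncell 13)) (rnum 1)) eD) (RDiv (RSub eP (rnum 2)) eP))))]) (3 * U)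
     (FF ell) (\<lambda>s. if lewis_post s then 0 else 1)"
proof (rule safe_wpc)
  fix s assume "FF ell s < 1"
  then have "linv ell s" unfolding FF_def by (auto split: if_splits)
  then obtain W where W: "hist W ell" "logged s"
    and r: "\<And>i. i < n \<Longrightarrow> reals s 5 i = (\<Sum>k'<ell. yy W k' i)"
    unfolding linv_def by blast
  have inp: "inp s" using W(2) baseD unfolding logged_def by blast
  have FF0: "FF ell s = 0" using \<open>linv ell s\<close> unfolding FF_def by simp
  define B where "B = (real JJ + 1) * d"
  define E where "E = (p - 2) / p"
  define V where "V i = (\<Sum>k<ell. yy W k i) / ell" for i
  have B0: "0 < B" unfolding B_def using d0 by (intro mult_pos_pos) auto
  have Wpos: "0 < W k i" if "k \<le> ell" "i < n" for k i using W(1) that unfolding hist_def by blast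
  have yy: "yy W k i = W k i powr ((p - 2) / p)" for k i by (rule yy_def)
  have ell0: "0 < ell" using ell(3) by simp
  have hbV: "hb p V (B powr E)"
    unfolding E_def
    by (rule lewis_hb[where w = W and y = "yy W" and K = ell])
      (use W(1) Wpos B0 p ell0 in \<open>auto simp: V_def yy B_def hist_def\<close>)
  have normV: "pw p (mv x) powr (2 / p) \<le> 296 powr E * wsq V (mv x)" for x
    unfolding E_def
  proof (rule lewis_norm[where w = W and y = "yy W" and K = ell])
    fix i assume i: "i < n"
    \<comment> \<open>Weights start at \<open>d / n\<close> and never exceed \<open>2 * d\<close>, a
      ratio of at most \<open>2 * n\<close>; this fixes the number of rounds, since
      \<open>ell\<close> of them make it at most \<open>4 ^ ell\<close>.\<close>
    have "2 * n \<le> 2 * 2 ^ ell" using ell(1) by simp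
    also have "\<dots> \<le> 2 ^ ell * 2 ^ ell"
      using power_increasing[OF ell(3), of "2::nat"] by (intro mult_le_mono1) simp
    also have "\<dots> = (4::nat) ^ ell" by (simp flip: power_mult_distrib)
    finally have "real (2 * n) \<le> real (4 ^ ell)" by (simp only: of_nat_le_iff)
    then have "2 * real n * (real d / real n) \<le> 4 ^ ell * (real d / real n)"
      by (intro mult_right_mono) auto
    then have "2 * real d \<le> 4 ^ ell * W 0 i" using W(1) i n2 unfolding hist_def by simp
    moreover have "W ell i \<le> 2 * real d" using W(1) i unfolding hist_def by simp
    ultimately show "W ell i \<le> 4 ^ ell * W 0 i" by linarith
  qed (use W(1) Wpos p ell0 in \<open>auto simp: V_def yy hist_def\<close>)
  have post: "lewis_post s'"
    if nats: "\<And>a. a \<noteq> 10 \<Longrightarrow> nats s' a = nats s a" and reals: "\<And>a. a \<noteq> 5 \<Longrightarrow> reals s' a = reals s a"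
      and r5: "\<And>i. i < n \<Longrightarrow> reals s' 5 i = 1 / B powr E * V i" for s'
    unfolding lewis_post_def
  proof (intro conjI allI impI)
    show "logged s'" by (rule logged_cong[OF W(2)]) (use nats reals in auto)
    fix i assume i: "i < n"
    have "0 < yy W k i" if "k < ell" for k using Wpos[of k i] that i unfolding yy_def by simp
    then have "0 < V i" unfolding V_def using ell0 by (intro divide_pos_pos sum_pos) auto
    then show "0 < reals s' 5 i" unfolding r5[OF i] using B0 by simp
  next
    have "hb p (\<lambda>i. 1 / B powr E * V i) (1 / B powr E * B powr E)" by (rule hb_scale[OF hbV]) simp
    then show "hb p (reals s' 5) 1"
      using B0 hb_cong[of "reals s' 5" "\<lambda>i. 1 / B powr E * V i" p] r5 by simp
  next
    fix x
    have "wsq (reals s' 5) (mv x) = 1 / B powr E * wsq V (mv x)"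
      unfolding wsq_scale_left[symmetric] by (intro wsq_cong) (simp_all add: r5)
    then have "(296 * B) powr E * wsq (reals s' 5) (mv x) = 296 powr E * wsq V (mv x)"
      using B0 by (simp add: powr_mult)
    then show "pw p (mv x) powr (2 / p) \<le> (296 * ((real JJ + 1) * d)) powr ((p - 2) / p) * wsq (reals s' 5) (mv x)"
      using normV[of x] unfolding B_def E_def by simp
  qed
  show "wpc A \<tau> (block [vmap 5 0 (RDiv (ent 5) (RMul (ROfNat (ncell 12))
      (Rpow (RMul (RAdd (ROfNat (ncell 13)) (rnum 1)) eD) (RDiv (RSub eP (rnum 2)) eP))))]) (3 * U) s
      (\<lambda>s'. (if lewis_post s' then 0 else 1) \<le> FF ell s)"
    apply (rule wp_block, rule wp_block_Cons, rule wp_vmap[OF inp, where g = "\<lambda>i. 1 / B powr E * V i" and m = n], simp, simp)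
    subgoal premises s' for i s'
      using s' inpD[OF inp] W(2) r[OF s'(1)] B0 unfolding logged_def B_def E_def V_def
      by (simp add: rval_Rpow less_imp_le)
    subgoal premises s1 for s1
      apply (rule wp_block_Nil)
      using post[of s1] s1 FF0 by simp
    by simp
qed

definition lewis_time :: nat where
  "lewis_time = (ell * (18 * JJ + 27) + 27) * U"

text \<open>Union bound over \<open>ell\<close> rounds and \<open>n\<close> rows, each pair
  contributing \<open>q0 ^ JJ\<close>.\<close>

lemma safe_lewis:
  "safe A \<tau> (p_lewis cc) lewis_time (\<lambda>s. if base s then real ell * n * q0 ^ JJ else 1)
     (\<lambda>s. if lewis_post s then 0 else 1)"
proof -
  let ?\<omega> = "\<lambda>s. if logged s then real ell * n * q0 ^ JJ else 1"
  have 1: "safe A \<tau> (p_log cc) (7 * U + (ell * (7 * U + 1) + 1) + 1) (\<lambda>s. if base s then real ell * n * q0 ^ JJ else 1) ?\<omega>"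
  proof (rule safe_wpc)
    fix s assume "(if base s then real ell * n * q0 ^ JJ else 1) < 1"
    then have "base s" by (auto split: if_splits)
    from wp_log[OF this] show "wpc A \<tau> (p_log cc) (7 * U + (ell * (7 * U + 1) + 1) + 1) s
      (\<lambda>s'. ?\<omega> s' \<le> (if base s then real ell * n * q0 ^ JJ else 1))"
      by (rule wpc_mono) (use \<open>base s\<close> in auto)
  qed
  have 2: "safe A \<tau> (block [vmap 7 0 (RDiv eD eN), vmap 5 0 (rnum 0), NAssign 14 (NConst 0) (NConst 0)]) (7 * U) ?\<omega> (FF 0)"
  proof (rule safe_wpc)
    fix s assume "?\<omega> s < 1"
    then have log: "logged s" by (auto split: if_splits)
    have inp: "inp s" using log baseD unfolding logged_def by blast
    have post: "FF 0 s' \<le> ?\<omega> s"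
      if "\<And>a. a \<noteq> 10 \<Longrightarrow> a \<noteq> 14 \<Longrightarrow> nats s' a = nats s a" "nats s' 14 0 = 0"
        "\<And>a. a \<noteq> 7 \<Longrightarrow> a \<noteq> 5 \<Longrightarrow> reals s' a = reals s a"
        "\<And>i. i < n \<Longrightarrow> reals s' 7 i = real d / real n" "\<And>i. i < n \<Longrightarrow> reals s' 5 i = 0" for s'
    proof -
      have "logged s'" by (rule logged_cong[OF log]) (use that in auto)
      moreover have "hist (\<lambda>_ _. real d / real n) 0"
        unfolding hist_def using d0 dn n2 by (auto simp: field_simps)
      ultimately have "linv 0 s'" unfolding linv_def
        by (intro exI[of _ "\<lambda>_ _. real d / real n"] conjI allI impI) (simp_all add: that)
      then show ?thesis using log unfolding FF_def by simp
    qed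
    show "wpc A \<tau> (block [vmap 7 0 (RDiv eD eN), vmap 5 0 (rnum 0), NAssign 14 (NConst 0) (NConst 0)]) (7 * U) s
       (\<lambda>s'. FF 0 s' \<le> ?\<omega> s)"
      apply (rule wp_block, rule wp_block_Cons, rule wp_vmap[OF inp, where g = "\<lambda>_. real d / real n" and m = n], simp, simp)
      subgoal premises s' for i s' using s' inpD[OF inp] by simp
      subgoal premises s1 for s1
      proof -
        have inp1: "inp s1" by (rule inp_cong[OF inp]) (use s1 in auto)
        show ?thesis
          apply (rule wp_block_Cons, rule wp_vmap[OF inp1, where g = "\<lambda>_. 0" and m = n], simp, simp, simp)
          subgoal premises s2 for s2
            apply (rule wp_block_Cons, rule wp_NAssign, rule wp_block_Nil)
            subgoal premises s3 for s3 by (rule post) (use s3 s2 s1 in auto)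
            done
          done
      qed
      by simp
  qed
  have 3: "safe A \<tau> (While (NLess (ncell 14) (ncell 12)) p_round) (ell * ((18 * JJ + 18) * U + 1) + 1) (FF 0) (FF ell)"
  proof (rule safe_While)
    show "safe A \<tau> p_round ((18 * JJ + 18) * U) (\<lambda>s. if bval (NLess (ncell 14) (ncell 12)) s then FF k s else 1) (FF (Suc k))" for k
      by (rule safe_round)
    fix k s assume "k \<le> ell" and b: "\<not> bval (NLess (ncell 14) (ncell 12)) s"
    show "FF ell s \<le> FF k s"
    proof (cases "linv k s")
      case True
      then have "k = ell" using b \<open>k \<le> ell\<close> unfolding linv_def logged_def by auto
      then show ?thesis by simp
    qed (simp add: FF_def)
  next
    fix s assume b: "bval (NLess (ncell 14) (ncell 12)) s"
    then have "\<not> linv ell s" unfolding linv_def logged_def by auto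
    then show "1 \<le> FF ell s" unfolding FF_def by simp
  qed
  have "safe A \<tau> (p_lewis cc)
      ((7 * U + (ell * (7 * U + 1) + 1) + 1) + ((7 * U) + ((ell * ((18 * JJ + 18) * U + 1) + 1) + (3 * U) + 1) + 1) + 1)
      (\<lambda>s. if base s then real ell * n * q0 ^ JJ else 1) (\<lambda>s. if lewis_post s then 0 else 1)"
    unfolding p_lewis_def by (rule safe_Seq[OF 1 safe_Seq[OF 2 safe_Seq[OF 3 safe_normalize]]])
  then show ?thesis
  proof (rule safe_mono)
    have "ell * (7 * U + 1) \<le> ell * (8 * U)" using U_pos by (intro mult_le_mono2) simp
    moreover have "ell * ((18 * JJ + 18) * U + 1) \<le> ell * ((18 * JJ + 19) * U)"
      using U_pos by (intro mult_le_mono2) (simp add: algebra_simps)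
    ultimately have "(7 * U + (ell * (7 * U + 1) + 1) + 1) + ((7 * U) + ((ell * ((18 * JJ + 18) * U + 1) + 1) + (3 * U) + 1) + 1) + 1
      \<le> ell * (8 * U) + ell * ((18 * JJ + 19) * U) + 17 * U + 6" by linarith
    also have "\<dots> \<le> ell * (8 * U) + ell * ((18 * JJ + 19) * U) + 27 * U" using U_pos by simp
    also have "\<dots> = lewis_time" unfolding lewis_time_def by (simp add: algebra_simps)
    finally show "(7 * U + (ell * (7 * U + 1) + 1) + 1) + ((7 * U) + ((ell * ((18 * JJ + 18) * U + 1) + 1) + (3 * U) + 1) + 1) + 1
      \<le> lewis_time" .
  qed auto
qed

end

section \<open>The refinement program\<close>

abbreviation eA :: rexp where "eA \<equiv> rcell 25"
abbreviation eC :: rexp where "eC \<equiv> RMul eP (Rpow (rnum 2) eP)"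
abbreviation eRoot :: rexp where "eRoot \<equiv> Rpow eA (RDiv (rnum 1) eP)"

definition p_init :: com where
  "p_init = block [
     vmap 4 0 (rnum 1),
     scatter 8 1 2 1 1,
     Solve 4 8 3,
     scatter 12 0 1 2 3,
     vmap 12 0 (RSub (ent 12) (ent 1)),
     vsum 13 0 (Rabs (ent 12) eP)]"

text \<open>One program serves all \<open>p\<close>, so the constants depending on \<open>p\<close>
  are evaluated at run time: distortion, number of steps, step length, width threshold, refinement
  step size. The first gap bound is the objective value itself.\<close>

definition p_consts :: com where
  "p_consts = block [
     RAssign 26 (NConst 0) (Rpow (RMul (rnum 296) (RMul (RAdd (ROfNat (ncell 13)) (rnum 1)) eD)) (RDiv (RSub eP (rnum 2)) eP)),
     RAssign 27 (NConst 0) (RAdd (rnum 1) (Rpow (rcell 26) (RDiv eP (RSub (RMul (rnum 3) eP) (rnum 2))))),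
     RAssign 28 (NConst 0) (RDiv (rnum 1) (RMul (RMul (rnum 16) eC) (rcell 27))),
     RAssign 29 (NConst 0) (Rpow (RMul (RMul (rnum 16) eC) (rcell 27)) (RSub eP (rnum 1))),
     RAssign 30 (NConst 0) (RDiv (Rpow (rnum 2) (RSub (rnum 0) eP))
        (RMul (RMul (rnum 2) (RMul (RMul eP eP) (Rpow (rnum 2) eP))) (RAdd (rnum 4) (Rpow (RMul (rnum 32) eC) eP)))),
     RAssign 14 (NConst 0) (rcell 13)]"

definition p_mwu_init :: com where
  "p_mwu_init = block [
     vmap 16 0 (Rabs (ent 12) (RSub eP (rnum 2))),
     vmap 17 0 (rnum 0),
     vmap 18 0 (rnum 0),
     vmap 19 1 (rnum 0),
     NAssign 17 (NConst 0) (NConst 0),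
     NAssign 16 (NConst 0) (NConst 0),
     vmap 10 0 (RMul eP (RMul (ent 16) (ent 12))),
     scatter 20 1 2 1 10,
     RAssign 25 (NConst 0) (RDiv (RMul (rnum 2) (Rpow (rnum 2) (RSub (rnum 0) eP))) (rcell 14))]"

text \<open>The solution is rescaled to inner product \<open>\<nu> / 2\<close> with the gradient;
  array \<open>21\<close> receives the quantity \<open>t\<close> that decides between the two kinds
  of steps.\<close>

definition p_solve :: com where
  "p_solve = block [
     vmap 4 0 (RAdd (RMul eA (ent 16)) (RMul (Rpow eA (RDiv (rnum 2) eP))
        (RAdd (RAdd (ent 5) (ent 17)) (Rpow (ent 18) (RSub eP (rnum 2)))))),
     Solve 4 20 9,
     vsum 11 1 (RMul (ent 20) (ent 9)),
     vmap 9 1 (RDiv (RMul (ent 9) (RDiv (rcell 14) (rnum 2))) (rcell 11)),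
     scatter 10 0 1 2 9,
     vsum 21 0 (Rabs (ent 10) eP),
     RAssign 21 (NConst 0) (RMul eA (rcell 21))]"

definition p_width :: com where
  "p_width = block [vmap 17 0 (RAdd (ent 17) (RMul
     (RDiv (rnum 1) (RMul (rcell 26) (Rpow (rcell 21) (RDiv (RSub eP (rnum 2)) eP))))
     (Rpow (RMul eRoot (Rabs (ent 10) (rnum 1))) (RSub eP (rnum 2)))))]"

definition p_primal :: com where
  "p_primal = block [
     vmap 18 0 (RAdd (ent 18) (RMul (rcell 28) (RMul eRoot (Rabs (ent 10) (rnum 1))))),
     vmap 19 1 (RAdd (ent 19) (ent 9)),
     NAssign 17 (NConst 0) (NAdd (ncell 17) (NConst 1))]"

definition p_mwu :: com where
  "p_mwu = While (RLess (ROfNat (ncell 16)) (rcell 27))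
     (Seq p_solve (Seq (Cond (RLess (rcell 29) (rcell 21)) p_width p_primal)
       (block [NAssign 16 (NConst 0) (NAdd (ncell 16) (NConst 1))])))"

text \<open>The average is over primal steps. If the gap was overestimated, nothing excludes that
  there are none; division by zero then gives \<open>0\<close>, and the candidate is the current
  point.\<close>

definition p_candidate :: com where
  "p_candidate = block [
     vmap 22 1 (RSub (ent 3) (RMul (rcell 30) (RDiv (ent 19) (ROfNat (ncell 17))))),
     scatter 23 0 1 2 22,
     vmap 23 0 (RSub (ent 23) (ent 1)),
     vsum 24 0 (Rabs (ent 23) eP)]"

definition p_accept :: com where
  "p_accept = Cond (RLess (rcell 24) (rcell 13))
     (block [vmap 3 1 (ent 22), vmap 12 0 (ent 23), RAssign 13 (NConst 0) (rcell 24)]) SKIP"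

text \<open>The loop stops at \<open>\<nu> \<le> \<epsilon> / (1 + \<epsilon>) * f\<close>, which
  for a gap of at most \<open>\<nu>\<close> means that \<open>f\<close> is at most
  \<open>1 + \<epsilon>\<close> times the optimum. The bound \<open>\<nu>\<close> shrinks in every
  pass, whether or not the candidate is accepted.\<close>

definition p_refine :: com where
  "p_refine = While (RLess (RMul (RDiv (RRead 0 (NConst 1)) (RAdd (rnum 1) (RRead 0 (NConst 1)))) (rcell 13)) (rcell 14))
     (Seq p_mwu_init (Seq p_mwu (Seq p_candidate (Seq p_accept
       (block [RAssign 14 (NConst 0) (RMul (rcell 14) (RSub (rnum 1) (RDiv (rcell 30) (rnum 4))))])))))"

text \<open>For \<open>p = 2\<close> the least squares solution is already optimal.\<close>

definition p_main :: "nat \<Rightarrow> com" where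
  "p_main cc = Seq p_init
     (Cond (RLess (rnum 2) eP) (Seq (p_lewis cc) (Seq p_consts p_refine)) SKIP)"

context regression
begin

lemma rinpD:
  assumes "inp s"
  shows "nats s 0 0 = n" "nats s 0 (Suc 0) = d" "reals s 0 0 = p" "reals s 0 (Suc 0) = \<epsilon>"
    "\<And>i. i < n \<Longrightarrow> reals s 1 i = b $ i" "\<And>i. i < n \<Longrightarrow> reals s (Suc 0) i = b $ i"
  using assms unfolding inp_def by auto

definition ff :: "(nat \<Rightarrow> real) \<Rightarrow> real" where
  "ff x = pw p (\<lambda>i. mv x i - b $ i)"

lemma ff_cong: "(\<And>j. j < d \<Longrightarrow> x j = y j) \<Longrightarrow> ff x = ff y"
  unfolding ff_def using mv_cong[of x y] by (intro pw_cong) simp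

lemma ff_nonneg: "0 \<le> ff x"
  unfolding ff_def by (rule pw_nonneg)

definition least_squares :: "(nat \<Rightarrow> real) \<Rightarrow> bool" where
  "least_squares x \<longleftrightarrow> (\<forall>x'. (\<Sum>i<n. (mv x i - b $ i)\<^sup>2) \<le> (\<Sum>i<n. (mv x' i - b $ i)\<^sup>2))"

text \<open>The normal equations make the residual orthogonal to the range of the matrix.\<close>

lemma nsol_least_squares:
  assumes "nsol (\<lambda>_. 1) (mt (\<lambda>i. b $ i)) x"
  shows "least_squares x"
  unfolding least_squares_def
proof
  fix x'
  let ?h = "\<lambda>j. x' j - x j"
  have "dot (mt (\<lambda>i. b $ i)) ?h = (\<Sum>i<n. mv x i * mv ?h i)" using nsol_dot[OF assms] by simp
  then have orth: "(\<Sum>i<n. (mv x i - b $ i) * mv ?h i) = 0"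
    unfolding dot_mt by (simp add: left_diff_distrib sum_subtractf)
  have "(\<Sum>i<n. (mv x' i - b $ i)\<^sup>2)
    = (\<Sum>i<n. (mv x i - b $ i)\<^sup>2 + 2 * ((mv x i - b $ i) * mv ?h i) + (mv ?h i)\<^sup>2)"
    by (intro sum.cong refl) (simp add: mv_diff power2_eq_square algebra_simps)
  also have "\<dots> = (\<Sum>i<n. (mv x i - b $ i)\<^sup>2) + (\<Sum>i<n. (mv ?h i)\<^sup>2)"
    unfolding sum.distrib sum_distrib_left[symmetric] orth by simp
  finally show "(\<Sum>i<n. (mv x i - b $ i)\<^sup>2) \<le> (\<Sum>i<n. (mv x' i - b $ i)\<^sup>2)"
    by (simp add: sum_nonneg)
qed

definition current :: "store \<Rightarrow> bool" where
  "current s \<longleftrightarrow> (\<forall>i<n. reals s 12 i = mv (reals s 3) i - b $ i) \<and> reals s 13 0 = ff (reals s 3)"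

lemma wp_init:
  assumes inp: "inp s"
  shows "wpc A \<tau> p_init (13 * U) s (\<lambda>s'. inp s' \<and> current s' \<and> least_squares (reals s' 3))"
  unfolding p_init_def
  apply (rule wp_block, rule wp_block_Cons, rule wp_vmap[OF inp, where g = "\<lambda>_. 1" and m = n], simp, simp, simp)
  subgoal premises s1 for s1
  proof -
    have inp1: "inp s1" by (rule inp_cong[OF inp]) (use s1 in auto)
    show ?thesis
      apply (rule wp_block_Cons, rule wp_mulAT[OF inp1], simp, simp)
      subgoal premises s2 for s2
        apply (rule wp_block_Cons, rule wp_Solve)
        subgoal premises i for i using i s2 s1 by simp
        subgoal premises s3 for s3 z
        proof -
          have inp3: "inp s3" by (rule inp_cong[OF inp1]) (use s2 s3 in auto)
          have "nsol (\<lambda>_. 1) (mt (\<lambda>i. b $ i)) z"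
          proof -
            have "mt (\<lambda>i. reals s2 4 i * mv z i) j = mt (\<lambda>i. 1 * mv z i) j" for j
              unfolding mt_def using s1 s2 by (intro sum.cong) auto
            moreover have "reals s2 8 j = mt (\<lambda>i. b $ i) j" if "j < d" for j
            proof -
              have "reals s2 8 j = mt (reals s1 1) j" using s2 that by simp
              also have "\<dots> = mt (\<lambda>i. b $ i) j"
                unfolding mt_def by (intro sum.cong refl) (simp add: rinpD[OF inp1])
              finally show ?thesis .
            qed
            ultimately show ?thesis using s3(1) unfolding nsol_def by simp
          qed
          then have ls: "least_squares z" by (rule nsol_least_squares)
          have mvz: "mv (reals s3 3) i = mv z i" for i using s3 by (intro mv_cong) simp
          show ?thesis
            apply (rule wp_block_Cons, rule wp_mulA[OF inp3], simp, simp)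
            subgoal premises s4 for s4
            proof -
              have inp4: "inp s4" by (rule inp_cong[OF inp3]) (use s4 in auto)
              show ?thesis
                apply (rule wp_block_Cons, rule wp_vmap[OF inp4, where g = "\<lambda>i. mv z i - b $ i" and m = n], simp, simp)
                subgoal premises s' for i s'
                  using s' s4 s'(1) mvz rinpD[OF inp4] by simp
                subgoal premises s5 for s5
                proof -
                  have inp5: "inp s5" by (rule inp_cong[OF inp4]) (use s5 in auto)
                  show ?thesis
                    apply (rule wp_block_Cons, rule wp_vsum[OF inp5, where g = "\<lambda>i. \<bar>mv z i - b $ i\<bar> powr p" and m = n], simp, simp)
                    subgoal premises s' for i s' x
                      using s' s5 rinpD[OF inp5] by simp
                    subgoal premises s6 for s6
                    proof (rule wp_block_Nil, intro conjI)
                      show "inp s6" by (rule inp_cong[OF inp5]) (use s6 in auto)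
                      have r3: "reals s6 3 = reals s3 3" using s6 s5 s4 by simp
                      have ffz: "ff (reals s6 3) = (\<Sum>i<n. \<bar>mv z i - b $ i\<bar> powr p)"
                        unfolding r3 ff_def pw_def mvz ..
                      have "reals s6 13 0 = ff (reals s6 3)" unfolding ffz using s6 by simp
                      moreover have "reals s6 12 i = mv (reals s6 3) i - b $ i" if "i < n" for i
                        unfolding r3 mvz using s6 s5 that by simp
                      ultimately show "current s6" unfolding current_def by simp
                      show "least_squares (reals s6 3)" using ls unfolding least_squares_def r3 mvz .
                    qed
                    done
                qed
                done
            qed
            done
        qed
        done
      done
  qed
  by simp

end

context lewis_run
begin

definition Lam :: real where "Lam = (296 * ((real JJ + 1) * d)) powr ((p - 2) / p)"
text \<open>The power of \<open>Lam\<close> is the least value allowed by the second inequality of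
  \<open>Iot_ge\<close>; the added \<open>1\<close> secures the first.\<close>

definition Iot :: real where "Iot = 1 + Lam powr (p / (3 * p - 2))"
text \<open>The step size of \<open>refinement_progress\<close> for
  \<open>\<kappa> = (32 * Cp) powr p\<close>, the bound that \<open>minv_final\<close>
  delivers.\<close>

definition stp :: real where
  "stp = 2 powr (- p) / (2 * (p\<^sup>2 * 2 powr p) * (4 + (32 * (p * 2 powr p)) powr p))"

definition consts_ok :: "store \<Rightarrow> bool" where
  "consts_ok s \<longleftrightarrow> reals s 26 0 = Lam \<and> reals s 27 0 = Iot \<and> reals s 28 0 = 1 / (16 * (p * 2 powr p) * Iot) \<and>
     reals s 29 0 = (16 * (p * 2 powr p) * Iot) powr (p - 1) \<and> reals s 30 0 = stp"

definition r0ok :: "(nat \<Rightarrow> real) \<Rightarrow> bool" where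
  "r0ok r \<longleftrightarrow> (\<forall>i<n. 0 < r i) \<and> hb p r 1 \<and> (\<forall>x. pw p (mv x) powr (2 / p) \<le> Lam * wsq r (mv x))"

lemma Lam_pos: "0 < Lam"
proof -
  have "0 < 296 * ((real JJ + 1) * d)" using d0 by (intro mult_pos_pos) auto
  then show ?thesis unfolding Lam_def by (metis powr_gt_zero less_irrefl)
qed

lemma Iot_ge: "1 \<le> Iot" "Lam \<le> Iot powr ((3 * p - 2) / p)"
proof -
  show "1 \<le> Iot" unfolding Iot_def by simp
  have e: "p / (3 * p - 2) * ((3 * p - 2) / p) = 1" using p by simp
  have "Lam = (Lam powr (p / (3 * p - 2))) powr ((3 * p - 2) / p)"
    unfolding powr_powr e using Lam_pos by simp
  also have "\<dots> \<le> Iot powr ((3 * p - 2) / p)"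
    unfolding Iot_def using p by (intro powr_mono2) auto
  finally show "Lam \<le> Iot powr ((3 * p - 2) / p)" .
qed

lemma stp_bounds: "0 < stp" "stp \<le> 1"
proof -
  have "(2::real) powr (- p) \<le> 2 powr 0" using p by (intro powr_mono) auto
  then have num: "2 powr (- p) \<le> (1::real)" by simp
  have "1 \<le> 2 powr p" using p by (intro ge_one_powr_ge_zero) auto
  moreover have "1 \<le> p\<^sup>2" using p by (intro one_le_power) auto
  ultimately have "1 * 1 \<le> p\<^sup>2 * 2 powr p" by (intro mult_mono) auto
  then have "1 * 1 \<le> (2 * (p\<^sup>2 * 2 powr p)) * (4 + (32 * (p * 2 powr p)) powr p)"
    by (intro mult_mono) (auto simp: add_increasing2)
  then have den: "1 \<le> 2 * (p\<^sup>2 * 2 powr p) * (4 + (32 * (p * 2 powr p)) powr p)" by simp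
  show "0 < stp" unfolding stp_def using den by (intro divide_pos_pos) auto
  have "stp \<le> 1 / 1" unfolding stp_def using num den by (intro frac_le) auto
  then show "stp \<le> 1" by simp
qed

lemma wp_consts:
  assumes "logged s" "r0ok (reals s 5)" "current s" "least_squares (reals s 3)"
  shows "wpc A \<tau> p_consts (13 * U) s (\<lambda>s'. inp s' \<and> consts_ok s' \<and> r0ok (reals s' 5) \<and> current s' \<and>
    least_squares (reals s' 3) \<and> reals s' 14 0 = ff (reals s' 3))"
proof -
  have inp: "inp s" and J: "nats s 13 0 = JJ" using assms(1) baseD unfolding logged_def by auto
  have B0: "0 \<le> 296 * ((real JJ + 1) * d)" by (intro mult_nonneg_nonneg) auto
  have B1: "0 \<le> 16 * (p * 2 powr p) * Iot" "0 \<le> 32 * (p * 2 powr p)"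
    using p Iot_ge by (auto intro!: mult_nonneg_nonneg)
  have L0: "0 \<le> Lam" using Lam_pos by simp
  show ?thesis
    unfolding p_consts_def
    apply (rule wp_block)
    apply (rule wp_block_Cons, rule wp_RAssign)
    apply (rule wp_block_Cons, rule wp_RAssign)
    apply (rule wp_block_Cons, rule wp_RAssign)
    apply (rule wp_block_Cons, rule wp_RAssign)
    apply (rule wp_block_Cons, rule wp_RAssign)
    apply (rule wp_block_Cons, rule wp_RAssign)
    apply (rule wp_block_Nil)
    subgoal premises st for s1 s2 s3 s4 s5 s6
    proof -
      note ip = rinpD[OF inp]
      have r26: "reals s1 26 0 = Lam"
        unfolding st(2) Lam_def using ip J B0 by (simp add: rval_Rpow)
      have a1: "reals s1 a = reals s a" if "a \<noteq> 26" for a using st(2) that by simp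
      have r27: "reals s2 27 0 = Iot"
        unfolding st(4) Iot_def using ip r26 L0 a1 by (simp add: rval_Rpow)
      have a2: "reals s2 a = reals s1 a" if "a \<noteq> 27" for a using st(4) that by simp
      have r28: "reals s3 28 0 = 1 / (16 * (p * 2 powr p) * Iot)"
        unfolding st(6) using ip r27 a1 a2 by (simp add: rval_Rpow)
      have a3: "reals s3 a = reals s2 a" if "a \<noteq> 28" for a using st(6) that by simp
      have r29: "reals s4 29 0 = (16 * (p * 2 powr p) * Iot) powr (p - 1)"
        unfolding st(8) using ip r27 a1 a2 a3 B1 by (simp add: rval_Rpow)
      have a4: "reals s4 a = reals s3 a" if "a \<noteq> 29" for a using st(8) that by simp
      have r30: "reals s5 30 0 = stp"
        unfolding st(10) stp_def using ip a1 a2 a3 a4 B1 by (simp add: rval_Rpow power2_eq_square)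
      have a5: "reals s5 a = reals s4 a" if "a \<noteq> 30" for a using st(10) that by simp
      have r14: "reals s6 14 0 = reals s 13 0"
        unfolding st(12) using a1 a2 a3 a4 a5 by simp
      have a6: "reals s6 a = reals s5 a" if "a \<noteq> 14" for a using st(12) that by simp
      have "inp s6" by (rule inp_cong[OF inp]) (use st a1 a2 a3 a4 a5 a6 in auto)
      moreover have "consts_ok s6" unfolding consts_ok_def
        using r26 r27 r28 r29 r30 a2 a3 a4 a5 a6 by simp
      moreover have "reals s6 5 = reals s 5" "reals s6 3 = reals s 3" "reals s6 12 = reals s 12" "reals s6 13 = reals s 13"
        using a1 a2 a3 a4 a5 a6 by simp_all
      ultimately show ?thesis using assms r14 unfolding current_def by simp
    qed
    by simp
qed

section \<open>The inner loop on the machine\<close>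

lemma nsol_cong:
  assumes "\<And>i. i < n \<Longrightarrow> V i = W i"
  shows "nsol V h z \<longleftrightarrow> nsol W h z"
proof -
  have "mt (\<lambda>i. V i * mv z i) j = mt (\<lambda>i. W i * mv z i) j" for j
    unfolding mt_def using assms by (intro sum.cong) auto
  then show ?thesis unfolding nsol_def by simp
qed

definition frame :: "store \<Rightarrow> store \<Rightarrow> bool" where
  "frame s0 s \<longleftrightarrow> (\<forall>a\<in>{0, 1, 2}. nats s a = nats s0 a) \<and>
     (\<forall>a\<in>{0, 1, 2, 3, 5, 12, 13, 14, 16, 20, 25, 26, 27, 28, 29, 30}. reals s a = reals s0 a)"

lemma frameI:
  assumes "frame s0 s" "\<And>a. a \<in> {0, 1, 2} \<Longrightarrow> nats s' a = nats s a"
    "\<And>a. a \<in> {0, 1, 2, 3, 5, 12, 13, 14, 16, 20, 25, 26, 27, 28, 29, 30} \<Longrightarrow> reals s' a = reals s a"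
  shows "frame s0 s'"
  unfolding frame_def
proof (intro conjI ballI)
  fix a assume "a \<in> {0::nat, 1, 2}"
  then show "nats s' a = nats s0 a" using assms(1) assms(2)[of a] unfolding frame_def by metis
next
  fix a assume "a \<in> {0::nat, 1, 2, 3, 5, 12, 13, 14, 16, 20, 25, 26, 27, 28, 29, 30}"
  then show "reals s' a = reals s0 a" using assms(1) assms(3)[of a] unfolding frame_def by metis
qed

lemma frame_refl: "frame s s" unfolding frame_def by simp

definition mm :: nat where "mm = nat \<lceil>Iot\<rceil>"

context
  fixes s0 :: store and a \<nu> :: real and D g r0 :: "nat \<Rightarrow> real"
  assumes inp0: "inp s0" and consts0: "consts_ok s0" and r0: "r0 = reals s0 5" "r0ok r0"
    and a: "a = reals s0 25 0" "0 < a" and \<nu>: "\<nu> = reals s0 14 0" "0 < \<nu>"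
    and D: "D = reals s0 16" "\<And>i. i < n \<Longrightarrow> 0 \<le> D i" and g: "g = reals s0 20"
begin

lemma frame_inp:
  assumes "frame s0 s" shows "inp s"
proof (rule inp_cong[OF inp0])
  fix k :: nat assume "k < 3"
  then have k: "k \<in> {0, 1, 2}" by auto
  show "nats s k = nats s0 k" using assms k unfolding frame_def by blast
  show "reals s k = reals s0 k" using assms k unfolding frame_def by blast
qed

lemma frame_vals:
  assumes "frame s0 s"
  shows "reals s 25 0 = a" "reals s 14 0 = \<nu>" "reals s 16 = D" "reals s 20 = g" "reals s 5 = r0"
    "reals s 26 0 = Lam" "reals s 27 0 = Iot" "reals s 28 0 = 1 / (16 * (p * 2 powr p) * Iot)"
    "reals s 29 0 = (16 * (p * 2 powr p) * Iot) powr (p - 1)"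
  using assms consts0 unfolding frame_def consts_ok_def a(1) \<nu>(1) D(1) g r0(1) by auto

text \<open>The weights \<open>mwu.mW\<close> read off the store, without presupposing the locale
  \<open>mwu\<close>, whose feasibility assumption may fail during a run.\<close>

definition WW :: "store \<Rightarrow> nat \<Rightarrow> real" where
  "WW s i = a * D i + a powr (2 / p) * (r0 i + reals s 17 i + reals s 18 i powr (p - 2))"

lemma WW_pos:
  assumes "0 \<le> reals s 17 i" "i < n" shows "0 < WW s i"
proof -
  have "0 < r0 i" using r0(2) assms(2) unfolding r0ok_def by blast
  then have "0 < r0 i + reals s 17 i + reals s 18 i powr (p - 2)" using assms(1) by (intro add_pos_nonneg) auto
  then have "0 < a powr (2 / p) * (r0 i + reals s 17 i + reals s 18 i powr (p - 2))" using a(2) by simp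
  then show ?thesis unfolding WW_def using D(2)[OF assms(2)] a(2) by (intro add_nonneg_pos) auto
qed

lemma wp_solve:
  assumes fr: "frame s0 s" and nn: "\<And>i. i < n \<Longrightarrow> 0 \<le> reals s 17 i" "\<And>i. i < n \<Longrightarrow> 0 \<le> reals s 18 i"
  shows "wpc A \<tau> p_solve (15 * U) s (\<lambda>s'. \<exists>z. nsol (WW s) g z \<and>
    (\<forall>j<d. reals s' 9 j = z j * (\<nu> / 2) / dot g z) \<and> (\<forall>i<n. reals s' 10 i = mv (reals s' 9) i) \<and>
    reals s' 21 0 = a * pw p (reals s' 10) \<and> frame s0 s' \<and> (\<forall>k\<in>{16, 17}. nats s' k = nats s k) \<and>
    (\<forall>k\<in>{17, 18, 19}. reals s' k = reals s k))"
  unfolding p_solve_def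
  apply (rule wp_block, rule wp_block_Cons, rule wp_vmap[OF frame_inp[OF fr], where g = "WW s" and m = n], simp, simp)
  subgoal premises s' for i s'
    using s' frame_vals[OF fr] rinpD[OF frame_inp[OF fr]] nn[OF s'(1)] a(2) unfolding WW_def
    by (simp add: rval_Rpow)
  subgoal premises s1 for s1
  proof -
    have fr1: "frame s0 s1" by (rule frameI[OF fr]) (use s1 in auto)
    show ?thesis
      apply (rule wp_block_Cons, rule wp_Solve)
      subgoal premises i for i using WW_pos[OF nn(1)[OF i] i] s1 i by simp
      subgoal premises s2 for s2 z
      proof -
        have fr2: "frame s0 s2" by (rule frameI[OF fr1]) (use s2 in auto)
        have z: "nsol (WW s) g z"
          using s2(1) nsol_cong[of "reals s1 4" "WW s" g z] s1 frame_vals[OF fr1] by simp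
        have z2: "reals s2 9 j = z j" if "j < d" for j using s2 that by simp
        show ?thesis
          apply (rule wp_block_Cons, rule wp_vsum[OF frame_inp[OF fr2], where g = "\<lambda>j. g j * z j" and m = d], simp, simp)
          subgoal premises s' for j s' x
            using s' z2[OF s'(1)] frame_vals[OF fr2] by simp
          subgoal premises s3 for s3
          proof -
            have fr3: "frame s0 s3" by (rule frameI[OF fr2]) (use s3 in auto)
            have r11: "reals s3 11 0 = dot g z" unfolding dot_def using s3 by simp
            show ?thesis
              apply (rule wp_block_Cons, rule wp_vmap[OF frame_inp[OF fr3], where g = "\<lambda>j. z j * (\<nu> / 2) / dot g z" and m = d], simp, simp)
              subgoal premises s' for j s'
                using s' s3 z2[OF s'(1)] r11 frame_vals[OF fr3] by simp
              subgoal premises s4 for s4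
              proof -
                have fr4: "frame s0 s4" by (rule frameI[OF fr3]) (use s4 in auto)
                show ?thesis
                  apply (rule wp_block_Cons, rule wp_mulA[OF frame_inp[OF fr4]], simp, simp)
                  subgoal premises s5 for s5
                  proof -
                    have fr5: "frame s0 s5" by (rule frameI[OF fr4]) (use s5 in auto)
                    show ?thesis
                      apply (rule wp_block_Cons, rule wp_vsum[OF frame_inp[OF fr5], where g = "\<lambda>i. \<bar>reals s5 10 i\<bar> powr p" and m = n], simp, simp)
                      subgoal premises s' for i s' x
                        using s' rinpD[OF frame_inp[OF fr5]] by simp
                      subgoal premises s6 for s6
                      proof -
                        have fr6: "frame s0 s6" by (rule frameI[OF fr5]) (use s6 in auto)
                        show ?thesis
                          apply (rule wp_block_Cons, rule wp_RAssign, rule wp_block_Nil)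
                          subgoal premises s7 for s7
                          proof (intro exI[of _ z] conjI z)
                            show "frame s0 s7" by (rule frameI[OF fr6]) (use s7 in auto)
                            have r9: "reals s7 9 = reals s4 9" using s7 s6 s5 by simp
                            have r10: "reals s7 10 = reals s5 10" using s7 s6 by simp
                            show "\<forall>j<d. reals s7 9 j = z j * (\<nu> / 2) / dot g z" unfolding r9 using s4 by simp
                            show "\<forall>i<n. reals s7 10 i = mv (reals s7 9) i" unfolding r9 r10 using s5 by simp
                            show "reals s7 21 0 = a * pw p (reals s7 10)"
                              unfolding r10 pw_def using s7 s6 frame_vals[OF fr6] by simp
                            show "\<forall>k\<in>{16, 17}. nats s7 k = nats s k" using s7 s6 s5 s4 s3 s2 s1 by simp
                            show "\<forall>k\<in>{17, 18, 19}. reals s7 k = reals s k" using s7 s6 s5 s4 s3 s2 s1 by simp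
                          qed
                          done
                      qed
                      done
                  qed
                  done
              qed
              done
          qed
          done
      qed
      done
  qed
  by simp

text \<open>\<open>PP\<close> holds if the gap exceeds \<open>\<nu> / 2\<close>. Otherwise nothing is claimed about the result of the
  loop, which is harmless because candidates are only accepted if they improve \<open>x\<close>.\<close>

definition PP :: bool where
  "PP \<longleftrightarrow> mwu n d M p a Lam Iot (\<nu> / 2) D r0 g"

text \<open>Nonnegativity of the increments is kept outside \<open>PP\<close> because the solver
  needs positive weights in any case. The slack in \<open>Iot + 1\<close> covers the last round,
  which is entered below \<open>Iot\<close>.\<close>

definition minvar :: "nat \<Rightarrow> store \<Rightarrow> bool" where
  "minvar j s \<longleftrightarrow> frame s0 s \<and> nats s 16 0 = j \<and> nats s 17 0 \<le> j \<and> (\<forall>i<n. 0 \<le> reals s 17 i \<and> 0 \<le> reals s 18 i) \<and>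
     real j \<le> Iot + 1 \<and> (PP \<longrightarrow> mwu.minv n d M p a Lam Iot (\<nu> / 2) D r0 g (reals s 17) (reals s 18) (reals s 19)
        (j - nats s 17 0) (nats s 17 0))"

lemma wp_mwu_body:
  assumes inv: "minvar j s" and b: "bval (RLess (ROfNat (ncell 16)) (rcell 27)) s"
  shows "wpc A \<tau> (Seq p_solve (Seq (Cond (RLess (rcell 29) (rcell 21)) p_width p_primal)
       (block [NAssign 16 (NConst 0) (NAdd (ncell 16) (NConst 1))]))) (28 * U) s (minvar (Suc j))"
proof -
  let ?c = "nats s 17 0"
  have fr: "frame s0 s" and n16: "nats s 16 0 = j" and cj: "?c \<le> j"
    and nn: "\<And>i. i < n \<Longrightarrow> 0 \<le> reals s 17 i" "\<And>i. i < n \<Longrightarrow> 0 \<le> reals s 18 i"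
    and mi: "PP \<Longrightarrow> mwu.minv n d M p a Lam Iot (\<nu> / 2) D r0 g (reals s 17) (reals s 18) (reals s 19) (j - ?c) ?c"
    using inv unfolding minvar_def by auto
  have jI: "real j < Iot" using b n16 frame_vals[OF fr] by simp
  have last: "wpc A \<tau> (block [NAssign 16 (NConst 0) (NAdd (ncell 16) (NConst 1))]) (3 * U) s' (minvar (Suc j))"
    if s': "frame s0 s'" "nats s' 16 0 = j" "nats s' 17 0 \<le> Suc j"
      "\<And>i. i < n \<Longrightarrow> 0 \<le> reals s' 17 i" "\<And>i. i < n \<Longrightarrow> 0 \<le> reals s' 18 i"
      "PP \<Longrightarrow> mwu.minv n d M p a Lam Iot (\<nu> / 2) D r0 g (reals s' 17) (reals s' 18) (reals s' 19)
        (Suc j - nats s' 17 0) (nats s' 17 0)" for s'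
    apply (rule wp_block, rule wp_block_Cons, rule wp_NAssign, rule wp_block_Nil)
    subgoal premises st for s2
    proof -
      have "frame s0 s2" by (rule frameI[OF s'(1)]) (use st in auto)
      then show ?thesis unfolding minvar_def using st s' jI by simp
    qed
    by simp
  have "wpc A \<tau> (Seq p_solve (Seq (Cond (RLess (rcell 29) (rcell 21)) p_width p_primal)
       (block [NAssign 16 (NConst 0) (NAdd (ncell 16) (NConst 1))]))) (15 * U + ((7 * U + 1) + 3 * U + 1) + 1) s (minvar (Suc j))"
  proof (rule wpc_Seq, rule wpc_mono[OF wp_solve[OF fr nn] order_refl])
    fix s1 assume "\<exists>z. nsol (WW s) g z \<and>
      (\<forall>j<d. reals s1 9 j = z j * (\<nu> / 2) / dot g z) \<and> (\<forall>i<n. reals s1 10 i = mv (reals s1 9) i) \<and>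
      reals s1 21 0 = a * pw p (reals s1 10) \<and> frame s0 s1 \<and> (\<forall>k\<in>{16, 17}. nats s1 k = nats s k) \<and>
      (\<forall>k\<in>{17, 18, 19}. reals s1 k = reals s k)"
    then obtain z where z: "nsol (WW s) g z" and \<Delta>: "\<And>j. j < d \<Longrightarrow> reals s1 9 j = z j * (\<nu> / 2) / dot g z"
      and y: "\<And>i. i < n \<Longrightarrow> reals s1 10 i = mv (reals s1 9) i" and t: "reals s1 21 0 = a * pw p (reals s1 10)"
      and fr1: "frame s0 s1" and same: "nats s1 16 = nats s 16" "nats s1 17 = nats s 17"
        "reals s1 17 = reals s 17" "reals s1 18 = reals s 18" "reals s1 19 = reals s 19" by auto
    let ?t = "reals s1 21 0"
    have t0: "0 \<le> ?t" unfolding t using a(2) pw_nonneg by simp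
    note v1 = frame_vals[OF fr1]
    note ip1 = rinpD[OF frame_inp[OF fr1]]
    show "wpc A \<tau> (Seq (Cond (RLess (rcell 29) (rcell 21)) p_width p_primal)
       (block [NAssign 16 (NConst 0) (NAdd (ncell 16) (NConst 1))])) ((7 * U + 1) + 3 * U + 1) s1 (minvar (Suc j))"
    proof (rule wpc_Seq, rule wpc_Cond)
      assume "bval (RLess (rcell 29) (rcell 21)) s1"
      then have big: "(16 * (p * 2 powr p) * Iot) powr (p - 1) < ?t" using v1 by simp
      let ?r = "\<lambda>i. reals s 17 i + 1 / (Lam * ?t powr ((p - 2) / p)) * (a powr (1 / p) * \<bar>reals s1 10 i\<bar>) powr (p - 2)"
      show "wpc A \<tau> p_width (7 * U) s1 (\<lambda>s2. wpc A \<tau> (block [NAssign 16 (NConst 0) (NAdd (ncell 16) (NConst 1))]) (3 * U) s2 (minvar (Suc j)))"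
        unfolding p_width_def
        apply (rule wp_block, rule wp_block_Cons, rule wp_vmap[OF frame_inp[OF fr1], where g = ?r and m = n], simp, simp)
        subgoal premises s' for i s'
          using s' v1 ip1 t0 a(2) same by (simp add: rval_Rpow)
        subgoal premises s2 for s2
          apply (rule wp_block_Nil, rule last)
          subgoal by (rule frameI[OF fr1]) (use s2 in auto)
          subgoal using s2 same n16 by simp
          subgoal using s2 same cj by simp
          subgoal premises i for i
          proof -
            have "0 \<le> 1 / (Lam * ?t powr ((p - 2) / p)) * (a powr (1 / p) * \<bar>reals s1 10 i\<bar>) powr (p - 2)"
              using Lam_pos by (intro mult_nonneg_nonneg) auto
            then show ?thesis using s2 i nn(1)[OF i] by simp
          qed
          subgoal premises i for i using s2 same nn(2)[OF i] by simp
          subgoal premises PP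
          proof -
            interpret m: mwu n d M p a Lam Iot "\<nu> / 2" D r0 g using PP unfolding PP_def .
            have "m.minv (reals s2 17) (reals s 18) (reals s 19) (Suc (j - ?c)) ?c"
            proof (rule m.minv_width[OF mi[OF PP], where z = z and \<Delta> = "reals s1 9" and y = "reals s1 10" and t = ?t])
              show "real ?c \<le> 2 * Iot" using cj jI Iot_ge by linarith
              show "nsol (m.mW (reals s 17) (reals s 18)) g z" using z unfolding m.mW_def WW_def[abs_def] .
              show "m.\<tau> < ?t" using big unfolding m.\<tau>_def m.Cp_def .
              show "reals s2 17 i = ?r i" if "i < n" for i using s2 that by simp
            qed (use \<Delta> y t in auto)
            moreover have "Suc (j - ?c) = Suc j - ?c" using cj by simp
            ultimately show ?thesis using s2 same by simp
          qed
          done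
        by simp
    next
      assume "\<not> bval (RLess (rcell 29) (rcell 21)) s1"
      then have small: "?t \<le> (16 * (p * 2 powr p) * Iot) powr (p - 1)" using v1 by simp
      let ?al = "1 / (16 * (p * 2 powr p) * Iot)"
      let ?u = "\<lambda>i. reals s 18 i + ?al * (a powr (1 / p) * \<bar>reals s1 10 i\<bar>)"
      have al0: "0 \<le> ?al" using p Iot_ge by (intro divide_nonneg_nonneg mult_nonneg_nonneg) auto
      show "wpc A \<tau> p_primal (7 * U) s1 (\<lambda>s2. wpc A \<tau> (block [NAssign 16 (NConst 0) (NAdd (ncell 16) (NConst 1))]) (3 * U) s2 (minvar (Suc j)))"
        unfolding p_primal_def
        apply (rule wp_block, rule wp_block_Cons, rule wp_vmap[OF frame_inp[OF fr1], where g = ?u and m = n], simp, simp)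
        subgoal premises s' for i s'
          using s' v1 ip1 a(2) same by (simp add: rval_Rpow)
        subgoal premises s2 for s2
        proof -
          have fr2: "frame s0 s2" by (rule frameI[OF fr1]) (use s2 in auto)
          show ?thesis
            apply (rule wp_block_Cons, rule wp_vmap[OF frame_inp[OF fr2], where g = "\<lambda>j. reals s 19 j + reals s1 9 j" and m = d], simp, simp)
            subgoal premises s' for i s' using s' s2 same by simp
            subgoal premises s3 for s3
              apply (rule wp_block_Cons, rule wp_NAssign, rule wp_block_Nil)
              subgoal premises s4 for s4
              proof (rule last)
                show "frame s0 s4" by (rule frameI[OF fr2]) (use s4 s3 in auto)
                show "nats s4 16 0 = j" using s4 s3 s2 same n16 by simp
                have c4: "nats s4 17 0 = Suc ?c" using s4 s3 s2 same by simp
                show "nats s4 17 0 \<le> Suc j" using c4 cj by simp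
                have r17: "reals s4 17 = reals s 17" using s4 s3 s2 same by simp
                have r18: "reals s4 18 i = ?u i" if "i < n" for i using s4 s3 s2 that by simp
                have r19: "reals s4 19 j = reals s 19 j + reals s1 9 j" if "j < d" for j using s4 s3 that by simp
                show "0 \<le> reals s4 17 i" if "i < n" for i unfolding r17 using nn(1)[OF that] .
                show "0 \<le> reals s4 18 i" if "i < n" for i
                proof -
                  have "0 \<le> ?al * (a powr (1 / p) * \<bar>reals s1 10 i\<bar>)" using al0 by (intro mult_nonneg_nonneg) auto
                  then show ?thesis unfolding r18[OF that] using nn(2)[OF that] by linarith
                qed
                assume PP: PP
                interpret m: mwu n d M p a Lam Iot "\<nu> / 2" D r0 g using PP unfolding PP_def .
                have "m.minv (reals s 17) (reals s4 18) (reals s4 19) (j - ?c) (Suc ?c)"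
                proof (rule m.minv_primal[OF mi[OF PP], where z = z and \<Delta> = "reals s1 9" and y = "reals s1 10" and t = ?t])
                  show "real ?c \<le> 2 * Iot" using cj jI Iot_ge by linarith
                  show "nsol (m.mW (reals s 17) (reals s 18)) g z" using z unfolding m.mW_def WW_def[abs_def] .
                  show "?t \<le> m.\<tau>" using small unfolding m.\<tau>_def m.Cp_def .
                  show "reals s4 18 i = reals s 18 i + m.\<alpha> * (a powr (1 / p) * \<bar>reals s1 10 i\<bar>)" if "i < n" for i
                    using r18[OF that] unfolding m.\<alpha>_def m.Cp_def .
                qed (use \<Delta> y t r19 in auto)
                then show "m.minv (reals s4 17) (reals s4 18) (reals s4 19) (Suc j - nats s4 17 0) (nats s4 17 0)"
                  unfolding r17 c4 by simp
              qed
              done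
            done
        qed
        by simp
    qed
  qed
  then show ?thesis by (rule wpc_mono) (use U_pos in auto)
qed

lemma wp_mwu:
  assumes fr: "frame s0 s" and zero: "nats s 16 0 = 0" "nats s 17 0 = 0" "\<And>i. i < n \<Longrightarrow> reals s 17 i = 0"
    "\<And>i. i < n \<Longrightarrow> reals s 18 i = 0" "\<And>j. j < d \<Longrightarrow> reals s 19 j = 0"
  shows "wpc A \<tau> p_mwu ((29 * mm + 1) * U) s (\<lambda>s'. frame s0 s' \<and> (PP \<longrightarrow>
    dot g (\<lambda>j. reals s' 19 j / nats s' 17 0) = \<nu> / 2 \<and> a * wsq D (mv (\<lambda>j. reals s' 19 j / nats s' 17 0)) \<le> 4 \<and>
    a * pw p (mv (\<lambda>j. reals s' 19 j / nats s' 17 0)) \<le> (32 * (p * 2 powr p)) powr p))"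
proof -
  have "wpc A \<tau> p_mwu (mm * (28 * U + 1) + 1) s (\<lambda>s'. frame s0 s' \<and> (PP \<longrightarrow>
    dot g (\<lambda>j. reals s' 19 j / nats s' 17 0) = \<nu> / 2 \<and> a * wsq D (mv (\<lambda>j. reals s' 19 j / nats s' 17 0)) \<le> 4 \<and>
    a * pw p (mv (\<lambda>j. reals s' 19 j / nats s' 17 0)) \<le> (32 * (p * 2 powr p)) powr p))"
    unfolding p_mwu_def
  proof (rule wpc_While[where I = minvar])
    have "PP \<Longrightarrow> mwu.minv n d M p a Lam Iot (\<nu> / 2) D r0 g (reals s 17) (reals s 18) (reals s 19) 0 0"
      unfolding PP_def by (rule mwu.minv_initial) (use zero in auto)
    then show "minvar 0 s" unfolding minvar_def using fr zero Iot_ge by simp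
    fix j s1 assume inv: "minvar j s1" and b: "bval (RLess (ROfNat (ncell 16)) (rcell 27)) s1"
    have "real j < Iot" using b inv frame_vals(7)[of s1] unfolding minvar_def by simp
    then have "j < mm" unfolding mm_def by linarith
    then show "j < mm \<and> wpc A \<tau> (Seq p_solve (Seq (Cond (RLess (rcell 29) (rcell 21)) p_width p_primal)
       (block [NAssign 16 (NConst 0) (NAdd (ncell 16) (NConst 1))]))) (28 * U) s1 (minvar (Suc j))"
      using wp_mwu_body[OF inv b] by simp
  next
    fix j s1 assume inv: "minvar j s1" and b: "\<not> bval (RLess (ROfNat (ncell 16)) (rcell 27)) s1"
    let ?c = "nats s1 17 0"
    have fr1: "frame s0 s1" and cj: "?c \<le> j" and j1: "real j \<le> Iot + 1" using inv unfolding minvar_def by auto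
    have jI: "Iot \<le> real j" using b inv frame_vals(7)[of s1] unfolding minvar_def by simp
    show "frame s0 s1 \<and> (PP \<longrightarrow>
      dot g (\<lambda>j. reals s1 19 j / ?c) = \<nu> / 2 \<and> a * wsq D (mv (\<lambda>j. reals s1 19 j / ?c)) \<le> 4 \<and>
      a * pw p (mv (\<lambda>j. reals s1 19 j / ?c)) \<le> (32 * (p * 2 powr p)) powr p)"
    proof (intro conjI[OF fr1] impI)
      assume PP: PP
      interpret m: mwu n d M p a Lam Iot "\<nu> / 2" D r0 g using PP unfolding PP_def .
      have mi: "m.minv (reals s1 17) (reals s1 18) (reals s1 19) (j - ?c) ?c"
        using inv PP unfolding minvar_def by blast
      have 1: "Iot \<le> real (j - ?c) + real ?c" "real (j - ?c) + real ?c \<le> 2 * Iot"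
        using jI j1 cj Iot_ge by (simp_all add: of_nat_diff)
      show "dot g (\<lambda>j. reals s1 19 j / ?c) = \<nu> / 2 \<and> a * wsq D (mv (\<lambda>j. reals s1 19 j / ?c)) \<le> 4 \<and>
        a * pw p (mv (\<lambda>j. reals s1 19 j / ?c)) \<le> (32 * (p * 2 powr p)) powr p"
        using m.minv_final(2-4)[OF mi 1] unfolding m.Cp_def by blast
    qed
  qed
  then show ?thesis
  proof (rule wpc_mono)
    have "mm * (28 * U + 1) \<le> mm * (29 * U)" using U_pos by (intro mult_le_mono2) simp
    moreover have "(29 * mm + 1) * U = mm * (29 * U) + U" by (simp add: algebra_simps)
    ultimately show "mm * (28 * U + 1) + 1 \<le> (29 * mm + 1) * U" using U_pos by linarith
  qed
qed

end

end

section \<open>Correctness of the refinement loop\<close>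

context lewis_run
begin

lemma wp_mwu_init:
  assumes inp: "inp s"
  shows "wpc A \<tau> p_mwu_init (19 * U) s (\<lambda>s'.
    (\<forall>k\<in>{0, 1, 2}. nats s' k = nats s k) \<and>
    (\<forall>k\<in>{0, 1, 2, 3, 5, 12, 13, 14, 26, 27, 28, 29, 30}. reals s' k = reals s k) \<and>
    nats s' 16 0 = 0 \<and> nats s' 17 0 = 0 \<and>
    (\<forall>i<n. reals s' 16 i = \<bar>reals s 12 i\<bar> powr (p - 2) \<and> reals s' 17 i = 0 \<and> reals s' 18 i = 0) \<and>
    (\<forall>j<d. reals s' 19 j = 0 \<and> reals s' 20 j = mt (\<lambda>i. p * (reals s' 16 i * reals s 12 i)) j) \<and>
    reals s' 25 0 = 2 * 2 powr (- p) / reals s 14 0)"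
  unfolding p_mwu_init_def
  apply (rule wp_block, rule wp_block_Cons, rule wp_vmap[OF inp, where g = "\<lambda>i. \<bar>reals s 12 i\<bar> powr (p - 2)" and m = n], simp, simp)
  subgoal premises s' for i s' using s' rinpD[OF inp] by simp
  subgoal premises s1 for s1
  proof -
    have inp1: "inp s1" by (rule inp_cong[OF inp]) (use s1 in auto)
    show ?thesis
      apply (rule wp_block_Cons, rule wp_vmap[OF inp1, where g = "\<lambda>_. 0" and m = n], simp, simp, simp)
      subgoal premises s2 for s2
      proof -
        have inp2: "inp s2" by (rule inp_cong[OF inp1]) (use s2 in auto)
        show ?thesis
          apply (rule wp_block_Cons, rule wp_vmap[OF inp2, where g = "\<lambda>_. 0" and m = n], simp, simp, simp)
          subgoal premises s3 for s3
          proof -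
            have inp3: "inp s3" by (rule inp_cong[OF inp2]) (use s3 in auto)
            show ?thesis
              apply (rule wp_block_Cons, rule wp_vmap[OF inp3, where g = "\<lambda>_. 0" and m = d], simp, simp, simp)
              subgoal premises s4 for s4
                apply (rule wp_block_Cons, rule wp_NAssign)
                apply (rule wp_block_Cons, rule wp_NAssign)
                subgoal premises s56 for s5 s6
                proof -
                  have inp6: "inp s6" by (rule inp_cong[OF inp3]) (use s4 s56 in auto)
                  have D6: "reals s6 16 i = \<bar>reals s 12 i\<bar> powr (p - 2)" if "i < n" for i
                    using that s56 s4 s3 s2 s1 by simp
                  have e6: "reals s6 12 = reals s 12" using s56 s4 s3 s2 s1 by simp
                  show ?thesis
                    apply (rule wp_block_Cons, rule wp_vmap[OF inp6,
                          where g = "\<lambda>i. p * (reals s6 16 i * reals s 12 i)" and m = n], simp, simp)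
                    subgoal premises s' for i s' using s' e6 rinpD[OF inp6] by simp
                    subgoal premises s7 for s7
                    proof -
                      have inp7: "inp s7" by (rule inp_cong[OF inp6]) (use s7 in auto)
                      have mt7: "mt (reals s7 10) j = mt (\<lambda>i. p * (reals s6 16 i * reals s 12 i)) j" for j
                        unfolding mt_def using s7 by (intro sum.cong) auto
                      show ?thesis
                        apply (rule wp_block_Cons, rule wp_mulAT[OF inp7], simp, simp)
                        subgoal premises s8 for s8
                        proof -
                          have inp8: "inp s8" by (rule inp_cong[OF inp7]) (use s8 in auto)
                          have r14: "reals s8 14 = reals s 14" using s8 s7 s56 s4 s3 s2 s1 by simp
                          show ?thesis
                            apply (rule wp_block_Cons, rule wp_RAssign, rule wp_block_Nil)
                            subgoal premises s9 for s9
                            proof (intro conjI)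
                              have r16: "reals s9 16 = reals s6 16" using s9 s8 s7 by simp
                              show "\<forall>k\<in>{0, 1, 2}. nats s9 k = nats s k" using s9 s8 s7 s56 s4 s3 s2 s1 by simp
                              show "\<forall>k\<in>{0, 1, 2, 3, 5, 12, 13, 14, 26, 27, 28, 29, 30}. reals s9 k = reals s k"
                                using s9 s8 s7 s56 s4 s3 s2 s1 by simp
                              show "nats s9 16 0 = 0" "nats s9 17 0 = 0" using s9 s8 s7 s56 by simp_all
                              show "\<forall>i<n. reals s9 16 i = \<bar>reals s 12 i\<bar> powr (p - 2) \<and> reals s9 17 i = 0 \<and> reals s9 18 i = 0"
                                unfolding r16 using D6 s9 s8 s7 s56 s4 s3 s2 by simp
                              show "\<forall>j<d. reals s9 19 j = 0 \<and> reals s9 20 j = mt (\<lambda>i. p * (reals s9 16 i * reals s 12 i)) j"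
                                unfolding r16 mt7[symmetric] using s9 s8 s7 s56 s4 by simp
                              show "reals s9 25 0 = 2 * 2 powr (- p) / reals s 14 0"
                                using s9 r14 rinpD[OF inp8] by (simp add: rval_Rpow)
                            qed
                            done
                        qed
                        done
                    qed
                    done
                qed
                done
              done
          qed
          done
      qed
      done
  qed
  by simp

lemma wp_candidate:
  assumes inp: "inp s" and stp: "reals s 30 0 = stp"
  shows "wpc A \<tau> p_candidate (9 * U) s (\<lambda>s'.
    (\<forall>k\<in>{0, 1, 2}. nats s' k = nats s k) \<and> (\<forall>k. k \<notin> {22, 23, 24} \<longrightarrow> reals s' k = reals s k) \<and>
    (\<forall>j<d. reals s' 22 j = reals s 3 j - stp * (reals s 19 j / nats s 17 0)) \<and>
    (\<forall>i<n. reals s' 23 i = mv (reals s' 22) i - b $ i) \<and> reals s' 24 0 = ff (reals s' 22))"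
  unfolding p_candidate_def
  apply (rule wp_block, rule wp_block_Cons,
      rule wp_vmap[OF inp, where g = "\<lambda>j. reals s 3 j - stp * (reals s 19 j / nats s 17 0)" and m = d], simp, simp)
  subgoal premises s' for i s' using s' stp by simp
  subgoal premises s1 for s1
  proof -
    have inp1: "inp s1" by (rule inp_cong[OF inp]) (use s1 in auto)
    show ?thesis
      apply (rule wp_block_Cons, rule wp_mulA[OF inp1], simp, simp)
      subgoal premises s2 for s2
      proof -
        have inp2: "inp s2" by (rule inp_cong[OF inp1]) (use s2 in auto)
        show ?thesis
          apply (rule wp_block_Cons, rule wp_vmap[OF inp2, where g = "\<lambda>i. mv (reals s1 22) i - b $ i" and m = n], simp, simp)
          subgoal premises s' for i s' using s' s2 rinpD[OF inp2] by simp
          subgoal premises s3 for s3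
          proof -
            have inp3: "inp s3" by (rule inp_cong[OF inp2]) (use s3 in auto)
            show ?thesis
              apply (rule wp_block_Cons, rule wp_vsum[OF inp3, where g = "\<lambda>i. \<bar>mv (reals s1 22) i - b $ i\<bar> powr p" and m = n], simp, simp)
              subgoal premises s' for i s' x using s' s3 rinpD[OF inp3] by simp
              subgoal premises s4 for s4
              proof (rule wp_block_Nil, intro conjI)
                have r22: "reals s4 22 = reals s1 22" using s4 s3 s2 by simp
                show "\<forall>k\<in>{0, 1, 2}. nats s4 k = nats s k" using s4 s3 s2 s1 by simp
                show "\<forall>k. k \<notin> {22, 23, 24} \<longrightarrow> reals s4 k = reals s k" using s4 s3 s2 s1 by simp
                show "\<forall>j<d. reals s4 22 j = reals s 3 j - stp * (reals s 19 j / nats s 17 0)" unfolding r22 using s1 by simp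
                show "\<forall>i<n. reals s4 23 i = mv (reals s4 22) i - b $ i" unfolding r22 using s4 s3 by simp
                show "reals s4 24 0 = ff (reals s4 22)" unfolding r22 ff_def pw_def using s4 by simp
              qed
              done
          qed
          done
      qed
      done
  qed
  by simp

lemma wp_accept:
  assumes inp: "inp s" and cur: "current s"
    and cand: "\<And>i. i < n \<Longrightarrow> reals s 23 i = mv (reals s 22) i - b $ i" "reals s 24 0 = ff (reals s 22)"
  shows "wpc A \<tau> p_accept (7 * U + 1) s (\<lambda>s'.
    (\<forall>k\<in>{0, 1, 2}. nats s' k = nats s k) \<and> (\<forall>k. k \<notin> {3, 12, 13} \<longrightarrow> reals s' k = reals s k) \<and>
    current s' \<and> ff (reals s' 3) \<le> ff (reals s 3) \<and> ff (reals s' 3) \<le> ff (reals s 22))"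
  unfolding p_accept_def
proof (rule wpc_Cond)
  assume b: "bval (RLess (rcell 24) (rcell 13)) s"
  then have lt: "ff (reals s 22) < ff (reals s 3)" using cand(2) cur unfolding current_def by simp
  show "wpc A \<tau> (block [vmap 3 1 (ent 22), vmap 12 0 (ent 23), RAssign 13 (NConst 0) (rcell 24)]) (7 * U) s (\<lambda>s'.
    (\<forall>k\<in>{0, 1, 2}. nats s' k = nats s k) \<and> (\<forall>k. k \<notin> {3, 12, 13} \<longrightarrow> reals s' k = reals s k) \<and>
    current s' \<and> ff (reals s' 3) \<le> ff (reals s 3) \<and> ff (reals s' 3) \<le> ff (reals s 22))"
    apply (rule wp_block, rule wp_block_Cons, rule wp_vmap[OF inp, where g = "reals s 22" and m = d], simp, simp, simp)
    subgoal premises s1 for s1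
    proof -
      have inp1: "inp s1" by (rule inp_cong[OF inp]) (use s1 in auto)
      show ?thesis
        apply (rule wp_block_Cons, rule wp_vmap[OF inp1, where g = "reals s 23" and m = n], simp, simp)
        subgoal premises s' for i s' using s' s1 by simp
        subgoal premises s2 for s2
          apply (rule wp_block_Cons, rule wp_RAssign, rule wp_block_Nil)
          subgoal premises s3 for s3
          proof -
            have r3: "reals s3 3 j = reals s 22 j" if "j < d" for j using s3 s2 s1 that by simp
            have ffe: "ff (reals s3 3) = ff (reals s 22)" by (rule ff_cong) (rule r3)
            have mve: "mv (reals s3 3) i = mv (reals s 22) i" for i by (rule mv_cong) (rule r3)
            have "current s3" unfolding current_def ffe mve using cand s3 s2 s1 by simp
            then show ?thesis using ffe lt s3 s2 s1 by simp
          qed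
          done
        done
    qed
    by simp
next
  assume b: "\<not> bval (RLess (rcell 24) (rcell 13)) s"
  then have "ff (reals s 3) \<le> ff (reals s 22)" using cand(2) cur unfolding current_def by simp
  then show "wpc A \<tau> SKIP (7 * U) s (\<lambda>s'.
    (\<forall>k\<in>{0, 1, 2}. nats s' k = nats s k) \<and> (\<forall>k. k \<notin> {3, 12, 13} \<longrightarrow> reals s' k = reals s k) \<and>
    current s' \<and> ff (reals s' 3) \<le> ff (reals s 3) \<and> ff (reals s' 3) \<le> ff (reals s 22))"
    using cur U_pos by (intro wpc_mono[OF wpc_SKIP[where Q = "\<lambda>s'. s' = s"]]) auto
qed

definition oinv :: "real \<Rightarrow> nat \<Rightarrow> store \<Rightarrow> bool" where
  "oinv f0 k s \<longleftrightarrow> inp s \<and> consts_ok s \<and> r0ok (reals s 5) \<and> current s \<and>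
     reals s 14 0 = f0 * (1 - stp / 4) ^ k \<and> (\<forall>x. ff (reals s 3) - ff x \<le> reals s 14 0)"

lemma consts_ok_cong: "consts_ok s \<Longrightarrow> (\<And>k. k \<in> {26, 27, 28, 29, 30} \<Longrightarrow> reals s' k = reals s k) \<Longrightarrow> consts_ok s'"
  unfolding consts_ok_def by simp

abbreviation refine_guard :: bexp where
  "refine_guard \<equiv> RLess (RMul (RDiv (RRead 0 (NConst 1)) (RAdd (rnum 1) (RRead 0 (NConst 1)))) (rcell 13)) (rcell 14)"

text \<open>If the gap to some competitor exceeds \<open>\<nu> / 2\<close>, the inner problem is
  feasible and the candidate gains \<open>stp / 4 * \<nu>\<close>; otherwise that gap already lies
  below the next bound.\<close>

lemma wp_refine_body:
  assumes inv: "oinv f0 k s" and guard: "bval refine_guard s"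
  shows "wpc A \<tau> (Seq p_mwu_init (Seq p_mwu (Seq p_candidate (Seq p_accept
       (block [RAssign 14 (NConst 0) (RMul (rcell 14) (RSub (rnum 1) (RDiv (rcell 30) (rnum 4))))])))))
     ((29 * mm + 45) * U) s (oinv f0 (Suc k))"
proof -
  have inp: "inp s" and cons: "consts_ok s" and r0: "r0ok (reals s 5)" and cur: "current s"
    and nu: "reals s 14 0 = f0 * (1 - stp / 4) ^ k" and gap: "\<And>x. ff (reals s 3) - ff x \<le> reals s 14 0"
    using inv unfolding oinv_def by auto
  define \<nu> where "\<nu> = reals s 14 0"
  define x where "x = reals s 3"
  have f13: "reals s 13 0 = ff x" using cur unfolding current_def x_def by simp
  have e12: "reals s 12 i = mv x i - b $ i" if "i < n" for i using cur that unfolding current_def x_def by simp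
  \<comment> \<open>The guard alone makes \<open>\<nu>\<close> positive, as it is the denominator of
    the scale \<open>a\<close>.\<close>
  have \<nu>0: "0 < \<nu>"
  proof -
    have "0 \<le> \<epsilon> / (1 + \<epsilon>) * ff x" using eps ff_nonneg by (intro mult_nonneg_nonneg divide_nonneg_nonneg) auto
    also have "\<dots> < \<nu>" using guard f13 rinpD[OF inp] unfolding \<nu>_def by simp
    finally show ?thesis .
  qed
  have stp30: "reals s 30 0 = stp" using cons unfolding consts_ok_def by simp
  have "wpc A \<tau> (Seq p_mwu_init (Seq p_mwu (Seq p_candidate (Seq p_accept
       (block [RAssign 14 (NConst 0) (RMul (rcell 14) (RSub (rnum 1) (RDiv (rcell 30) (rnum 4))))])))))
     (19 * U + ((29 * mm + 1) * U + (9 * U + ((7 * U + 1) + 3 * U + 1) + 1) + 1) + 1) s (oinv f0 (Suc k))"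
  proof (rule wpc_Seq, rule wpc_mono[OF wp_mwu_init[OF inp] order_refl], elim conjE)
    fix s0 :: store assume n0: "\<forall>k\<in>{0, 1, 2}. nats s0 k = nats s k"
      and r0eq: "\<forall>k\<in>{0, 1, 2, 3, 5, 12, 13, 14, 26, 27, 28, 29, 30}. reals s0 k = reals s k"
      and z: "nats s0 16 0 = 0" "nats s0 17 0 = 0"
      and D0: "\<forall>i<n. reals s0 16 i = \<bar>reals s 12 i\<bar> powr (p - 2) \<and> reals s0 17 i = 0 \<and> reals s0 18 i = 0"
      and g0: "\<forall>j<d. reals s0 19 j = 0 \<and> reals s0 20 j = mt (\<lambda>i. p * (reals s0 16 i * reals s 12 i)) j"
      and a0: "reals s0 25 0 = 2 * 2 powr (- p) / reals s 14 0"
    define a where "a = reals s0 25 0"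
    define D where "D = reals s0 16"
    define g where "g = reals s0 20"
    define rr where "rr = reals s0 5"
    have inp0: "inp s0"
    proof (rule inp_cong[OF inp])
      fix k :: nat assume "k < 3"
      then have k: "k \<in> {0, 1, 2}" by auto
      show "nats s0 k = nats s k" using n0 k by blast
      show "reals s0 k = reals s k" using r0eq k by blast
    qed
    have cons0: "consts_ok s0" by (rule consts_ok_cong[OF cons]) (use r0eq in auto)
    have rr: "rr = reals s0 5" "r0ok rr" using r0 r0eq unfolding rr_def by auto
    have a_eq: "a = 2 * 2 powr (- p) / \<nu>" using a0 unfolding a_def \<nu>_def .
    have a_pos: "0 < a" unfolding a_eq using \<nu>0 by simp
    have \<nu>s0: "\<nu> = reals s0 14 0" using r0eq unfolding \<nu>_def by simp
    have D_eq: "D i = \<bar>reals s 12 i\<bar> powr (p - 2)" if "i < n" for i using D0 that unfolding D_def by blast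
    have D_nn: "0 \<le> D i" if "i < n" for i unfolding D_eq[OF that] by simp
    have g_eq: "g j = mt (\<lambda>i. p * (D i * reals s 12 i)) j" if "j < d" for j using g0 that unfolding g_def D_def by blast
    note ctx = inp0 cons0 rr a_def a_pos \<nu>s0 \<nu>0 D_def D_nn g_def
    have x0: "reals s0 3 = x" "reals s0 12 = reals s 12" "reals s0 13 = reals s 13" using r0eq unfolding x_def by auto
    show "wpc A \<tau> (Seq p_mwu (Seq p_candidate (Seq p_accept
       (block [RAssign 14 (NConst 0) (RMul (rcell 14) (RSub (rnum 1) (RDiv (rcell 30) (rnum 4))))]))))
       ((29 * mm + 1) * U + (9 * U + ((7 * U + 1) + 3 * U + 1) + 1) + 1) s0 (oinv f0 (Suc k))"
    proof (rule wpc_Seq, rule wpc_mono[OF wp_mwu[OF ctx frame_refl] order_refl])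
      show "nats s0 16 0 = 0" "nats s0 17 0 = 0" by (fact z)+
      show "reals s0 17 i = 0" "reals s0 18 i = 0" if "i < n" for i using D0 that by blast+
      show "reals s0 19 j = 0" if "j < d" for j using g0 that by blast
      fix s1 :: store assume *: "frame s0 s1 \<and> (PP a \<nu> D g rr \<longrightarrow>
        dot g (\<lambda>j. reals s1 19 j / nats s1 17 0) = \<nu> / 2 \<and> a * wsq D (mv (\<lambda>j. reals s1 19 j / nats s1 17 0)) \<le> 4 \<and>
        a * pw p (mv (\<lambda>j. reals s1 19 j / nats s1 17 0)) \<le> (32 * (p * 2 powr p)) powr p)"
      then have fr1: "frame s0 s1" by blast
      have inp1: "inp s1" by (rule frame_inp[OF ctx fr1])
      have r1: "reals s1 3 = x" "reals s1 12 = reals s 12" "reals s1 13 = reals s 13" "reals s1 5 = rr"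
        "\<And>k. k \<in> {14, 26, 27, 28, 29, 30} \<Longrightarrow> reals s1 k = reals s k"
        using fr1 r0eq x0 unfolding frame_def rr_def by auto
      have st1: "reals s1 30 0 = stp" using r1(5)[of 30] stp30 by simp
      show "wpc A \<tau> (Seq p_candidate (Seq p_accept
         (block [RAssign 14 (NConst 0) (RMul (rcell 14) (RSub (rnum 1) (RDiv (rcell 30) (rnum 4))))])))
         (9 * U + ((7 * U + 1) + 3 * U + 1) + 1) s1 (oinv f0 (Suc k))"
      proof (rule wpc_Seq, rule wpc_mono[OF wp_candidate[OF inp1 st1] order_refl], elim conjE)
        fix s2 :: store assume n2: "\<forall>k\<in>{0, 1, 2}. nats s2 k = nats s1 k"
          and r2: "\<forall>k. k \<notin> {22, 23, 24} \<longrightarrow> reals s2 k = reals s1 k"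
          and c22: "\<forall>j<d. reals s2 22 j = reals s1 3 j - stp * (reals s1 19 j / nats s1 17 0)"
          and c23: "\<forall>i<n. reals s2 23 i = mv (reals s2 22) i - b $ i" and c24: "reals s2 24 0 = ff (reals s2 22)"
        have inp2: "inp s2"
        proof (rule inp_cong[OF inp1])
          fix k :: nat assume "k < 3"
          then have k: "k \<in> {0, 1, 2}" by auto
          show "nats s2 k = nats s1 k" using n2 k by blast
          show "reals s2 k = reals s1 k" using r2 \<open>k < 3\<close> by auto
        qed
        have cur2: "current s2" unfolding current_def using r2 r1 e12 f13 by simp
        have decrease: "ff (reals s2 22) \<le> ff x - stp / 4 * \<nu>" if big: "\<nu> / 2 < ff x - ff x'" for x'
        proof -
          have feas: "\<exists>h. dot g h = \<nu> / 2 \<and> a * wsq D (mv h) \<le> 1 \<and> a * pw p (mv h) \<le> 1"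
            by (rule refinement_feasible[where x = x and b = "\<lambda>i. b $ i" and e = "reals s 12" and x' = x', OF p \<nu>0 a_eq])
              (use e12 D_eq g_eq big in \<open>auto simp: ff_def\<close>)
          have PP: "PP a \<nu> D g rr"
          proof -
            have "mwu n d M p a Lam Iot (\<nu> / 2) D rr g"
              by unfold_locales
                (use p a_pos Lam_pos \<nu>0 Iot_ge D_nn rr(2) feas in \<open>auto simp: r0ok_def\<close>)
            then show ?thesis using PP_def[OF ctx] by blast
          qed
          show ?thesis
            unfolding ff_def
            by (rule refinement_progress[where e = "reals s 12" and D = D and g = g and a = a
                  and \<Delta> = "\<lambda>j. reals s1 19 j / nats s1 17 0" and \<kappa> = "(32 * (p * 2 powr p)) powr p" and b = "\<lambda>i. b $ i", OF p \<nu>0 a_eq])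
              (use e12 D_eq g_eq * PP c22 r1 in \<open>auto simp: stp_def\<close>)
        qed
        show "wpc A \<tau> (Seq p_accept
           (block [RAssign 14 (NConst 0) (RMul (rcell 14) (RSub (rnum 1) (RDiv (rcell 30) (rnum 4))))]))
           ((7 * U + 1) + 3 * U + 1) s2 (oinv f0 (Suc k))"
        proof (rule wpc_Seq, rule wpc_mono[OF wp_accept[OF inp2 cur2] order_refl])
          show "reals s2 23 i = mv (reals s2 22) i - b $ i" if "i < n" for i using c23 that by blast
          show "reals s2 24 0 = ff (reals s2 22)" by (fact c24)
          fix s3 :: store assume s3: "(\<forall>k\<in>{0, 1, 2}. nats s3 k = nats s2 k) \<and> (\<forall>k. k \<notin> {3, 12, 13} \<longrightarrow> reals s3 k = reals s2 k) \<and>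
            current s3 \<and> ff (reals s3 3) \<le> ff (reals s2 3) \<and> ff (reals s3 3) \<le> ff (reals s2 22)"
          have s23: "reals s2 3 = x" using r2 r1 by simp
          have inp3: "inp s3"
          proof (rule inp_cong[OF inp2])
            fix k :: nat assume "k < 3"
            then have k: "k \<in> {0, 1, 2}" by auto
            show "nats s3 k = nats s2 k" using s3 k by blast
            show "reals s3 k = reals s2 k" using s3 \<open>k < 3\<close> by auto
          qed
          have s3k: "reals s3 k = reals s k" if "k \<in> {14, 26, 27, 28, 29, 30}" for k
          proof -
            have "reals s3 k = reals s2 k" using s3 that by auto
            also have "\<dots> = reals s1 k" using r2 that by auto
            also have "\<dots> = reals s k" by (rule r1(5)[OF that])
            finally show ?thesis .
          qed
          have s35: "reals s3 5 = rr" using s3 r2 r1(4) by simp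
          have gap3: "ff (reals s3 3) - ff x' \<le> \<nu> * (1 - stp / 4)" for x'
          proof (cases "\<nu> / 2 < ff x - ff x'")
            case True
            have "ff (reals s3 3) \<le> ff x - stp / 4 * \<nu>" using s3 decrease[OF True] by linarith
            moreover have "ff x - ff x' \<le> \<nu>" using gap[of x'] unfolding x_def \<nu>_def .
            ultimately show ?thesis by (simp add: algebra_simps)
          next
            case False
            have "ff (reals s3 3) - ff x' \<le> \<nu> / 2" using s3 s23 False by simp
            also have "\<dots> \<le> \<nu> * (1 - stp / 4)" using \<nu>0 stp_bounds mult_left_mono[of "1 / 2" "1 - stp / 4" \<nu>] by simp
            finally show ?thesis .
          qed
          show "wpc A \<tau> (block [RAssign 14 (NConst 0) (RMul (rcell 14) (RSub (rnum 1) (RDiv (rcell 30) (rnum 4))))])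
             (3 * U) s3 (oinv f0 (Suc k))"
            apply (rule wp_block, rule wp_block_Cons, rule wp_RAssign, rule wp_block_Nil)
            subgoal premises s4 for s4
            proof -
              have "reals s3 14 0 = \<nu>" "reals s3 30 0 = stp" using s3k[of 14] s3k[of 30] stp30 \<nu>_def by simp_all
              then have r14: "reals s4 14 0 = \<nu> * (1 - stp / 4)" using s4 by simp
              have same: "reals s4 k = reals s3 k" if "k \<noteq> 14" for k using s4 that by simp
              have "inp s4" by (rule inp_cong[OF inp3]) (use s4 in auto)
              moreover have "consts_ok s4" by (rule consts_ok_cong[OF cons]) (use same s3k in auto)
              moreover have "r0ok (reals s4 5)" using same[of 5] s35 rr(2) by simp
              moreover have "current s4" using s3 same unfolding current_def by simp
              moreover have "reals s4 14 0 = f0 * (1 - stp / 4) ^ Suc k"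
                unfolding r14 \<nu>_def nu by simp
              moreover have "\<forall>x'. ff (reals s4 3) - ff x' \<le> reals s4 14 0"
                unfolding r14 using gap3 same[of 3] by simp
              ultimately show ?thesis unfolding oinv_def by blast
            qed
            by simp
        qed
      qed
    qed
  qed
  then show ?thesis
  proof (rule wpc_mono)
    have "(29 * mm + 45) * U = (29 * mm + 1) * U + 44 * U" by (simp add: algebra_simps)
    then show "19 * U + ((29 * mm + 1) * U + (9 * U + ((7 * U + 1) + 3 * U + 1) + 1) + 1) + 1 \<le> (29 * mm + 45) * U"
      using U_pos by linarith
  qed
qed

text \<open>Obtained by solving \<open>n powr p * exp (- (k * stp / 4)) \<le> \<epsilon> / (1 +
  \<epsilon>)\<close> for \<open>k\<close>, where \<open>n powr p\<close> bounds the ratio of the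
  start value to the optimum.\<close>

definition Nout :: nat where
  "Nout = nat \<lceil>(p * ln n + ln ((1 + \<epsilon>) / \<epsilon>)) * 4 / stp\<rceil>"

lemma wp_refine:
  assumes inv: "oinv (ff x0) 0 s" and apx: "\<And>x. ff x0 \<le> n powr p * ff x"
  shows "wpc A \<tau> p_refine ((Nout * (29 * mm + 46) + 1) * U) s (\<lambda>s'. \<forall>x. ff (reals s' 3) \<le> (1 + \<epsilon>) * ff x)"
proof -
  have "wpc A \<tau> p_refine (Nout * ((29 * mm + 45) * U + 1) + 1) s (\<lambda>s'. \<forall>x. ff (reals s' 3) \<le> (1 + \<epsilon>) * ff x)"
    unfolding p_refine_def
  proof (rule wpc_While[where I = "oinv (ff x0)"])
    show "oinv (ff x0) 0 s" by (rule inv)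
    fix k s1 assume inv1: "oinv (ff x0) k s1" and guard: "bval refine_guard s1"
    have f13: "reals s1 13 0 = ff (reals s1 3)" and inp1: "inp s1" and nu: "reals s1 14 0 = ff x0 * (1 - stp / 4) ^ k"
      using inv1 unfolding oinv_def current_def by auto
    have lt: "\<epsilon> / (1 + \<epsilon>) * ff (reals s1 3) < ff x0 * (1 - stp / 4) ^ k"
      using guard f13 nu rinpD[OF inp1] by simp
    have e0: "0 < \<epsilon> / (1 + \<epsilon>)" using eps by simp
    have np: "0 < real n powr p" using n2 by simp
    \<comment> \<open>With start value \<open>0\<close> the guard fails at once; otherwise this
      value cancels below.\<close>
    have f0: "0 < ff x0"
    proof (rule ccontr)
      assume "\<not> 0 < ff x0"
      then have "ff x0 = 0" using ff_nonneg[of x0] by simp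
      moreover have "0 \<le> \<epsilon> / (1 + \<epsilon>) * ff (reals s1 3)" using e0 ff_nonneg by (intro mult_nonneg_nonneg) auto
      ultimately show False using lt by simp
    qed
    have "ff x0 * (\<epsilon> / (1 + \<epsilon>)) \<le> real n powr p * ff (reals s1 3) * (\<epsilon> / (1 + \<epsilon>))"
      using apx[of "reals s1 3"] e0 by (intro mult_right_mono) auto
    also have "\<dots> = real n powr p * (\<epsilon> / (1 + \<epsilon>) * ff (reals s1 3))" by (simp only: ac_simps)
    also have "\<dots> < real n powr p * (ff x0 * (1 - stp / 4) ^ k)" using lt np by (rule mult_strict_left_mono)
    also have "\<dots> = ff x0 * (real n powr p * (1 - stp / 4) ^ k)" by (simp only: ac_simps)
    finally have "\<epsilon> / (1 + \<epsilon>) < real n powr p * (1 - stp / 4) ^ k"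
      using f0 mult_less_cancel_left_pos by blast
    also have "\<dots> \<le> real n powr p * exp (- (k * stp / 4))"
    proof -
      have "1 - stp / 4 \<le> exp (- (stp / 4))" using exp_ge_add_one_self[of "- (stp / 4)"] by simp
      then have "(1 - stp / 4) ^ k \<le> exp (- (stp / 4)) ^ k" using stp_bounds by (intro power_mono) auto
      also have "\<dots> = exp (- (k * stp / 4))" by (simp add: exp_of_nat_mult[symmetric])
      finally show ?thesis using np by (intro mult_left_mono) auto
    qed
    finally have "ln (\<epsilon> / (1 + \<epsilon>)) < ln (real n powr p * exp (- (k * stp / 4)))"
      using e0 np by (subst ln_less_cancel_iff) auto
    also have "\<dots> = p * ln n - k * stp / 4" using n2 by (simp add: ln_mult ln_powr)
    finally have "real k * stp / 4 < p * ln n + ln ((1 + \<epsilon>) / \<epsilon>)"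
      using eps by (simp add: ln_div)
    then have "real k < (p * ln n + ln ((1 + \<epsilon>) / \<epsilon>)) * 4 / stp"
      using stp_bounds(1) by (simp add: field_simps)
    then have "k < Nout" unfolding Nout_def by linarith
    then show "k < Nout \<and> wpc A \<tau> (Seq p_mwu_init (Seq p_mwu (Seq p_candidate (Seq p_accept
       (block [RAssign 14 (NConst 0) (RMul (rcell 14) (RSub (rnum 1) (RDiv (rcell 30) (rnum 4))))])))))
       ((29 * mm + 45) * U) s1 (oinv (ff x0) (Suc k))"
      using wp_refine_body[OF inv1 guard] by blast
  next
    fix k s1 assume inv1: "oinv (ff x0) k s1" and guard: "\<not> bval refine_guard s1"
    have f13: "reals s1 13 0 = ff (reals s1 3)" and inp1: "inp s1"
      and gap: "\<And>x. ff (reals s1 3) - ff x \<le> reals s1 14 0"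
      using inv1 unfolding oinv_def current_def by auto
    have "reals s1 14 0 \<le> \<epsilon> / (1 + \<epsilon>) * ff (reals s1 3)" using guard f13 rinpD[OF inp1] by simp
    then have "ff (reals s1 3) - ff x \<le> \<epsilon> / (1 + \<epsilon>) * ff (reals s1 3)" for x using gap[of x] by linarith
    then have *: "ff (reals s1 3) * (1 - \<epsilon> / (1 + \<epsilon>)) \<le> ff x" for x by (simp add: algebra_simps)
    have e: "1 - \<epsilon> / (1 + \<epsilon>) = 1 / (1 + \<epsilon>)" using eps by (simp add: field_simps)
    show "\<forall>x. ff (reals s1 3) \<le> (1 + \<epsilon>) * ff x"
      using * eps unfolding e by (simp add: field_simps)
  qed
  then show ?thesis
  proof (rule wpc_mono)
    have "Nout * ((29 * mm + 45) * U + 1) \<le> Nout * ((29 * mm + 45) * U + U)" using U_pos by (intro mult_le_mono2) simp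
    moreover have "(Nout * (29 * mm + 46) + 1) * U = Nout * ((29 * mm + 45) * U + U) + U" by (simp add: algebra_simps)
    ultimately show "Nout * ((29 * mm + 45) * U + 1) + 1 \<le> (Nout * (29 * mm + 46) + 1) * U" using U_pos by linarith
  qed
qed

end

section \<open>Running time and success probability\<close>

lemma sum_powr_le:
  fixes f :: "'i \<Rightarrow> real"
  assumes "finite I" "\<And>i. i \<in> I \<Longrightarrow> 0 \<le> f i" "1 \<le> h"
  shows "(\<Sum>i\<in>I. f i powr h) \<le> (\<Sum>i\<in>I. f i) powr h"
  using assms
proof (induction I rule: finite_induct)
  case (insert i I)
  have "(\<Sum>i\<in>insert i I. f i powr h) \<le> f i powr h + (\<Sum>i\<in>I. f i) powr h"
    using insert by simp
  also have "\<dots> \<le> (f i + (\<Sum>i\<in>I. f i)) powr h"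
    using insert by (intro powr_superadditive sum_nonneg) auto
  finally show ?case using insert by simp
qed simp

lemma safe_Cond_True:
  assumes "\<And>s. \<phi> s < 1 \<Longrightarrow> bval b s" "safe A \<tau> c1 T \<phi> \<psi>"
  shows "safe A \<tau> (Cond b c1 c2) (T + 1) \<phi> \<psi>"
  unfolding safe_def
proof (intro allI impI)
  fix s cs t L
  assume L: "halting L" and post: "\<forall>s' t'. t' \<le> t + (T + 1) \<longrightarrow> 1 - \<psi> s' \<le> hit A \<tau> L (cs, s', t')"
  show "1 - \<phi> s \<le> hit A \<tau> L (Cond b c1 c2 # cs, s, t)"
  proof (cases "\<phi> s < 1")
    case True
    then have "bval b s" by (rule assms(1))
    then have "hit A \<tau> L (Cond b c1 c2 # cs, s, t) = hit A \<tau> L (c1 # cs, s, t + 1)"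
      by (intro hit_det[OF L]) simp
    moreover have "\<forall>s' t'. t' \<le> t + 1 + T \<longrightarrow> 1 - \<psi> s' \<le> hit A \<tau> L (cs, s', t')" using post by simp
    ultimately show ?thesis using assms(2) L unfolding safe_def by metis
  next
    case False
    then show ?thesis using hit_nonneg[of A \<tau> L "(Cond b c1 c2 # cs, s, t)"] by linarith
  qed
qed

lemma safe_returns:
  assumes "safe A \<tau> P T \<phi> (\<lambda>s. if Q (output_vec (dim_col A) s) then 0 else 1)" "real T \<le> B"
  shows "1 - \<phi> s \<le> prob_returns_within A \<tau> P s B Q"
proof -
  let ?L = "{(cs, s', t). cs = [] \<and> real t \<le> B \<and> Q (output_vec (dim_col A) s')} :: config set"
  have "halting ?L" unfolding halting_def by auto
  moreover have "1 - (if Q (output_vec (dim_col A) s') then 0 else 1) \<le> hit A \<tau> ?L ([], s', t')" if "t' \<le> 0 + T" for s' t'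
    using that assms(2) hit_halted[of s' t' ?L] hit_nonneg[of A \<tau> ?L "([], s', t')"] by auto
  ultimately have "1 - \<phi> s \<le> hit A \<tau> ?L ([P], s, 0)" using assms(1) unfolding safe_def by blast
  then show ?thesis unfolding prob_returns_within_def hit_def .
qed

lemma prob_returns_within_nonneg: "0 \<le> prob_returns_within A \<tau> P s B Q"
  using hit_nonneg unfolding prob_returns_within_def hit_def .

context regression
begin

lemma lp_norm_ff:
  assumes "y \<in> carrier_vec d"
  shows "lp_norm p (A *\<^sub>v y - b) = ff (vec_index y) powr (1 / p)"
proof -
  have y: "Matrix.vec d (vec_index y) = y" using assms by auto
  have "(A *\<^sub>v y - b) $ i = mv (vec_index y) i - b $ i" if "i < n" for i
    using mult_index[OF that, of "vec_index y"] that b unfolding y by simp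
  then show ?thesis unfolding lp_norm_def ff_def pw_def by simp
qed

text \<open>A factor \<open>1 + \<epsilon>\<close> between \<open>p\<close>-th powers is more than
  enough, since its \<open>p\<close>-th root is at most \<open>1 + \<epsilon>\<close>.\<close>

lemma accurate_of_ff:
  assumes p: "2 \<le> p" and x: "\<And>x'. ff x \<le> (1 + \<epsilon>) * ff x'"
  shows "accurate_lp_solution p \<epsilon> A b (Matrix.vec d x)"
proof -
  let ?y = "Matrix.vec d x"
  have ffy: "ff (vec_index ?y) = ff x" by (rule ff_cong) simp
  have le: "lp_norm p (A *\<^sub>v ?y - b) / (1 + \<epsilon>) \<le> lp_norm p (A *\<^sub>v x' - b)" if "x' \<in> carrier_vec d" for x'
  proof -
    have "ff x powr (1 / p) \<le> ((1 + \<epsilon>) * ff (vec_index x')) powr (1 / p)"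
      using x ff_nonneg p by (intro powr_mono2) auto
    also have "\<dots> = (1 + \<epsilon>) powr (1 / p) * ff (vec_index x') powr (1 / p)"
      by (simp add: powr_mult)
    also have "\<dots> \<le> (1 + \<epsilon>) powr 1 * ff (vec_index x') powr (1 / p)"
      using eps p by (intro mult_right_mono powr_mono) auto
    finally show ?thesis
      unfolding lp_norm_ff[OF that] lp_norm_ff[OF vec_carrier] ffy using eps by (simp add: field_simps)
  qed
  have "lp_norm p (A *\<^sub>v ?y - b) / (1 + \<epsilon>) \<le> (INF x' \<in> carrier_vec (dim_col A). lp_norm p (A *\<^sub>v x' - b))"
  proof (rule cINF_greatest)
    show "carrier_vec (dim_col A) \<noteq> ({} :: real Matrix.vec set)" using zero_carrier_vec[of "dim_col A"] by blast
  qed (use le in simp)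
  then show ?thesis unfolding accurate_lp_solution_def using eps by (simp add: field_simps)
qed

text \<open>The \<open>p\<close>-norm is at most the Euclidean norm, which the start minimizes, and
  every coordinate of a competitor's residual is at most its \<open>p\<close>-norm. A crude factor
  suffices because it enters the number of passes through its logarithm.\<close>

lemma least_squares_ff:
  assumes p: "2 \<le> p" and ls: "least_squares x"
  shows "ff x \<le> real n powr p * ff x'"
proof -
  have e: "\<bar>t\<bar> powr p = (t\<^sup>2) powr (p / 2)" for t :: real
    using square_powr[of t "p / 2"] by (simp add: power2_eq_square)
  have nn: "0 \<le> (\<Sum>i<n. (mv x i - b $ i)\<^sup>2)" by (intro sum_nonneg) auto
  have "ff x = (\<Sum>i<n. ((mv x i - b $ i)\<^sup>2) powr (p / 2))" unfolding ff_def pw_def e ..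
  also have "\<dots> \<le> (\<Sum>i<n. (mv x i - b $ i)\<^sup>2) powr (p / 2)" using p by (intro sum_powr_le) auto
  also have "\<dots> \<le> (\<Sum>i<n. (mv x' i - b $ i)\<^sup>2) powr (p / 2)"
    using ls nn p unfolding least_squares_def by (intro powr_mono2) auto
  also have "\<dots> \<le> (real n * ff x' powr (2 / p)) powr (p / 2)"
  proof (intro powr_mono2)
    have "(mv x' i - b $ i)\<^sup>2 \<le> ff x' powr (2 / p)" if i: "i < n" for i
    proof -
      have "\<bar>mv x' i - b $ i\<bar> powr p \<le> ff x'"
        unfolding ff_def pw_def using i by (intro member_le_sum) auto
      then have "(\<bar>mv x' i - b $ i\<bar> powr p) powr (2 / p) \<le> ff x' powr (2 / p)"
        using p by (intro powr_mono2) auto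
      moreover have "(\<bar>mv x' i - b $ i\<bar> powr p) powr (2 / p) = (mv x' i - b $ i)\<^sup>2"
        using p by (cases "mv x' i - b $ i = 0") (simp_all add: powr_powr powr_numeral)
      ultimately show ?thesis by simp
    qed
    then show "(\<Sum>i<n. (mv x' i - b $ i)\<^sup>2) \<le> real n * ff x' powr (2 / p)"
      using sum_bounded_above[of "{..<n}" "\<lambda>i. (mv x' i - b $ i)\<^sup>2" "ff x' powr (2 / p)"] by simp
  qed (use p in \<open>auto intro: sum_nonneg\<close>)
  also have "\<dots> = real n powr (p / 2) * ff x'"
  proof -
    have "(ff x' powr (2 / p)) powr (p / 2) = ff x' powr 1" unfolding powr_powr using p by simp
    then show ?thesis using ff_nonneg[of x'] by (simp add: powr_mult)
  qed
  also have "\<dots> \<le> real n powr p * ff x'"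
    using d0 dn p ff_nonneg by (intro mult_right_mono powr_mono) auto
  finally show ?thesis .
qed

lemma least_squares_ff_two:
  assumes "p = 2" "least_squares x"
  shows "ff x \<le> ff x'"
proof -
  have "ff z = (\<Sum>i<n. (mv z i - b $ i)\<^sup>2)" for z
    unfolding ff_def pw_def by (intro sum.cong refl) (simp add: assms(1) powr_numeral)
  then show ?thesis using assms(2) unfolding least_squares_def by simp
qed

end

section \<open>Explicit bounds on time and failure\<close>

context lewis_run
begin

abbreviation lf :: real where "lf \<equiv> log_factor n \<epsilon>"
abbreviation de :: real where "de \<equiv> real d powr ((p - 2) / (3 * p - 2))"

lemma lf_ge: "1 \<le> lf" "ln n \<le> lf - 1"
  unfolding log_factor_def using n2 by (auto simp: add_nonneg_nonneg)

lemma de_ge: "1 \<le> de"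
  using d0 p by (intro ge_one_powr_ge_zero) auto

lemma ell_le: "real ell \<le> 2 * lf" "ell \<le> n"
proof -
  have "2 ^ (ell - 1) \<le> real n" using ell(4) by (metis less_imp_le of_nat_le_iff of_nat_numeral of_nat_power)
  then have "ln (2 ^ (ell - 1)) \<le> ln (real n)" using n2 by (subst ln_le_cancel_iff) auto
  then have "real (ell - 1) * ln 2 \<le> ln n" by (simp add: ln_realpow)
  moreover have "real (ell - 1) * (1 / 2) \<le> real (ell - 1) * ln 2"
    using ln2_ge_two_thirds by (intro mult_left_mono) auto
  ultimately have "real (ell - 1) \<le> 2 * ln n" by simp
  then show "real ell \<le> 2 * lf" using lf_ge ell(3) by (simp add: of_nat_diff)
  have "ell - 1 < 2 ^ (ell - 1)" by simp
  then show "ell \<le> n" using ell(4) by linarith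
qed

lemma JJ_le:
  assumes "1 \<le> cc" shows "real JJ + 1 \<le> 17 * cc * lf"
proof -
  have "real JJ = 8 * real cc * real ell" unfolding JJ_def by simp
  also have "\<dots> \<le> 8 * real cc * (2 * lf)" using ell_le by (intro mult_left_mono) auto
  finally have "real JJ \<le> 16 * (cc * lf)" by simp
  moreover have "1 * 1 \<le> cc * lf" using assms lf_ge by (intro mult_mono) auto
  ultimately show ?thesis by simp
qed

text \<open>The exponent \<open>p / (3 * p - 2)\<close> in \<open>Iot\<close> cancels against that
  of \<open>Lam\<close>, leaving \<open>d powr ((p - 2) / (3 * p - 2))\<close>; the logarithmic
  factor has exponent at most \<open>1\<close> and is bounded by itself. In \<open>5034\<close>,
  \<open>296 * 17\<close> comes from \<open>Lam\<close> and \<open>2\<close> from the summand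
  \<open>1\<close> and rounding.\<close>

lemma mm_le:
  assumes cc: "1 \<le> cc" shows "real mm \<le> 5034 * cc * lf * de"
proof -
  let ?e = "(p - 2) / (3 * p - 2)"
  have e: "0 \<le> ?e" "?e \<le> 1" using p by auto
  have le: "x powr ?e \<le> x" if "1 \<le> x" for x :: real
    using powr_mono[OF e(2) that] that by simp
  have B: "1 \<le> 296 * (real JJ + 1)" by simp
  have "Lam powr (p / (3 * p - 2)) = (296 * ((real JJ + 1) * d)) powr ?e"
    unfolding Lam_def powr_powr using p by simp
  also have "\<dots> = (296 * (real JJ + 1)) powr ?e * de"
    unfolding mult.assoc[symmetric] powr_mult[of "296 * (real JJ + 1)"] ..
  also have "\<dots> \<le> (296 * (real JJ + 1)) * de" using le[OF B] by (intro mult_right_mono) auto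
  also have "\<dots> \<le> (296 * (17 * cc * lf)) * de" using JJ_le[OF cc] by (intro mult_right_mono mult_left_mono) auto
  finally have L: "Lam powr (p / (3 * p - 2)) \<le> 5032 * (cc * lf * de)" by (simp add: ac_simps)
  have "1 * 1 * 1 \<le> cc * lf * de" using cc lf_ge de_ge by (intro mult_mono) auto
  then have one: "1 \<le> cc * lf * de" by simp
  have "real mm \<le> Iot + 1" unfolding mm_def using Iot_ge(1) by linarith
  then have "real mm \<le> 5034 * (cc * lf * de)" using L one unfolding Iot_def by linarith
  then show ?thesis by (simp add: ac_simps)
qed

lemma Nout_le: "real Nout \<le> (1 + 4 * p / stp) * lf"
proof -
  have "ln ((1 + \<epsilon>) / \<epsilon>) \<le> 1 + max 0 (ln (1 / \<epsilon>))"
  proof -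
    have "(1 + \<epsilon>) / \<epsilon> = 1 + 1 / \<epsilon>" using eps by (simp add: field_simps)
    also have "\<dots> \<le> 2 * max 1 (1 / \<epsilon>)" by simp
    finally have "ln ((1 + \<epsilon>) / \<epsilon>) \<le> ln (2 * max 1 (1 / \<epsilon>))" using eps by (subst ln_le_cancel_iff) auto
    also have "\<dots> = ln 2 + ln (max 1 (1 / \<epsilon>))" by (subst ln_mult) auto
    also have "ln (max 1 (1 / \<epsilon>)) \<le> max 0 (ln (1 / \<epsilon>))" by (auto simp: max_def)
    also have "ln 2 \<le> (1::real)" using ln_le_minus_one[of "2::real"] by simp
    finally show ?thesis by simp
  qed
  then have "p * ln n + ln ((1 + \<epsilon>) / \<epsilon>) \<le> p * ln n + p * (1 + max 0 (ln (1 / \<epsilon>)))"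
    using p mult_right_mono[of 1 p "1 + max 0 (ln (1 / \<epsilon>))"] by (simp add: add_nonneg_nonneg)
  also have "\<dots> = p * lf" unfolding log_factor_def by (simp add: algebra_simps)
  finally have "(p * ln n + ln ((1 + \<epsilon>) / \<epsilon>)) * 4 / stp \<le> p * lf * 4 / stp"
    using stp_bounds(1) by (intro divide_right_mono mult_right_mono) auto
  moreover have "0 \<le> p * lf * 4 / stp" using stp_bounds(1) p lf_ge by (intro divide_nonneg_nonneg mult_nonneg_nonneg) auto
  ultimately have "real Nout \<le> p * lf * 4 / stp + 1" unfolding Nout_def by linarith
  also have "\<dots> \<le> p * lf * 4 / stp + lf" using lf_ge by simp
  also have "\<dots> = (1 + 4 * p / stp) * lf" by (simp add: algebra_simps)
  finally show ?thesis .
qed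

text \<open>Each phase costs two logarithmic factors: rounds times samples for the weights, passes
  times inner steps for the refinement. The power of \<open>d\<close> comes from the inner
  steps.\<close>

lemma time_le:
  assumes cc: "1 \<le> cc"
  shows "real (lewis_time + (Nout * (29 * mm + 46) + 31) * U)
    \<le> 16 * ((576 * real cc + 81) + (1 + 4 * p / \<bar>stp\<bar>) * (145986 * real cc + 46) + 31) * lf ^ 2 * (de * real SS)"
proof -
  let ?S = "1 + 4 * p / stp"
  have S0: "0 \<le> ?S" using stp_bounds p by (intro add_nonneg_nonneg divide_nonneg_nonneg) auto
  have l2: "lf \<le> lf ^ 2" "1 \<le> lf ^ 2"
    using lf_ge mult_left_mono[of 1 lf lf] one_le_power[of lf 2] by (simp_all add: power2_eq_square)
  have l2de: "lf ^ 2 \<le> lf ^ 2 * de" "lf \<le> lf * de" "1 \<le> lf * de" "1 \<le> lf ^ 2 * de"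
  proof -
    show "lf ^ 2 \<le> lf ^ 2 * de" using mult_left_mono[OF de_ge, of "lf ^ 2"] by simp
    show "lf \<le> lf * de" using de_ge lf_ge mult_left_mono[of 1 de lf] by simp
    then show "1 \<le> lf * de" using lf_ge by linarith
    show "1 \<le> lf ^ 2 * de" using \<open>lf ^ 2 \<le> lf ^ 2 * de\<close> l2 by linarith
  qed
  have "real ell * (18 * real JJ + 27) + 27 \<le> 2 * lf * (18 * (16 * (cc * lf)) + 27) + 27"
  proof (intro add_right_mono mult_mono)
    have "real JJ = 8 * real cc * real ell" unfolding JJ_def by simp
    also have "\<dots> \<le> 8 * real cc * (2 * lf)" using ell_le by (intro mult_left_mono) auto
    finally show "real JJ \<le> 16 * (cc * lf)" by simp
  qed (use ell_le lf_ge in auto)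
  also have "\<dots> = 576 * real cc * lf ^ 2 + 54 * lf + 27" by (simp add: algebra_simps power2_eq_square)
  also have "\<dots> \<le> (576 * real cc + 81) * lf ^ 2" using l2 by (simp add: algebra_simps)
  also have "\<dots> \<le> (576 * real cc + 81) * (lf ^ 2 * de)" using l2de by (intro mult_left_mono) auto
  finally have T1: "real ell * (18 * real JJ + 27) + 27 \<le> (576 * real cc + 81) * (lf ^ 2 * de)" .
  have "29 * real mm + 46 \<le> 29 * (5034 * cc * lf * de) + 46 * (lf * de)"
    using mm_le[OF cc] l2de by (intro add_mono mult_left_mono) auto
  also have "\<dots> = (145986 * real cc + 46) * (lf * de)" by (simp add: algebra_simps)
  finally have m: "29 * real mm + 46 \<le> (145986 * real cc + 46) * (lf * de)" .
  have "real Nout * (29 * real mm + 46) \<le> (?S * lf) * ((145986 * real cc + 46) * (lf * de))"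
    using Nout_le m S0 lf_ge by (intro mult_mono) auto
  also have "\<dots> = ?S * (145986 * real cc + 46) * (lf ^ 2 * de)" by (simp add: power2_eq_square ac_simps)
  finally have T2: "real Nout * (29 * real mm + 46) \<le> ?S * (145986 * real cc + 46) * (lf ^ 2 * de)" .
  have T3: "31 \<le> 31 * (lf ^ 2 * de)" using l2de by simp
  have "real (lewis_time + (Nout * (29 * mm + 46) + 31) * U)
    = ((real ell * (18 * real JJ + 27) + 27) + real Nout * (29 * real mm + 46) + 31) * real U"
    unfolding lewis_time_def by (simp add: algebra_simps)
  also have "\<dots> \<le> ((576 * real cc + 81) * (lf ^ 2 * de) + ?S * (145986 * real cc + 46) * (lf ^ 2 * de) + 31 * (lf ^ 2 * de)) * real U"
    using T1 T2 T3 by (intro mult_right_mono add_mono) auto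
  also have "\<dots> = 16 * ((576 * real cc + 81) + ?S * (145986 * real cc + 46) + 31) * lf ^ 2 * (de * real SS)"
    unfolding U_def by (simp add: algebra_simps)
  finally show ?thesis using stp_bounds(1) by simp
qed

text \<open>Eight samples fail together with probability at most one half, so
  \<open>8 * cc * ell\<close> of them with at most \<open>n powr (- cc)\<close>, as
  \<open>n \<le> 2 ^ ell\<close>. There are at most \<open>n\<^sup>2\<close> pairs of a round and a
  row, whence \<open>C + 2\<close>.\<close>

lemma failure_le:
  assumes "C + 2 \<le> real cc"
  shows "real ell * n * q0 ^ JJ \<le> real n powr (- C)"
proof -
  have n1: "1 \<le> real n" using n2 by simp
  have "q0 ^ 8 \<le> 1 / 2" unfolding q0_def by (simp add: power_divide)
  then have "(q0 ^ 8) ^ (cc * ell) \<le> (1 / 2) ^ (cc * ell)" using q0_pos by (intro power_mono) auto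
  moreover have "q0 ^ JJ = (q0 ^ 8) ^ (cc * ell)" unfolding JJ_def by (simp add: power_mult mult.assoc)
  moreover have "((1::real) / 2) ^ (cc * ell) = (1 / 2 ^ ell) ^ cc"
    by (simp add: power_mult[symmetric] power_divide mult.commute)
  ultimately have "q0 ^ JJ \<le> (1 / 2 ^ ell) ^ cc" by simp
  also have "\<dots> \<le> (1 / real n) ^ cc"
  proof (intro power_mono divide_left_mono)
    show "real n \<le> 2 ^ ell" using ell(1) by (metis of_nat_le_iff of_nat_numeral of_nat_power)
  qed (use n2 in auto)
  also have "\<dots> = real n powr (- real cc)" using n2 by (simp add: powr_minus powr_realpow power_inverse divide_inverse)
  finally have q: "q0 ^ JJ \<le> real n powr (- real cc)" .
  have "real ell * n * q0 ^ JJ \<le> real n * n * real n powr (- real cc)"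
    using ell_le(2) q q0_pos by (intro mult_mono) auto
  also have "real n * n = real n powr 2" using n2 by (simp add: powr_numeral power2_eq_square)
  also have "real n powr 2 * real n powr (- real cc) = real n powr (2 + - real cc)" by (simp only: powr_add)
  also have "\<dots> \<le> real n powr (- C)" using assms n1 by (intro powr_mono) auto
  finally show ?thesis .
qed


lemma safe_tail:
  assumes X: "\<And>i. i < n \<Longrightarrow> X 12 i = mv (X 3) i - b $ i" "X 13 0 = ff (X 3)" "least_squares (X 3)"
  shows "safe A \<tau> (Seq (p_lewis cc) (Seq p_consts p_refine))
    (lewis_time + (13 * U + (Nout * (29 * mm + 46) + 1) * U + 1) + 1)
    (\<lambda>s. if base s then real ell * n * q0 ^ JJ else 1)
    (\<lambda>s. if accurate_lp_solution p \<epsilon> A b (output_vec (dim_col A) s) then 0 else 1)"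
proof (rule safe_Seq[OF safe_lewis], rule safe_wpc)
  fix s assume "(if lewis_post s then 0 else 1) < (1::real)"
  then have post: "lewis_post s" by (auto split: if_splits)
  then have log: "logged s" and r0: "r0ok (reals s 5)"
    unfolding lewis_post_def r0ok_def Lam_def by auto
  have eqs: "reals s 3 = X 3" "reals s 12 = X 12" "reals s 13 = X 13" using log unfolding logged_def base_def by auto
  have cur: "current s" unfolding current_def eqs using X by simp
  have ls: "least_squares (reals s 3)" unfolding eqs by (rule X(3))
  have p2: "2 \<le> p" using p by simp
  have "wpc A \<tau> (Seq p_consts p_refine) (13 * U + (Nout * (29 * mm + 46) + 1) * U + 1) s
    (\<lambda>s'. \<forall>x. ff (reals s' 3) \<le> (1 + \<epsilon>) * ff x)"
  proof (rule wpc_Seq, rule wpc_mono[OF wp_consts[OF log r0 cur ls] order_refl])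
    fix s1 assume s1: "inp s1 \<and> consts_ok s1 \<and> r0ok (reals s1 5) \<and> current s1 \<and>
      least_squares (reals s1 3) \<and> reals s1 14 0 = ff (reals s1 3)"
    have "oinv (ff (reals s1 3)) 0 s1" unfolding oinv_def using s1 ff_nonneg by simp
    moreover have "ff (reals s1 3) \<le> n powr p * ff x" for x using least_squares_ff[OF p2] s1 by blast
    ultimately show "wpc A \<tau> p_refine ((Nout * (29 * mm + 46) + 1) * U) s1 (\<lambda>s'. \<forall>x. ff (reals s' 3) \<le> (1 + \<epsilon>) * ff x)"
      by (rule wp_refine)
  qed
  then show "wpc A \<tau> (Seq p_consts p_refine) (13 * U + (Nout * (29 * mm + 46) + 1) * U + 1) s
    (\<lambda>s'. (if accurate_lp_solution p \<epsilon> A b (output_vec (dim_col A) s') then 0 else 1)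
        \<le> (if lewis_post s then 0 else (1::real)))"
  proof (rule wpc_mono[OF _ order_refl])
    fix s' :: store assume "\<forall>x. ff (reals s' 3) \<le> (1 + \<epsilon>) * ff x"
    then have "accurate_lp_solution p \<epsilon> A b (output_vec (dim_col A) s')"
      unfolding output_vec_def read_vec_def dims by (intro accurate_of_ff[OF p2]) blast
    then show "(if accurate_lp_solution p \<epsilon> A b (output_vec (dim_col A) s') then 0 else 1)
        \<le> (if lewis_post s then 0 else (1::real))" using post by simp
  qed
qed

end

definition time_const :: "nat \<Rightarrow> real \<Rightarrow> real" where
  "time_const cc p = 16 * ((576 * real cc + 81) + (1 + 4 * p / \<bar>lewis_run.stp p\<bar>) * (145986 * real cc + 46) + 31)"

lemma (in regression) main_bound:
  assumes p: "2 \<le> p" and n2: "2 \<le> n" and cc: "1 \<le> cc" "C + 2 \<le> real cc"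
  shows "1 - real n powr (- C) \<le> prob_returns_within A \<tau> (p_main cc) (input_store A b p \<epsilon>)
    (time_const cc p * log_factor n \<epsilon> ^ 2 * (real d powr ((p - 2) / (3 * p - 2)) * real (solve_time A \<tau>)))
    (accurate_lp_solution p \<epsilon> A b)"
proof -
  let ?s0 = "input_store A b p \<epsilon>"
  let ?\<psi> = "\<lambda>s. if accurate_lp_solution p \<epsilon> A b (output_vec (dim_col A) s) then 0 else (1::real)"
  let ?rest = "Seq (p_lewis cc) (Seq p_consts p_refine)"
  \<comment> \<open>The initial phase is deterministic, so its result can be named and serve as the
    ghost memory of \<open>lewis_run\<close>.\<close>
  obtain s1 where init: "wpc A \<tau> p_init (13 * U) ?s0 (\<lambda>s'. s' = s1)"
    and s1: "inp s1" "current s1" "least_squares (reals s1 3)"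
    using wp_init[OF inp_input_store] unfolding wpc_def by blast
  show ?thesis
  proof (cases "p = 2")
    case True
    have "wpc A \<tau> (p_main cc) (13 * U + (1 + 1) + 1) ?s0 (\<lambda>s'. s' = s1)"
      unfolding p_main_def
    proof (rule wpc_Seq, rule wpc_mono[OF init order_refl])
      fix s assume s: "s = s1"
      show "wpc A \<tau> (Cond (RLess (rnum 2) eP) ?rest SKIP) (1 + 1) s (\<lambda>s'. s' = s1)"
      proof (rule wpc_Cond)
        assume "bval (RLess (rnum 2) eP) s"
        then show "wpc A \<tau> ?rest 1 s (\<lambda>s'. s' = s1)" using rinpD[OF s1(1)] s True by simp
      qed (rule wpc_SKIP, rule s)
    qed
    moreover have "?\<psi> s1 = 0"
    proof -
      have "ff (reals s1 3) \<le> (1 + \<epsilon>) * ff x" for x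
      proof -
        have "ff (reals s1 3) \<le> 1 * ff x" using least_squares_ff_two[OF True s1(3)] by simp
        also have "\<dots> \<le> (1 + \<epsilon>) * ff x" using eps ff_nonneg by (intro mult_right_mono) auto
        finally show ?thesis .
      qed
      then show ?thesis unfolding output_vec_def read_vec_def dims using accurate_of_ff[OF p] by simp
    qed
    ultimately have "safe A \<tau> (p_main cc) (13 * U + (1 + 1) + 1) (\<lambda>s. if s = ?s0 then 0 else 1) ?\<psi>"
      by (intro safe_wpc) (auto split: if_splits intro: wpc_mono[OF _ order_refl])
    from safe_returns[OF this, where s = ?s0]
    have ret: "1 \<le> prob_returns_within A \<tau> (p_main cc) ?s0 B (accurate_lp_solution p \<epsilon> A b)"
      if "real (13 * U + (1 + 1) + 1) \<le> B" for B using that by simp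
    have "real (13 * U + (1 + 1) + 1) \<le> 16 * real U" using U_pos by linarith
    also have "\<dots> = 16 * 16 * 1 * (1 * real SS)" unfolding U_def by simp
    also have "\<dots> \<le> time_const cc p * log_factor n \<epsilon> ^ 2 * (real d powr ((p - 2) / (3 * p - 2)) * real SS)"
    proof (intro mult_mono)
      have "0 \<le> (1 + 4 * p / \<bar>lewis_run.stp p\<bar>) * (145986 * real cc + 46)"
        using p by (intro mult_nonneg_nonneg add_nonneg_nonneg divide_nonneg_nonneg) auto
      then show "16 * 16 \<le> time_const cc p" unfolding time_const_def by (simp del: abs_divide)
      show "1 \<le> log_factor n \<epsilon> ^ 2"
        unfolding log_factor_def using n2 by (intro one_le_power) (simp add: add_nonneg_nonneg)
      show "1 \<le> real d powr ((p - 2) / (3 * p - 2))" using True d0 by simp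
      show "0 \<le> time_const cc p" using \<open>16 * 16 \<le> time_const cc p\<close> by simp
      then show "0 \<le> time_const cc p * log_factor n \<epsilon> ^ 2" by simp
    qed auto
    finally have "1 \<le> prob_returns_within A \<tau> (p_main cc) ?s0
      (time_const cc p * log_factor n \<epsilon> ^ 2 * (real d powr ((p - 2) / (3 * p - 2)) * real SS))
      (accurate_lp_solution p \<epsilon> A b)" by (rule ret)
    then show ?thesis unfolding SS_def by (smt (verit) powr_ge_zero)
  next
    case False
    then have p2: "2 < p" using p by simp
    interpret L: lewis_run A b p \<epsilon> \<tau> n d cc "reals s1" by unfold_locales (use p2 n2 in auto)
    let ?\<delta> = "real L.ell * n * L.q0 ^ L.JJ"
    define T where "T = L.lewis_time + (13 * U + (L.Nout * (29 * L.mm + 46) + 1) * U + 1) + 1"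
    have base: "L.base s1" unfolding L.base_def using s1(1) by simp
    have tail: "safe A \<tau> ?rest T (\<lambda>s. if s = s1 then ?\<delta> else 1) ?\<psi>"
    proof (rule safe_mono)
      show "safe A \<tau> ?rest T (\<lambda>s. if L.base s then ?\<delta> else 1) ?\<psi>"
        unfolding T_def by (rule L.safe_tail) (use s1 in \<open>auto simp: current_def\<close>)
      show "(if L.base s then ?\<delta> else 1) \<le> (if s = s1 then ?\<delta> else 1)"
        if "(if L.base s then ?\<delta> else 1) < 1 \<or> (if s = s1 then ?\<delta> else 1) < 1" for s
        using that base by (auto split: if_splits)
    qed auto
    have "safe A \<tau> (Cond (RLess (rnum 2) eP) ?rest SKIP) (T + 1) (\<lambda>s. if s = s1 then ?\<delta> else 1) ?\<psi>"
      by (rule safe_Cond_True[OF _ tail]) (use rinpD[OF s1(1)] p2 in \<open>auto split: if_splits\<close>)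
    moreover have "safe A \<tau> p_init (13 * U) (\<lambda>s. if s = ?s0 then ?\<delta> else 1) (\<lambda>s. if s = s1 then ?\<delta> else 1)"
    proof (rule safe_wpc)
      fix s assume "(if s = ?s0 then ?\<delta> else 1) < 1"
      then have "s = ?s0" by (auto split: if_splits)
      then show "wpc A \<tau> p_init (13 * U) s (\<lambda>s'. (if s' = s1 then ?\<delta> else 1) \<le> (if s = ?s0 then ?\<delta> else 1))"
        using wpc_mono[OF init order_refl] by simp
    qed
    ultimately have "safe A \<tau> (p_main cc) (13 * U + (T + 1) + 1) (\<lambda>s. if s = ?s0 then ?\<delta> else 1) ?\<psi>"
      unfolding p_main_def by (intro safe_Seq)
    from safe_returns[OF this, where s = ?s0]
    have ret: "1 - ?\<delta> \<le> prob_returns_within A \<tau> (p_main cc) ?s0 B (accurate_lp_solution p \<epsilon> A b)"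
      if "real (13 * U + (T + 1) + 1) \<le> B" for B using that by simp
    have "13 * U + (T + 1) + 1 \<le> L.lewis_time + (L.Nout * (29 * L.mm + 46) + 31) * U"
    proof -
      have "(L.Nout * (29 * L.mm + 46) + 31) * U = (L.Nout * (29 * L.mm + 46) + 1) * U + 30 * U"
        by (simp only: add_mult_distrib[symmetric]) simp
      then show ?thesis unfolding T_def using U_pos by linarith
    qed
    then have "real (13 * U + (T + 1) + 1) \<le> real (L.lewis_time + (L.Nout * (29 * L.mm + 46) + 31) * U)"
      by (simp only: of_nat_le_iff)
    also have "\<dots> \<le> time_const cc p * log_factor n \<epsilon> ^ 2 * (real d powr ((p - 2) / (3 * p - 2)) * real SS)"
      unfolding time_const_def by (rule L.time_le[OF cc(1)])
    finally have "1 - ?\<delta> \<le> prob_returns_within A \<tau> (p_main cc) ?s0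
      (time_const cc p * log_factor n \<epsilon> ^ 2 * (real d powr ((p - 2) / (3 * p - 2)) * real SS))
      (accurate_lp_solution p \<epsilon> A b)" by (rule ret)
    then show ?thesis using L.failure_le[OF cc(2)] unfolding SS_def by linarith
  qed
qed

theorem theorem1p2:
  shows "\<forall>C::real. \<exists>(P::com) (k::nat) (K::real \<Rightarrow> real).
    \<forall>(n::nat) (d::nat) (A::real mat) (b::real Matrix.vec) (p::real) (\<epsilon>::real) (\<tau>::nat).
      A \<in> carrier_mat n d \<and> 0 < d \<and> d \<le> n \<and> vec_space.rank n A = d \<and>
      b \<in> carrier_vec n \<and> 2 \<le> p \<and> 0 < \<epsilon> \<longrightarrow>
      prob_returns_within A \<tau> P (input_store A b p \<epsilon>)
        (K p * log_factor n \<epsilon> ^ k *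
          (real d powr ((p - 2) / (3 * p - 2)) * real (solve_time A \<tau>)))
        (accurate_lp_solution p \<epsilon> A b)
      \<ge> 1 - real n powr (- C)"
proof
  fix C :: real
  \<comment> \<open>The summand \<open>2\<close> pays for the union bound over rounds and
    rows.\<close>
  define cc where "cc = nat \<lceil>C\<rceil> + 2"
  have cc: "1 \<le> cc" "C + 2 \<le> real cc" unfolding cc_def by linarith+
  show "\<exists>(P::com) (k::nat) (K::real \<Rightarrow> real).
    \<forall>(n::nat) (d::nat) (A::real mat) (b::real Matrix.vec) (p::real) (\<epsilon>::real) (\<tau>::nat).
      A \<in> carrier_mat n d \<and> 0 < d \<and> d \<le> n \<and> vec_space.rank n A = d \<and>
      b \<in> carrier_vec n \<and> 2 \<le> p \<and> 0 < \<epsilon> \<longrightarrow>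
      prob_returns_within A \<tau> P (input_store A b p \<epsilon>)
        (K p * log_factor n \<epsilon> ^ k *
          (real d powr ((p - 2) / (3 * p - 2)) * real (solve_time A \<tau>)))
        (accurate_lp_solution p \<epsilon> A b)
      \<ge> 1 - real n powr (- C)"
  proof (intro exI[of _ "p_main cc"] exI[of _ "2::nat"] exI[of _ "time_const cc"] allI impI)
    fix n d :: nat and A :: "real mat" and b :: "real Matrix.vec" and p \<epsilon> :: real and \<tau> :: nat
    assume h: "A \<in> carrier_mat n d \<and> 0 < d \<and> d \<le> n \<and> vec_space.rank n A = d \<and>
      b \<in> carrier_vec n \<and> 2 \<le> p \<and> 0 < \<epsilon>"
    show "1 - real n powr (- C) \<le> prob_returns_within A \<tau> (p_main cc) (input_store A b p \<epsilon>)
        (time_const cc p * log_factor n \<epsilon> ^ 2 *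
          (real d powr ((p - 2) / (3 * p - 2)) * real (solve_time A \<tau>)))
        (accurate_lp_solution p \<epsilon> A b)"
    proof (cases "n = 1")
      \<comment> \<open>For \<open>n = 1\<close> the lower bound is
        \<open>1 - 1 = 0\<close>.\<close>
      case True
      then show ?thesis using prob_returns_within_nonneg by simp
    next
      case False
      interpret regression A b p \<epsilon> \<tau> n d by unfold_locales (use h in auto)
      show ?thesis by (rule main_bound) (use h False cc in auto)
    qed
  qed
qed

end
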